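(* Let $(B,\mathcal{A})$ be an integral affine manifold of dimension $n$ with linear holonomy $\mathfrak{l}$, and let $(\mathrm{T}^*B/P_{(B,\mathcal{A})},\omega_0)\to B$ be its symplectic reference bundle. The cohomology class $w_0\in\mathrm{H}^1(B;\mathrm{H}^1(\mathbb{R}^n/\mathbb{Z}^n;\mathbb{R})_{\mathfrak{l}})$ defined by the symplectic form $\omega_0$ is mapped to the radiance obstruction $r_{(B,\mathcal{A})}\in\mathrm{H}^1(B;\mathbb{R}^n_{\mathfrak{l}})$ by the isomorphism $$\Phi:\mathrm{H}^1(B;\mathrm{H}^1(\mathbb{R}^n/\mathbb{Z}^n;\mathbb{R})_{\mathfrak{l}})\to\mathrm{H}^1(B;\mathbb{R}^n_{\mathfrak{l}})$$ induced by $\omega_0$; that is, $\Phi(w_0)=r_{(B,\mathcal{A})}$.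
   Context: Manifolds are smooth and connected. An integral affine manifold $(B,\mathcal{A})$ is an $n$-manifold with an atlas $\mathcal{A}$ whose coordinate changes are, on connected components, restrictions of elements of $\mathrm{GL}(n;\mathbb{Z})\ltimes\mathbb{R}^n$; write them as $\mathbf{a}_\beta=A_{\beta\alpha}\mathbf{a}_\alpha+\mathbf{d}_{\beta\alpha}$. Its affine holonomy is $\mathfrak{a}:\pi_1(B)\to\mathrm{GL}(n;\mathbb{Z})\ltimes\mathbb{R}^n$, and its linear holonomy $\mathfrak{l}$ is the linear part of $\mathfrak{a}$. $\mathbb{R}^n_{\mathfrak{l}}$ is the local system of flat (locally constant in affine coordinates) sections of $\mathrm{T}B$. Symplectic reference bundle: $P_{(B,\mathcal{A})}\subset\mathrm{T}^*B$ is given over a chart with integral affine coordinates $a^i_\alpha$ by the integral combinations of $\mathrm{d}a^1_\alpha,\dots,\mathrm{d}a^n_\alpha$. The canonical symplectic form of $\mathrm{T}^*B$ descends to $\omega_0$ on $\mathrm{T}^*B/P_{(B,\mathcal{A})}$. Over each chart $\omega_0=\sum_i\mathrm{d}a^i_\alpha\wedge\mathrm{d}\theta^i_\alpha$, where $\theta^i_\alpha\in\mathbb{R}/\mathbb{Z}$ are the fibre coordinates with respect to $\mathrm{d}a^i_\alpha$. Class $w_0$: for a good open cover by integral affine charts $U_\alpha$, with $\nu_\alpha=\sum_i a^i_\alpha\,\mathrm{d}\theta^i_\alpha$ a local potential of $\omega_0$, the differences $\tau_{\beta\alpha}=\nu_\beta-\nu_\alpha$ on overlaps define a Čech cocycle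 (whose value on $(U_\alpha,U_\beta)$ is $\tau_{\beta\alpha}$) with values in the local system of first real cohomology groups of the fibres, which has monodromy $\mathfrak{l}$; $w_0$ is its class. The isomorphism $\Phi$: $\omega_0$ induces an isomorphism from the local system of first real cohomology groups of the fibres of the symplectic reference bundle to the local system $\mathbb{R}^n_{\mathfrak{l}}$ of flat sections, given over each chart by $\sum_i r^i_\alpha[\mathrm{d}\theta^i_\alpha]\mapsto\sum_i r^i_\alpha\,\partial/\partial a^i_\alpha$ ($r^i_\alpha\in\mathbb{R}$ constants); $\Phi$ is the induced map in cohomology. Radiance obstruction: let $\mathrm{Trans}:\mathrm{GL}(n;\mathbb{R})\ltimes\mathbb{R}^n\to\mathbb{R}^n$, $(A,\mathbf{b})\mapsto\mathbf{b}$. The crossed homomorphism $\mathrm{Trans}\circ\mathfrak{a}$ defines a class in $\mathrm{H}^1(\pi_1(B);\mathbb{R}^n_{\mathfrak{l}})\cong\mathrm{H}^1(B;\mathbb{R}^n_{\mathfrak{l}})$, denoted $r_{(B,\mathcal{A})}$. Sign convention: the identification of group cohomology with Čech cohomology is the one for which, for $\mathbb{R}/\mathbb{Z}$ with its standard atlas (coordinate changes $a_\beta=a_\alpha+d_{\beta\alpha}$), the radiance obstruction is represented by the Čech cocycle whose value on $(U_\alpha,U_\beta)$ is $d_{\beta\alpha}$. *)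

theory Defs
  imports "HOL-Analysis.Analysis" "HOL-Algebra.Product_Groups" "HOL-Library.Function_Algebras"
begin

section \<open>Smooth manifolds given by an atlas\<close>

text \<open>
  A chart is a pair \<open>(U, \<phi>)\<close> with \<open>\<phi>\<close> injective on \<open>U\<close> and \<open>\<phi> ` U\<close> open; the values of \<open>\<phi>\<close>
  outside \<open>U\<close> are irrelevant.  The smooth structure carried by an atlas \<open>\<C>\<close> lives on the
  union of the chart domains.
\<close>

type_synonym ('m, 'e) chart = "'m set \<times> ('m \<Rightarrow> 'e)"

text \<open>
  A tangent vector at \<open>x\<close> is the family of its coordinate vectors in all charts around \<open>x\<close>.
  It is \<open>0\<close> at the charts not around \<open>x\<close>, so that the linear structure is the pointwise one.
  Covectors and forms are likewise \<open>0\<close> off the tangent spaces.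
\<close>

type_synonym ('m, 'e) tvec = "('m, 'e) chart \<Rightarrow> 'e"
type_synonym ('m, 'e) covec = "('m, 'e) tvec \<Rightarrow> real"
type_synonym ('m, 'e) form1 = "'m \<Rightarrow> ('m, 'e) covec"
type_synonym ('m, 'e) form2 = "'m \<Rightarrow> ('m, 'e) tvec \<Rightarrow> ('m, 'e) tvec \<Rightarrow> real"

definition chart_inv :: "('m, 'e) chart \<Rightarrow> 'e \<Rightarrow> 'm" where
  "chart_inv c = inv_into (fst c) (snd c)"

definition chart_at :: "('m, 'e) chart set \<Rightarrow> 'm \<Rightarrow> ('m, 'e) chart" where
  "chart_at \<C> x = (SOME c. c \<in> \<C> \<and> x \<in> fst c)"

definition transition :: "('m, 'e) chart \<Rightarrow> ('m, 'e) chart \<Rightarrow> 'e \<Rightarrow> 'e" where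
  "transition c c' = snd c' \<circ> chart_inv c"

definition tangent_space ::
  "('m, 'e::euclidean_space) chart set \<Rightarrow> 'm \<Rightarrow> ('m, 'e) tvec set" where
  "tangent_space \<C> x = {v. x \<in> (\<Union>c\<in>\<C>. fst c) \<and>
     (\<forall>c. \<not> (c \<in> \<C> \<and> x \<in> fst c) \<longrightarrow> v c = 0) \<and>
     (\<forall>c\<in>\<C>. \<forall>c'\<in>\<C>. x \<in> fst c \<and> x \<in> fst c' \<longrightarrow>
        v c' = frechet_derivative (transition c c') (at (snd c x)) (v c))}"

text \<open>\<open>coord_vector \<C> c x u\<close> is the tangent vector \<open>\<Sum>\<^sub>i u\<^sub>i \<partial>/\<partial>a\<^sup>i\<close> at \<open>x\<close>, where \<open>a\<close> are the coordinates of \<open>c\<close>.\<close>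

definition coord_vector ::
  "('m, 'e::euclidean_space) chart set \<Rightarrow> ('m, 'e) chart \<Rightarrow> 'm \<Rightarrow> 'e \<Rightarrow> ('m, 'e) tvec" where
  "coord_vector \<C> c x u = (\<lambda>c'. if c' \<in> \<C> \<and> x \<in> fst c'
     then frechet_derivative (transition c c') (at (snd c x)) u else 0)"

definition cotangent_space ::
  "('m, 'e::euclidean_space) chart set \<Rightarrow> 'm \<Rightarrow> ('m, 'e) covec set" where
  "cotangent_space \<C> x = {p. (\<forall>v. v \<notin> tangent_space \<C> x \<longrightarrow> p v = 0) \<and>
     (\<forall>c\<in>\<C>. x \<in> fst c \<longrightarrow> linear (\<lambda>u. p (coord_vector \<C> c x u)))}"

text \<open>\<open>dcoord \<C> c k x\<close> is the differential at \<open>x\<close> of the coordinate function \<open>\<lambda>y. snd c y \<bullet> k\<close>.\<close>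

definition dcoord ::
  "('m, 'e::euclidean_space) chart set \<Rightarrow> ('m, 'e) chart \<Rightarrow> 'e \<Rightarrow> ('m, 'e) form1" where
  "dcoord \<C> c k x v = (if v \<in> tangent_space \<C> x \<and> x \<in> fst c then v c \<bullet> k else 0)"

primrec Ck_on :: "nat \<Rightarrow> 'a set \<Rightarrow> ('a::euclidean_space \<Rightarrow> real) \<Rightarrow> bool" where
  "Ck_on 0 S f \<longleftrightarrow> continuous_on S f"
| "Ck_on (Suc k) S f \<longleftrightarrow> f differentiable_on S \<and>
     (\<forall>v. Ck_on k S (\<lambda>x. frechet_derivative f (at x) v))"

text \<open>Only used for open \<open>S\<close>.\<close>

definition smooth_on :: "'a set \<Rightarrow> ('a::euclidean_space \<Rightarrow> real) \<Rightarrow> bool" where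
  "smooth_on S f \<longleftrightarrow> (\<forall>k. Ck_on k S f)"

definition smooth_function ::
  "('m, 'e::euclidean_space) chart set \<Rightarrow> ('m \<Rightarrow> real) \<Rightarrow> bool" where
  "smooth_function \<C> f \<longleftrightarrow> (\<forall>c\<in>\<C>. smooth_on (snd c ` fst c) (f \<circ> chart_inv c))"

definition smooth_form1 ::
  "('m, 'e::euclidean_space) chart set \<Rightarrow> ('m, 'e) form1 \<Rightarrow> bool" where
  "smooth_form1 \<C> \<eta> \<longleftrightarrow> (\<forall>x. \<eta> x \<in> cotangent_space \<C> x) \<and>
     (\<forall>c\<in>\<C>. \<forall>u. smooth_on (snd c ` fst c)
        (\<lambda>y. \<eta> (chart_inv c y) (coord_vector \<C> c (chart_inv c y) u)))"

definition differential ::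
  "('m, 'e::euclidean_space) chart set \<Rightarrow> ('m \<Rightarrow> real) \<Rightarrow> ('m, 'e) form1" where
  "differential \<C> f x v = (if v \<in> tangent_space \<C> x then
     let c = chart_at \<C> x in frechet_derivative (f \<circ> chart_inv c) (at (snd c x)) (v c) else 0)"

text \<open>
  \<open>d\<eta>(v,w) = v(\<eta>(w)) - w(\<eta>(v))\<close>, where \<open>v\<close> and \<open>w\<close> are extended to vector fields that are constant in
  some chart around \<open>x\<close>; the value does not depend on that chart.
\<close>

definition ext_deriv ::
  "('m, 'e::euclidean_space) chart set \<Rightarrow> ('m, 'e) form1 \<Rightarrow> ('m, 'e) form2" where
  "ext_deriv \<C> \<eta> x v w = (if v \<in> tangent_space \<C> x \<and> w \<in> tangent_space \<C> x then
     let c = chart_at \<C> x;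
         comp = (\<lambda>u y. \<eta> (chart_inv c y) (coord_vector \<C> c (chart_inv c y) u))
     in frechet_derivative (comp (w c)) (at (snd c x)) (v c)
      - frechet_derivative (comp (v c)) (at (snd c x)) (w c)
   else 0)"

definition pushforward ::
  "('m, 'e::euclidean_space) chart set \<Rightarrow> ('n, 'f::euclidean_space) chart set \<Rightarrow> ('m \<Rightarrow> 'n) \<Rightarrow>
     'm \<Rightarrow> ('m, 'e) tvec \<Rightarrow> ('n, 'f) tvec" where
  "pushforward \<C> \<D> f x v = (\<lambda>d. if d \<in> \<D> \<and> f x \<in> fst d then
     let c = chart_at \<C> x in
       frechet_derivative (snd d \<circ> f \<circ> chart_inv c) (at (snd c x)) (v c)
     else 0)"

definition pullback1 ::
  "('m, 'e::euclidean_space) chart set \<Rightarrow> ('n, 'f::euclidean_space) chart set \<Rightarrow> ('m \<Rightarrow> 'n) \<Rightarrow>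
     ('n, 'f) form1 \<Rightarrow> ('m, 'e) form1" where
  "pullback1 \<C> \<D> f \<eta> x v =
     (if v \<in> tangent_space \<C> x then \<eta> (f x) (pushforward \<C> \<D> f x v) else 0)"

definition pullback2 ::
  "('m, 'e::euclidean_space) chart set \<Rightarrow> ('n, 'f::euclidean_space) chart set \<Rightarrow> ('m \<Rightarrow> 'n) \<Rightarrow>
     ('n, 'f) form2 \<Rightarrow> ('m, 'e) form2" where
  "pullback2 \<C> \<D> f \<omega> x v w =
     (if v \<in> tangent_space \<C> x \<and> w \<in> tangent_space \<C> x
      then \<omega> (f x) (pushforward \<C> \<D> f x v) (pushforward \<C> \<D> f x w) else 0)"


section \<open>First de Rham cohomology\<close>

definition additive_group :: "'a set \<Rightarrow> 'a::{plus, zero} monoid" where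
  "additive_group S = \<lparr>carrier = S, monoid.mult = (+), one = 0\<rparr>"

definition closed_form1s ::
  "('m, 'e::euclidean_space) chart set \<Rightarrow> ('m, 'e) form1 monoid" where
  "closed_form1s \<C> = additive_group {\<eta>. smooth_form1 \<C> \<eta> \<and> ext_deriv \<C> \<eta> = 0}"

definition exact_form1s ::
  "('m, 'e::euclidean_space) chart set \<Rightarrow> ('m, 'e) form1 set" where
  "exact_form1s \<C> = differential \<C> ` {f. smooth_function \<C> f}"

definition deRham_H1 ::
  "('m, 'e::euclidean_space) chart set \<Rightarrow> ('m, 'e) form1 set monoid" where
  "deRham_H1 \<C> = closed_form1s \<C> Mod exact_form1s \<C>"

definition deRham_class ::
  "('m, 'e::euclidean_space) chart set \<Rightarrow> ('m, 'e) form1 \<Rightarrow> ('m, 'e) form1 set" where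
  "deRham_class \<C> \<eta> = exact_form1s \<C> #>\<^bsub>closed_form1s \<C>\<^esub> \<eta>"


section \<open>Integral affine manifolds\<close>

definition integral_matrix :: "real^'n^'n \<Rightarrow> bool" where
  "integral_matrix A \<longleftrightarrow> (\<forall>i j. A $ i $ j \<in> \<int>)"

definition GL_int :: "(real^'n^'n) set" where
  "GL_int = {A. integral_matrix A \<and>
     (\<exists>A'. integral_matrix A' \<and> A ** A' = mat 1 \<and> A' ** A = mat 1)}"

definition top_chart :: "'b::topological_space set \<Rightarrow> ('b, real^'n) chart \<Rightarrow> bool" where
  "top_chart B c \<longleftrightarrow> openin (top_of_set B) (fst c) \<and> open (snd c ` fst c) \<and>
     (\<exists>\<psi>. homeomorphism (fst c) (snd c ` fst c) (snd c) \<psi>)"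

definition int_affine_compatible ::
  "('b::topological_space, real^'n) chart \<Rightarrow> ('b, real^'n) chart \<Rightarrow> bool" where
  "int_affine_compatible c c' \<longleftrightarrow> (\<forall>K\<in>components (fst c \<inter> fst c').
     \<exists>A\<in>GL_int. \<exists>d. \<forall>x\<in>K. snd c' x = A *v snd c x + d)"

definition integral_affine_manifold ::
  "'b::topological_space set \<Rightarrow> ('b, real^'n) chart set \<Rightarrow> bool" where
  "integral_affine_manifold B \<A> \<longleftrightarrow>
     Hausdorff_space (top_of_set B) \<and> second_countable (top_of_set B) \<and>
     B \<noteq> {} \<and> connected B \<and>
     (\<forall>c\<in>\<A>. top_chart B c) \<and> (\<Union>c\<in>\<A>. fst c) = B \<and>
     (\<forall>c\<in>\<A>. \<forall>c'\<in>\<A>. int_affine_compatible c c')"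

text \<open>
  The integral affine charts of \<open>(B, \<A>)\<close>, i.e. the maximal atlas of \<open>\<A>\<close>.  All constructions below
  that take an argument \<open>\<C>\<close> are applied to this atlas.
\<close>

definition int_affine_charts ::
  "'b::topological_space set \<Rightarrow> ('b, real^'n) chart set \<Rightarrow> ('b, real^'n) chart set" where
  "int_affine_charts B \<A> = {c. top_chart B c \<and> (\<forall>c'\<in>\<A>. int_affine_compatible c c')}"


section \<open>The symplectic reference bundle\<close>

definition cot_coord ::
  "('b, real^'n) chart set \<Rightarrow> ('b, real^'n) chart \<Rightarrow> 'b \<Rightarrow> ('b, real^'n) covec \<Rightarrow> real^'n" where
  "cot_coord \<C> c x p = (\<chi> i. p (coord_vector \<C> c x (axis i 1)))"

definition cot_chart ::
  "('b, real^'n) chart set \<Rightarrow> ('b, real^'n) chart \<Rightarrow>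
     ('b \<times> ('b, real^'n) covec, (real^'n) \<times> (real^'n)) chart" where
  "cot_chart \<C> c = ({(x, p). x \<in> fst c \<and> p \<in> cotangent_space \<C> x},
     \<lambda>(x, p). (snd c x, cot_coord \<C> c x p))"

definition cot_atlas ::
  "('b, real^'n) chart set \<Rightarrow> ('b \<times> ('b, real^'n) covec, (real^'n) \<times> (real^'n)) chart set" where
  "cot_atlas \<C> = cot_chart \<C> ` \<C>"

definition taut_form ::
  "('b, real^'n) chart set \<Rightarrow> ('b \<times> ('b, real^'n) covec, (real^'n) \<times> (real^'n)) form1" where
  "taut_form \<C> e v = (if v \<in> tangent_space (cot_atlas \<C>) e
     then snd e (pushforward (cot_atlas \<C>) \<C> fst e v) else 0)"

text \<open>With this sign \<open>\<omega> = \<Sum>\<^sub>i da\<^sup>i \<and> dp\<^sub>i\<close>, in accordance with \<open>\<omega>\<^sub>0 = \<Sum>\<^sub>i da\<^sup>i \<and> d\<theta>\<^sup>i\<close>.\<close>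

definition can_form ::
  "('b, real^'n) chart set \<Rightarrow> ('b \<times> ('b, real^'n) covec, (real^'n) \<times> (real^'n)) form2" where
  "can_form \<C> e v w = - ext_deriv (cot_atlas \<C>) (taut_form \<C>) e v w"

definition period_lattice ::
  "('b, real^'n) chart set \<Rightarrow> 'b \<Rightarrow> ('b, real^'n) covec set" where
  "period_lattice \<C> x = {(\<lambda>v. \<Sum>i\<in>UNIV. of_int (k i) * dcoord \<C> c (axis i 1) x v) | c k.
     c \<in> \<C> \<and> x \<in> fst c}"

abbreviation cot_group :: "('b, real^'n) chart set \<Rightarrow> 'b \<Rightarrow> ('b, real^'n) covec monoid" where
  "cot_group \<C> x \<equiv> additive_group (cotangent_space \<C> x)"

text \<open>The torus \<open>T\<^sup>*\<^sub>x B / P\<^sub>x\<close>.\<close>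

definition ref_fibre :: "('b, real^'n) chart set \<Rightarrow> 'b \<Rightarrow> ('b, real^'n) covec set set" where
  "ref_fibre \<C> x = carrier (cot_group \<C> x Mod period_lattice \<C> x)"

definition ref_proj ::
  "('b, real^'n) chart set \<Rightarrow> 'b \<times> ('b, real^'n) covec \<Rightarrow> 'b \<times> ('b, real^'n) covec set" where
  "ref_proj \<C> = (\<lambda>(x, p). (x, period_lattice \<C> x #>\<^bsub>cot_group \<C> x\<^esub> p))"

text \<open>
  The coordinates \<open>\<theta> \<in> (\<real>/\<int>)\<^sup>n\<close> with respect to \<open>da\<^sup>1, \<dots>, da\<^sup>n\<close> become charts of the fibre and of the total
  space after restriction to an open \<open>W \<subseteq> \<real>\<^sup>n\<close> that embeds in \<open>(\<real>/\<int>)\<^sup>n\<close>.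
\<close>

definition theta_window :: "(real^'n) set \<Rightarrow> bool" where
  "theta_window W \<longleftrightarrow> open W \<and> (\<forall>t\<in>W. \<forall>t'\<in>W. (\<forall>i. t $ i - t' $ i \<in> \<int>) \<longrightarrow> t = t')"

definition fibre_chart ::
  "('b, real^'n) chart set \<Rightarrow> 'b \<Rightarrow> ('b, real^'n) chart \<Rightarrow> (real^'n) set \<Rightarrow>
     (('b, real^'n) covec set, real^'n) chart" where
  "fibre_chart \<C> x c W = ({T \<in> ref_fibre \<C> x. \<exists>p\<in>T. cot_coord \<C> c x p \<in> W},
     \<lambda>T. THE t. t \<in> W \<and> (\<exists>p\<in>T. cot_coord \<C> c x p = t))"

definition fibre_atlas ::
  "('b, real^'n) chart set \<Rightarrow> 'b \<Rightarrow> (('b, real^'n) covec set, real^'n) chart set" where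
  "fibre_atlas \<C> x = {fibre_chart \<C> x c W | c W. c \<in> \<C> \<and> x \<in> fst c \<and> theta_window W}"

definition ref_chart ::
  "('b, real^'n) chart set \<Rightarrow> ('b, real^'n) chart \<Rightarrow> (real^'n) set \<Rightarrow>
     ('b \<times> ('b, real^'n) covec set, (real^'n) \<times> (real^'n)) chart" where
  "ref_chart \<C> c W = ({(x, T). x \<in> fst c \<and> T \<in> fst (fibre_chart \<C> x c W)},
     \<lambda>(x, T). (snd c x, snd (fibre_chart \<C> x c W) T))"

definition ref_atlas ::
  "('b, real^'n) chart set \<Rightarrow>
     ('b \<times> ('b, real^'n) covec set, (real^'n) \<times> (real^'n)) chart set" where
  "ref_atlas \<C> = {ref_chart \<C> c W | c W. c \<in> \<C> \<and> theta_window W}"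

text \<open>\<open>\<omega>\<^sub>0\<close> is the 2-form on \<open>T\<^sup>*B / P\<close> whose pullback to \<open>T\<^sup>*B\<close> is the canonical symplectic form.\<close>

definition omega0 ::
  "('b, real^'n) chart set \<Rightarrow>
     ('b \<times> ('b, real^'n) covec set, (real^'n) \<times> (real^'n)) form2" where
  "omega0 \<C> = (THE \<omega>.
     (\<forall>e v w. v \<notin> tangent_space (ref_atlas \<C>) e \<or> w \<notin> tangent_space (ref_atlas \<C>) e
        \<longrightarrow> \<omega> e v w = 0) \<and>
     pullback2 (cot_atlas \<C>) (ref_atlas \<C>) (ref_proj \<C>) \<omega> = can_form \<C>)"

text \<open>
  \<open>d\<theta>\<^sup>i\<close> over the chart \<open>c\<close>: the differential of any local lift of \<open>\<theta>\<^sup>i\<close> to a real-valued function.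
\<close>

definition dtheta ::
  "('b, real^'n) chart set \<Rightarrow> ('b, real^'n) chart \<Rightarrow> 'n \<Rightarrow>
     ('b \<times> ('b, real^'n) covec set, (real^'n) \<times> (real^'n)) form1" where
  "dtheta \<C> c i e =
     dcoord (ref_atlas \<C>) (ref_chart \<C> c (SOME W. theta_window W \<and> e \<in> fst (ref_chart \<C> c W)))
       (0, axis i 1) e"

definition nu_form ::
  "('b, real^'n) chart set \<Rightarrow> ('b, real^'n) chart \<Rightarrow>
     ('b \<times> ('b, real^'n) covec set, (real^'n) \<times> (real^'n)) form1" where
  "nu_form \<C> c e v = (\<Sum>i\<in>UNIV. snd c (fst e) $ i * dtheta \<C> c i e v)"

definition fibre_restrict ::
  "('b, real^'n) chart set \<Rightarrow> 'b \<Rightarrow>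
     ('b \<times> ('b, real^'n) covec set, (real^'n) \<times> (real^'n)) form1 \<Rightarrow>
     (('b, real^'n) covec set, real^'n) form1" where
  "fibre_restrict \<C> x = pullback1 (fibre_atlas \<C> x) (ref_atlas \<C>) (Pair x)"

definition fibre_class ::
  "('b, real^'n) chart set \<Rightarrow> 'b \<Rightarrow>
     ('b \<times> ('b, real^'n) covec set, (real^'n) \<times> (real^'n)) form1 \<Rightarrow>
     (('b, real^'n) covec set, real^'n) form1 set" where
  "fibre_class \<C> x \<eta> = deRham_class (fibre_atlas \<C> x) (fibre_restrict \<C> x \<eta>)"


section \<open>Local systems and Cech cohomology\<close>

text \<open>
  The group of flat sections over \<open>V\<close> of the bundle of groups \<open>G\<close> over \<open>B\<close>: those which are locally of the
  form \<open>k c r\<close>, where \<open>k c r y\<close> is the element of \<open>G y\<close> with the (constant) coordinates \<open>r\<close> with respect to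
  the chart \<open>c\<close>.
\<close>

definition flat_sections ::
  "'b::topological_space set \<Rightarrow> ('b, real^'n) chart set \<Rightarrow> ('b \<Rightarrow> 'g monoid) \<Rightarrow>
     (('b, real^'n) chart \<Rightarrow> real^'n \<Rightarrow> 'b \<Rightarrow> 'g) \<Rightarrow> 'b set \<Rightarrow> ('b \<Rightarrow> 'g) monoid" where
  "flat_sections B \<C> G k V = product_group V G \<lparr>carrier :=
     {s \<in> carrier (product_group V G).
        \<forall>x\<in>V. \<exists>c\<in>\<C>. \<exists>N r. openin (top_of_set B) N \<and> x \<in> N \<and> N \<subseteq> V \<inter> fst c \<and>
          (\<forall>y\<in>N. s y = k c r y)}\<rparr>"

text \<open>The local system \<open>\<real>\<^sup>n\<^sub>l\<close> of flat sections of \<open>TB\<close>.\<close>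

definition flat_TB ::
  "'b::topological_space set \<Rightarrow> ('b, real^'n) chart set \<Rightarrow> 'b set \<Rightarrow>
     ('b \<Rightarrow> ('b, real^'n) tvec) monoid" where
  "flat_TB B \<C> = flat_sections B \<C> (\<lambda>x. additive_group (tangent_space \<C> x))
     (\<lambda>c r x. coord_vector \<C> c x r)"

text \<open>
  The local system of first real (de Rham) cohomology groups of the fibres; the constants are the
  coefficients of the classes \<open>[d\<theta>\<^sup>i]\<close>.
\<close>

definition theta_class ::
  "('b, real^'n) chart set \<Rightarrow> ('b, real^'n) chart \<Rightarrow> real^'n \<Rightarrow> 'b \<Rightarrow>
     (('b, real^'n) covec set, real^'n) form1 set" where
  "theta_class \<C> c r x = fibre_class \<C> x (\<lambda>e v. \<Sum>i\<in>UNIV. r $ i * dtheta \<C> c i e v)"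

definition flat_HF ::
  "'b::topological_space set \<Rightarrow> ('b, real^'n) chart set \<Rightarrow> 'b set \<Rightarrow>
     ('b \<Rightarrow> (('b, real^'n) covec set, real^'n) form1 set) monoid" where
  "flat_HF B \<C> = flat_sections B \<C> (\<lambda>x. deRham_H1 (fibre_atlas \<C> x)) (theta_class \<C>)"

text \<open>
  Cech cochains of a cover \<open>U\<close> indexed by \<open>I\<close>, with values in a sheaf \<open>\<Gamma>\<close> of abelian groups (in
  multiplicative notation) whose sections over \<open>V\<close> are extensional functions on \<open>V\<close>.
\<close>

definition cech_C0 :: "('b set \<Rightarrow> ('b \<Rightarrow> 'g) monoid) \<Rightarrow> 'i set \<Rightarrow> ('i \<Rightarrow> 'b set) \<Rightarrow>
    ('i \<Rightarrow> 'b \<Rightarrow> 'g) monoid" where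
  "cech_C0 \<Gamma> I U = product_group I (\<lambda>\<alpha>. \<Gamma> (U \<alpha>))"

definition cech_C1 :: "('b set \<Rightarrow> ('b \<Rightarrow> 'g) monoid) \<Rightarrow> 'i set \<Rightarrow> ('i \<Rightarrow> 'b set) \<Rightarrow>
    ('i \<times> 'i \<Rightarrow> 'b \<Rightarrow> 'g) monoid" where
  "cech_C1 \<Gamma> I U = product_group (I \<times> I) (\<lambda>(\<alpha>, \<beta>). \<Gamma> (U \<alpha> \<inter> U \<beta>))"

definition cech_Z1 :: "('b set \<Rightarrow> ('b \<Rightarrow> 'g) monoid) \<Rightarrow> 'i set \<Rightarrow> ('i \<Rightarrow> 'b set) \<Rightarrow>
    ('i \<times> 'i \<Rightarrow> 'b \<Rightarrow> 'g) monoid" where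
  "cech_Z1 \<Gamma> I U = cech_C1 \<Gamma> I U \<lparr>carrier := {s \<in> carrier (cech_C1 \<Gamma> I U).
     \<forall>\<alpha>\<in>I. \<forall>\<beta>\<in>I. \<forall>\<gamma>\<in>I. let V = U \<alpha> \<inter> U \<beta> \<inter> U \<gamma> in
       restrict (s (\<beta>, \<gamma>)) V \<otimes>\<^bsub>\<Gamma> V\<^esub> inv\<^bsub>\<Gamma> V\<^esub> (restrict (s (\<alpha>, \<gamma>)) V)
         \<otimes>\<^bsub>\<Gamma> V\<^esub> restrict (s (\<alpha>, \<beta>)) V = \<one>\<^bsub>\<Gamma> V\<^esub>}\<rparr>"

definition cech_delta0 :: "('b set \<Rightarrow> ('b \<Rightarrow> 'g) monoid) \<Rightarrow> 'i set \<Rightarrow> ('i \<Rightarrow> 'b set) \<Rightarrow>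
    ('i \<Rightarrow> 'b \<Rightarrow> 'g) \<Rightarrow> 'i \<times> 'i \<Rightarrow> 'b \<Rightarrow> 'g" where
  "cech_delta0 \<Gamma> I U u = (\<lambda>(\<alpha>, \<beta>)\<in>I \<times> I. let V = U \<alpha> \<inter> U \<beta> in
     restrict (u \<beta>) V \<otimes>\<^bsub>\<Gamma> V\<^esub> inv\<^bsub>\<Gamma> V\<^esub> (restrict (u \<alpha>) V))"

definition cech_B1 :: "('b set \<Rightarrow> ('b \<Rightarrow> 'g) monoid) \<Rightarrow> 'i set \<Rightarrow> ('i \<Rightarrow> 'b set) \<Rightarrow>
    ('i \<times> 'i \<Rightarrow> 'b \<Rightarrow> 'g) set" where
  "cech_B1 \<Gamma> I U = cech_delta0 \<Gamma> I U ` carrier (cech_C0 \<Gamma> I U)"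

definition cech_H1 :: "('b set \<Rightarrow> ('b \<Rightarrow> 'g) monoid) \<Rightarrow> 'i set \<Rightarrow> ('i \<Rightarrow> 'b set) \<Rightarrow>
    ('i \<times> 'i \<Rightarrow> 'b \<Rightarrow> 'g) set monoid" where
  "cech_H1 \<Gamma> I U = cech_Z1 \<Gamma> I U Mod cech_B1 \<Gamma> I U"

definition cech_class :: "('b set \<Rightarrow> ('b \<Rightarrow> 'g) monoid) \<Rightarrow> 'i set \<Rightarrow> ('i \<Rightarrow> 'b set) \<Rightarrow>
    ('i \<times> 'i \<Rightarrow> 'b \<Rightarrow> 'g) \<Rightarrow> ('i \<times> 'i \<Rightarrow> 'b \<Rightarrow> 'g) set" where
  "cech_class \<Gamma> I U s = cech_B1 \<Gamma> I U #>\<^bsub>cech_Z1 \<Gamma> I U\<^esub> s"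

text \<open>
  A good cover by integral affine charts \<open>\<kappa> \<alpha>\<close>.  For such a cover \<open>H\<^sup>1(B; -)\<close> of a local system is
  the cohomology \<open>cech_H1\<close> of the cover.  The empty set is \<open>contractible\<close> in the library.
\<close>

definition good_chart_cover ::
  "'b::topological_space set \<Rightarrow> ('b, real^'n) chart set \<Rightarrow> 'i set \<Rightarrow>
     ('i \<Rightarrow> ('b, real^'n) chart) \<Rightarrow> bool" where
  "good_chart_cover B \<C> I \<kappa> \<longleftrightarrow> (\<forall>\<alpha>\<in>I. \<kappa> \<alpha> \<in> \<C>) \<and> (\<Union>\<alpha>\<in>I. fst (\<kappa> \<alpha>)) = B \<and>
     (\<forall>J. J \<subseteq> I \<and> finite J \<and> J \<noteq> {} \<longrightarrow> contractible (\<Inter>\<alpha>\<in>J. fst (\<kappa> \<alpha>)))"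


section \<open>The class \<open>w\<^sub>0\<close> and the map \<open>\<Phi>\<close>\<close>

definition tau_cocycle ::
  "('b, real^'n) chart set \<Rightarrow> 'i set \<Rightarrow> ('i \<Rightarrow> ('b, real^'n) chart) \<Rightarrow>
     'i \<times> 'i \<Rightarrow> 'b \<Rightarrow> (('b, real^'n) covec set, real^'n) form1 set" where
  "tau_cocycle \<C> I \<kappa> = (\<lambda>(\<alpha>, \<beta>)\<in>I \<times> I. \<lambda>x\<in>fst (\<kappa> \<alpha>) \<inter> fst (\<kappa> \<beta>).
     fibre_class \<C> x (\<lambda>e v. nu_form \<C> (\<kappa> \<beta>) e v - nu_form \<C> (\<kappa> \<alpha>) e v))"

definition w0_class ::
  "'b::topological_space set \<Rightarrow> ('b, real^'n) chart set \<Rightarrow> 'i set \<Rightarrow>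
     ('i \<Rightarrow> ('b, real^'n) chart) \<Rightarrow>
     ('i \<times> 'i \<Rightarrow> 'b \<Rightarrow> (('b, real^'n) covec set, real^'n) form1 set) set" where
  "w0_class B \<C> I \<kappa> = cech_class (flat_HF B \<C>) I (fst \<circ> \<kappa>) (tau_cocycle \<C> I \<kappa>)"

definition Phi_fibre ::
  "('b, real^'n) chart set \<Rightarrow> 'b \<Rightarrow> (('b, real^'n) covec set, real^'n) form1 set \<Rightarrow>
     ('b, real^'n) tvec" where
  "Phi_fibre \<C> x h = (THE v. \<exists>c\<in>\<C>. x \<in> fst c \<and>
     (\<exists>r. h = theta_class \<C> c r x \<and> v = coord_vector \<C> c x r))"

definition Phi_cochain ::
  "('b, real^'n) chart set \<Rightarrow> 'i set \<Rightarrow> ('i \<Rightarrow> 'b set) \<Rightarrow>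
     ('i \<times> 'i \<Rightarrow> 'b \<Rightarrow> (('b, real^'n) covec set, real^'n) form1 set) \<Rightarrow>
     'i \<times> 'i \<Rightarrow> 'b \<Rightarrow> ('b, real^'n) tvec" where
  "Phi_cochain \<C> I U s = (\<lambda>(\<alpha>, \<beta>)\<in>I \<times> I. \<lambda>x\<in>U \<alpha> \<inter> U \<beta>. Phi_fibre \<C> x (s (\<alpha>, \<beta>) x))"

definition Phi ::
  "'b::topological_space set \<Rightarrow> ('b, real^'n) chart set \<Rightarrow> 'i set \<Rightarrow> ('i \<Rightarrow> 'b set) \<Rightarrow>
     ('i \<times> 'i \<Rightarrow> 'b \<Rightarrow> (('b, real^'n) covec set, real^'n) form1 set) set \<Rightarrow>
     ('i \<times> 'i \<Rightarrow> 'b \<Rightarrow> ('b, real^'n) tvec) set" where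
  "Phi B \<C> I U K =
     the_elem ((\<lambda>s. cech_class (flat_TB B \<C>) I U (Phi_cochain \<C> I U s)) ` K)"


section \<open>Affine holonomy\<close>

definition path_class :: "'b::topological_space set \<Rightarrow> (real \<Rightarrow> 'b) \<Rightarrow> (real \<Rightarrow> 'b) set" where
  "path_class B g = {g'. homotopic_paths B g g'}"

definition fundamental_group ::
  "'b::topological_space set \<Rightarrow> 'b \<Rightarrow> (real \<Rightarrow> 'b) set monoid" where
  "fundamental_group B b =
     \<lparr>carrier = path_class B ` {g. path g \<and> path_image g \<subseteq> B \<and> pathstart g = b \<and> pathfinish g = b},
      monoid.mult = (\<lambda>K L. \<Union>g\<in>K. \<Union>h\<in>L. path_class B (g +++ h)),
      one = path_class B (\<lambda>_. b)\<rparr>"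

definition germ_eq ::
  "'b::topological_space set \<Rightarrow> 'b \<Rightarrow> ('b, real^'n) chart \<Rightarrow> ('b, real^'n) chart \<Rightarrow> bool" where
  "germ_eq B x c c' \<longleftrightarrow> (\<exists>N. openin (top_of_set B) N \<and> x \<in> N \<and> N \<subseteq> fst c \<inter> fst c' \<and>
     (\<forall>y\<in>N. snd c y = snd c' y))"

text \<open>\<open>F\<close> continues the germ of the chart \<open>c\<close> along the path \<open>g\<close>, through integral affine charts.\<close>

definition continuation ::
  "'b::topological_space set \<Rightarrow> ('b, real^'n) chart set \<Rightarrow> (real \<Rightarrow> 'b) \<Rightarrow>
     ('b, real^'n) chart \<Rightarrow> (real \<Rightarrow> ('b, real^'n) chart) \<Rightarrow> bool" where
  "continuation B \<C> g c F \<longleftrightarrow>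
     (\<forall>t\<in>{0..1}. F t \<in> \<C> \<and> g t \<in> fst (F t)) \<and> germ_eq B (g 0) c (F 0) \<and>
     (\<forall>t\<in>{0..1}. \<exists>e>0. \<forall>s\<in>{0..1}. \<bar>s - t\<bar> < e \<longrightarrow> germ_eq B (g s) (F t) (F s))"

text \<open>
  The affine holonomy at \<open>b\<close> with respect to the chart \<open>c\<close>: the element \<open>(A, d)\<close> of
  \<open>GL(n; \<int>) \<ltimes> \<real>\<^sup>n\<close> such that continuing \<open>c\<close> along the loop yields \<open>A c + d\<close>.  Equivalently, the
  developing map of \<open>c\<close> is equivariant, so this is a homomorphism for the product of
  \<open>fundamental_group\<close>.
\<close>

definition affine_holonomy ::
  "'b::topological_space set \<Rightarrow> ('b, real^'n) chart set \<Rightarrow> 'b \<Rightarrow> ('b, real^'n) chart \<Rightarrow>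
     (real \<Rightarrow> 'b) set \<Rightarrow> (real^'n^'n) \<times> (real^'n)" where
  "affine_holonomy B \<C> b c K = (THE (A, d). A \<in> GL_int \<and>
     (\<exists>g\<in>K. \<exists>F N. continuation B \<C> g c F \<and> openin (top_of_set B) N \<and> b \<in> N \<and>
        N \<subseteq> fst c \<inter> fst (F 1) \<and> (\<forall>y\<in>N. snd (F 1) y = A *v snd c y + d)))"

definition linear_holonomy ::
  "'b::topological_space set \<Rightarrow> ('b, real^'n) chart set \<Rightarrow> 'b \<Rightarrow> ('b, real^'n) chart \<Rightarrow>
     (real \<Rightarrow> 'b) set \<Rightarrow> real^'n^'n" where
  "linear_holonomy B \<C> b c K = fst (affine_holonomy B \<C> b c K)"

definition Trans :: "(real^'n^'n) \<times> (real^'n) \<Rightarrow> real^'n" where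
  "Trans = (\<lambda>(A, d). d)"


section \<open>The radiance obstruction\<close>

text \<open>First cohomology of the group \<open>G\<close> with coefficients in \<open>\<real>\<^sup>n\<close>, on which \<open>G\<close> acts by \<open>\<rho>\<close>.\<close>

definition crossed_homs :: "'g monoid \<Rightarrow> ('g \<Rightarrow> real^'n^'n) \<Rightarrow> ('g \<Rightarrow> real^'n) monoid" where
  "crossed_homs G \<rho> = product_group (carrier G) (\<lambda>_. additive_group UNIV) \<lparr>carrier :=
     {f \<in> extensional (carrier G). \<forall>g\<in>carrier G. \<forall>h\<in>carrier G.
        f (g \<otimes>\<^bsub>G\<^esub> h) = f g + \<rho> g *v f h}\<rparr>"

definition principal_crossed_homs ::
  "'g monoid \<Rightarrow> ('g \<Rightarrow> real^'n^'n) \<Rightarrow> ('g \<Rightarrow> real^'n) set" where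
  "principal_crossed_homs G \<rho> = range (\<lambda>u. \<lambda>g\<in>carrier G. \<rho> g *v u - u)"

definition group_H1 :: "'g monoid \<Rightarrow> ('g \<Rightarrow> real^'n^'n) \<Rightarrow> ('g \<Rightarrow> real^'n) set monoid" where
  "group_H1 G \<rho> = crossed_homs G \<rho> Mod principal_crossed_homs G \<rho>"

definition group_H1_class ::
  "'g monoid \<Rightarrow> ('g \<Rightarrow> real^'n^'n) \<Rightarrow> ('g \<Rightarrow> real^'n) \<Rightarrow> ('g \<Rightarrow> real^'n) set" where
  "group_H1_class G \<rho> f = principal_crossed_homs G \<rho> #>\<^bsub>crossed_homs G \<rho>\<^esub> f"

text \<open>The class of \<open>Trans \<circ> a\<close> in \<open>H\<^sup>1(\<pi>\<^sub>1(B, b); \<real>\<^sup>n\<^sub>l)\<close>; here \<open>\<real>\<^sup>n\<close> is \<open>T\<^sub>b B\<close> in the coordinates \<open>c\<close>.\<close>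

definition radiance_class ::
  "'b::topological_space set \<Rightarrow> ('b, real^'n) chart set \<Rightarrow> 'b \<Rightarrow> ('b, real^'n) chart \<Rightarrow>
     ((real \<Rightarrow> 'b) set \<Rightarrow> real^'n) set" where
  "radiance_class B \<C> b c =
     group_H1_class (fundamental_group B b) (linear_holonomy B \<C> b c)
       (\<lambda>K\<in>carrier (fundamental_group B b). Trans (affine_holonomy B \<C> b c K))"

text \<open>
  Parallel transport \<open>T\<^sub>b B \<rightarrow> T\<^sub>x B\<close> along a path \<open>g\<close> from \<open>b\<close> to \<open>x\<close>, with \<open>T\<^sub>b B\<close> identified with \<open>\<real>\<^sup>n\<close> by
  the coordinates \<open>c\<close>.
\<close>

definition parallel_transport ::
  "'b::topological_space set \<Rightarrow> ('b, real^'n) chart set \<Rightarrow> ('b, real^'n) chart \<Rightarrow>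
     (real \<Rightarrow> 'b) \<Rightarrow> real^'n \<Rightarrow> ('b, real^'n) tvec" where
  "parallel_transport B \<C> c g u = (THE v. v \<in> tangent_space \<C> (g 1) \<and>
     (\<exists>F. continuation B \<C> g c F \<and> v (F 1) = u))"

text \<open>
  \<open>\<sigma> \<alpha>\<close> is a section over \<open>U \<alpha>\<close> of the universal cover of \<open>B\<close>, whose points over \<open>x\<close> are the homotopy
  classes of paths from \<open>b\<close> to \<open>x\<close>.
\<close>

definition univ_cover_sections ::
  "'b::topological_space set \<Rightarrow> 'b \<Rightarrow> 'i set \<Rightarrow> ('i \<Rightarrow> 'b set) \<Rightarrow> ('i \<Rightarrow> 'b \<Rightarrow> real \<Rightarrow> 'b) \<Rightarrow> bool"
  where
  "univ_cover_sections B b I U \<sigma> \<longleftrightarrow> (\<forall>\<alpha>\<in>I.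
     (\<forall>x\<in>U \<alpha>. path (\<sigma> \<alpha> x) \<and> path_image (\<sigma> \<alpha> x) \<subseteq> B \<and>
        pathstart (\<sigma> \<alpha> x) = b \<and> pathfinish (\<sigma> \<alpha> x) = x) \<and>
     (\<forall>h. path h \<and> path_image h \<subseteq> U \<alpha> \<longrightarrow>
        homotopic_paths B (\<sigma> \<alpha> (pathstart h) +++ h) (\<sigma> \<alpha> (pathfinish h))))"

text \<open>
  The identification of \<open>H\<^sup>1(\<pi>\<^sub>1(B, b); \<real>\<^sup>n\<^sub>l)\<close> with Cech cohomology.  The deck transformation which
  takes \<open>\<sigma> \<alpha> x\<close> to \<open>\<sigma> \<beta> x\<close> is the class of the loop \<open>\<sigma> \<beta> x * (\<sigma> \<alpha> x)\<^sup>-\<^sup>1\<close>.  Sign convention: on \<open>\<real>/\<int>\<close>, if \<open>a\<^sub>\<alpha> + t\<^sub>\<alpha>\<close> is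
  the continuation of \<open>c\<close> along \<open>\<sigma> \<alpha> x\<close>, then the holonomy of this loop is the translation by
  \<open>d\<^sub>\<beta>\<^sub>\<alpha> + t\<^sub>\<beta> - t\<^sub>\<alpha>\<close>, so that the cocycle \<open>(U\<^sub>\<alpha>, U\<^sub>\<beta>) \<mapsto> d\<^sub>\<beta>\<^sub>\<alpha>\<close> represents the radiance obstruction.
\<close>

definition crossed_hom_cochain ::
  "'b::topological_space set \<Rightarrow> ('b, real^'n) chart set \<Rightarrow> ('b, real^'n) chart \<Rightarrow> 'i set \<Rightarrow>
     ('i \<Rightarrow> 'b set) \<Rightarrow> ('i \<Rightarrow> 'b \<Rightarrow> real \<Rightarrow> 'b) \<Rightarrow> ((real \<Rightarrow> 'b) set \<Rightarrow> real^'n) \<Rightarrow>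
     'i \<times> 'i \<Rightarrow> 'b \<Rightarrow> ('b, real^'n) tvec" where
  "crossed_hom_cochain B \<C> c I U \<sigma> f = (\<lambda>(\<alpha>, \<beta>)\<in>I \<times> I. \<lambda>x\<in>U \<alpha> \<inter> U \<beta>.
     parallel_transport B \<C> c (\<sigma> \<beta> x) (f (path_class B (\<sigma> \<beta> x +++ reversepath (\<sigma> \<alpha> x)))))"

definition group_to_cech ::
  "'b::topological_space set \<Rightarrow> ('b, real^'n) chart set \<Rightarrow> ('b, real^'n) chart \<Rightarrow> 'i set \<Rightarrow>
     ('i \<Rightarrow> 'b set) \<Rightarrow> ('i \<Rightarrow> 'b \<Rightarrow> real \<Rightarrow> 'b) \<Rightarrow> ((real \<Rightarrow> 'b) set \<Rightarrow> real^'n) set \<Rightarrow>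
     ('i \<times> 'i \<Rightarrow> 'b \<Rightarrow> ('b, real^'n) tvec) set" where
  "group_to_cech B \<C> c I U \<sigma> K =
     the_elem ((\<lambda>f. cech_class (flat_TB B \<C>) I U (crossed_hom_cochain B \<C> c I U \<sigma> f)) ` K)"

definition radiance_obstruction ::
  "'b::topological_space set \<Rightarrow> ('b, real^'n) chart set \<Rightarrow> 'b \<Rightarrow> ('b, real^'n) chart \<Rightarrow> 'i set \<Rightarrow>
     ('i \<Rightarrow> 'b set) \<Rightarrow> ('i \<Rightarrow> 'b \<Rightarrow> real \<Rightarrow> 'b) \<Rightarrow>
     ('i \<times> 'i \<Rightarrow> 'b \<Rightarrow> ('b, real^'n) tvec) set" where
  "radiance_obstruction B \<C> b c I U \<sigma> = group_to_cech B \<C> c I U \<sigma> (radiance_class B \<C> b c)"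


section \<open>The relation to \<open>\<omega>\<^sub>0\<close>\<close>

text \<open>
  The remaining lemmas justify the definitions above.  By \<open>nu_form_potential\<close>, \<open>nu_form\<close> is a
  potential of \<open>\<omega>\<^sub>0\<close> over the domain of the chart.  By \<open>theta_class_contraction\<close>, the inverse of \<open>Phi_fibre\<close> takes
  \<open>v \<in> T\<^sub>x B\<close> to the class of \<open>\<omega>\<^sub>0(X, -)\<close> on the fibre over \<open>x\<close>, where \<open>X\<close> is any lift of \<open>v\<close> along that fibre.
\<close>

definition covec_of ::
  "('b, real^'n) chart set \<Rightarrow> ('b, real^'n) chart \<Rightarrow> 'b \<Rightarrow> real^'n \<Rightarrow> ('b, real^'n) covec" where
  "covec_of \<C> c x t v = (if v \<in> tangent_space \<C> x then t \<bullet> v c else 0)"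

lemma GL_intE:
  assumes "A \<in> GL_int"
  obtains A' where "A' \<in> GL_int" "A ** A' = mat 1" "A' ** A = mat 1"
  using assms unfolding GL_int_def by blast

lemma integral_matrix_vec:
  assumes "integral_matrix A" "\<And>i. k $ i \<in> \<int>"
  shows "(A *v k) $ i \<in> \<int>" "(transpose A *v k) $ i \<in> \<int>"
  using assms by (auto simp: matrix_vector_mult_def transpose_def integral_matrix_def intro!: Ints_sum Ints_mult)

locale affine_atlas =
  fixes \<C> :: "('m, 'e::euclidean_space) chart set"
  assumes inj_chart: "c \<in> \<C> \<Longrightarrow> inj_on (snd c) (fst c)"
    and open_chart: "c \<in> \<C> \<Longrightarrow> open (snd c ` fst c)"
    and local_affine: "c \<in> \<C> \<Longrightarrow> c' \<in> \<C> \<Longrightarrow> x \<in> fst c \<Longrightarrow> x \<in> fst c' \<Longrightarrow>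
      \<exists>L d M. linear L \<and> open M \<and> snd c x \<in> M \<and> M \<subseteq> snd c ` fst c \<and>
        (\<forall>y\<in>M. chart_inv c y \<in> fst c' \<and> snd c' (chart_inv c y) = L y + d)"
begin

lemma inv_chart [simp]: "c \<in> \<C> \<Longrightarrow> x \<in> fst c \<Longrightarrow> chart_inv c (snd c x) = x"
  by (simp add: chart_inv_def inj_chart)

lemma transition_has_derivative:
  fixes L :: "'e \<Rightarrow> 'e" and c c' :: "('m, 'e) chart"
  assumes "linear L" "open M" "y \<in> M" "\<And>y. y \<in> M \<Longrightarrow> snd c' (chart_inv c y) = L y + d"
  shows "(transition c c' has_derivative L) (at y)"
proof (rule has_derivative_transform_within_open[OF _ assms(2,3)])
  show "((\<lambda>y. L y + d) has_derivative L) (at y)"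
    using has_derivative_add_const linear_imp_has_derivative[OF assms(1)] by blast
qed (use assms in \<open>auto simp: transition_def\<close>)

lemma transition_self:
  assumes "c \<in> \<C>" "x \<in> fst c"
  shows "(transition c c has_derivative (\<lambda>u. u)) (at (snd c x))"
  by (rule has_derivative_transform_within_open[OF has_derivative_ident open_chart[OF assms(1)]])
    (use assms in \<open>auto simp: transition_def\<close>)

lemma coord_vector_eq:
  assumes "c' \<in> \<C>" "x \<in> fst c'" "(transition c c' has_derivative L) (at (snd c x))"
  shows "coord_vector \<C> c x u c' = L u"
  using assms frechet_derivative_at[OF assms(3)] by (simp add: coord_vector_def)

lemma coord_vector_self [simp]: "c \<in> \<C> \<Longrightarrow> x \<in> fst c \<Longrightarrow> coord_vector \<C> c x u c = u"
  by (rule coord_vector_eq) (auto intro: transition_self)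

lemma tangent_eq_coord:
  assumes "v \<in> tangent_space \<C> x" "c \<in> \<C>" "x \<in> fst c"
  shows "v = coord_vector \<C> c x (v c)"
proof
  fix c'
  have "v c' = 0" if "\<not> (c' \<in> \<C> \<and> x \<in> fst c')"
    using assms(1) that unfolding tangent_space_def by blast
  moreover have "v c' = frechet_derivative (transition c c') (at (snd c x)) (v c)"
    if "c' \<in> \<C> \<and> x \<in> fst c'"
    using assms that unfolding tangent_space_def by blast
  ultimately show "v c' = coord_vector \<C> c x (v c) c'"
    unfolding coord_vector_def by simp
qed

lemma coord_vector_tangent:
  assumes "c \<in> \<C>" "x \<in> fst c"
  shows "coord_vector \<C> c x u \<in> tangent_space \<C> x"
  unfolding tangent_space_def mem_Collect_eq
proof (intro conjI allI ballI impI)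
  show "x \<in> (\<Union>c\<in>\<C>. fst c)" using assms by auto
  fix c1 assume "\<not> (c1 \<in> \<C> \<and> x \<in> fst c1)"
  then show "coord_vector \<C> c x u c1 = 0" unfolding coord_vector_def by auto
next
  fix c1 c2 assume c: "c1 \<in> \<C>" "c2 \<in> \<C>" "x \<in> fst c1 \<and> x \<in> fst c2"
  obtain L1 d1 M1 where 1: "linear L1" "open M1" "snd c x \<in> M1"
    "\<And>y. y \<in> M1 \<Longrightarrow> chart_inv c y \<in> fst c1 \<and> snd c1 (chart_inv c y) = L1 y + d1"
    using local_affine[OF assms(1) c(1) assms(2) conjunct1[OF c(3)]] by blast
  obtain L2 d2 M2 where 2: "linear L2" "open M2" "snd c1 x \<in> M2"
    "\<And>y. y \<in> M2 \<Longrightarrow> chart_inv c1 y \<in> fst c2 \<and> snd c2 (chart_inv c1 y) = L2 y + d2"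
    using local_affine[OF c(1,2) conjunct1[OF c(3)] conjunct2[OF c(3)]] by blast
  have t1: "(transition c c1 has_derivative L1) (at (snd c x))"
    using transition_has_derivative[OF 1(1,2,3)] 1(4) by blast
  have t2: "(transition c1 c2 has_derivative L2) (at (snd c1 x))"
    using transition_has_derivative[OF 2(1,2,3)] 2(4) by blast
  have x1: "transition c c1 (snd c x) = snd c1 x" using assms by (simp add: transition_def)
  have comp: "(transition c1 c2 \<circ> transition c c1 has_derivative (L2 \<circ> L1)) (at (snd c x))"
    by (rule diff_chain_at) (use t1 t2 x1 in auto)
  have "(transition c c2 has_derivative (L2 \<circ> L1)) (at (snd c x))"
  proof (rule has_derivative_transform_within_open[OF comp 1(2,3)])
    fix y assume "y \<in> M1"
    then have "chart_inv c1 (snd c1 (chart_inv c y)) = chart_inv c y"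
      using 1(4) inv_chart[OF c(1)] by blast
    then show "(transition c1 c2 \<circ> transition c c1) y = transition c c2 y"
      by (simp add: transition_def)
  qed
  then show "coord_vector \<C> c x u c2 =
      frechet_derivative (transition c1 c2) (at (snd c1 x)) (coord_vector \<C> c x u c1)"
    using c t1 t2 by (simp add: coord_vector_eq frechet_derivative_at[OF t2, symmetric])
qed

lemma coord_vector_change:
  assumes "c \<in> \<C>" "c' \<in> \<C>" "x \<in> fst c" "x \<in> fst c'"
    "(transition c c' has_derivative L) (at (snd c x))"
  shows "coord_vector \<C> c x u = coord_vector \<C> c' x (L u)"
  using tangent_eq_coord[OF coord_vector_tangent[OF assms(1,3)] assms(2,4)]
    coord_vector_eq[OF assms(2,4,5)] by metis

lemma tangent_comp:
  assumes "v \<in> tangent_space \<C> x" "c \<in> \<C>" "c' \<in> \<C>" "x \<in> fst c" "x \<in> fst c'"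
    "(transition c c' has_derivative L) (at (snd c x))"
  shows "v c' = L (v c)"
  using tangent_eq_coord[OF assms(1,2,4)] coord_vector_eq[OF assms(3,5,6)] by metis

lemma tangent_iff: "v \<in> tangent_space \<C> x \<Longrightarrow> \<exists>c\<in>\<C>. x \<in> fst c"
  by (auto simp: tangent_space_def)

lemma chart_at:
  assumes "c \<in> \<C>" "x \<in> fst c"
  shows "chart_at \<C> x \<in> \<C>" "x \<in> fst (chart_at \<C> x)"
proof -
  have "\<exists>c. c \<in> \<C> \<and> x \<in> fst c" using assms by blast
  from someI_ex[OF this] show "chart_at \<C> x \<in> \<C>" "x \<in> fst (chart_at \<C> x)"
    unfolding chart_at_def by auto
qed

lemma pushforward_eq:
  assumes v: "v \<in> tangent_space \<C> x" and c: "c \<in> \<C>" "x \<in> fst c" and d: "d \<in> \<D>" "f x \<in> fst d"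
    and D: "((snd d \<circ> f \<circ> chart_inv c) has_derivative L) (at (snd c x))"
  shows "pushforward \<C> \<D> f x v d = L (v c)"
proof -
  define c' where "c' = chart_at \<C> x"
  have c': "c' \<in> \<C>" "x \<in> fst c'" using chart_at[OF c] by (auto simp: c'_def)
  obtain L' e M where 1: "linear L'" "open M" "snd c' x \<in> M"
    "\<And>y. y \<in> M \<Longrightarrow> chart_inv c' y \<in> fst c \<and> snd c (chart_inv c' y) = L' y + e"
    using local_affine[OF c'(1) c(1) c'(2) c(2)] by blast
  have t: "(transition c' c has_derivative L') (at (snd c' x))"
    using transition_has_derivative[OF 1(1,2,3)] 1(4) by blast
  have "transition c' c (snd c' x) = snd c x" using c' by (simp add: transition_def)
  then have comp: "((snd d \<circ> f \<circ> chart_inv c) \<circ> transition c' c has_derivative (L \<circ> L')) (at (snd c' x))"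
    by (intro diff_chain_at t) (use D in simp)
  have "((snd d \<circ> f \<circ> chart_inv c') has_derivative (L \<circ> L')) (at (snd c' x))"
  proof (rule has_derivative_transform_within_open[OF comp 1(2,3)])
    fix y assume "y \<in> M"
    then have "chart_inv c (snd c (chart_inv c' y)) = chart_inv c' y"
      using 1(4) inv_chart[OF c(1)] by blast
    then show "((snd d \<circ> f \<circ> chart_inv c) \<circ> transition c' c) y = (snd d \<circ> f \<circ> chart_inv c') y"
      by (simp add: transition_def)
  qed
  from frechet_derivative_at[OF this] have "pushforward \<C> \<D> f x v d = L (L' (v c'))"
    using d by (simp add: pushforward_def c'_def[symmetric] fun_eq_iff)
  then show ?thesis using tangent_comp[OF v c'(1) c(1) c'(2) c(2) t] by simp
qed

end

locale int_affine_atlas =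
  fixes \<C> :: "('b, real^'n) chart set"
  assumes inj_chart': "c \<in> \<C> \<Longrightarrow> inj_on (snd c) (fst c)"
    and open_chart': "c \<in> \<C> \<Longrightarrow> open (snd c ` fst c)"
    and local_int_affine: "c \<in> \<C> \<Longrightarrow> c' \<in> \<C> \<Longrightarrow> x \<in> fst c \<Longrightarrow> x \<in> fst c' \<Longrightarrow>
      \<exists>A\<in>GL_int. \<exists>d M. open M \<and> snd c x \<in> M \<and> M \<subseteq> snd c ` fst c \<and>
        (\<forall>y\<in>M. chart_inv c y \<in> fst c' \<and> snd c' (chart_inv c y) = A *v y + d)"

sublocale int_affine_atlas \<subseteq> affine_atlas
proof
  fix c c' x assume "c \<in> \<C>" "c' \<in> \<C>" "x \<in> fst c" "x \<in> fst c'"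
  from local_int_affine[OF this] show "\<exists>L d M. linear L \<and> open M \<and> snd c x \<in> M \<and> M \<subseteq> snd c ` fst c \<and>
        (\<forall>y\<in>M. chart_inv c y \<in> fst c' \<and> snd c' (chart_inv c y) = L y + d)"
    using matrix_vector_mul_linear by blast
qed (auto simp: inj_chart' open_chart')

context int_affine_atlas
begin

lemma affE:
  assumes "c \<in> \<C>" "c' \<in> \<C>" "x \<in> fst c" "x \<in> fst c'"
  obtains A A' d M where "integral_matrix A" "integral_matrix A'" "A ** A' = mat 1" "A' ** A = mat 1"
    "open M" "snd c x \<in> M" "M \<subseteq> snd c ` fst c"
    "\<And>y. y \<in> M \<Longrightarrow> chart_inv c y \<in> fst c \<and> chart_inv c y \<in> fst c' \<and> snd c (chart_inv c y) = y \<and>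
       snd c' (chart_inv c y) = A *v y + d"
    "\<And>y. y \<in> M \<Longrightarrow> (transition c c' has_derivative (*v) A) (at y)"
proof -
  obtain A d M where *: "A \<in> GL_int" "open M" "snd c x \<in> M" "M \<subseteq> snd c ` fst c"
    "\<And>y. y \<in> M \<Longrightarrow> chart_inv c y \<in> fst c' \<and> snd c' (chart_inv c y) = A *v y + d"
    using local_int_affine[OF assms] by blast
  obtain A' where A': "A' \<in> GL_int" "A ** A' = mat 1" "A' ** A = mat 1"
    using GL_intE[OF *(1)] .
  show ?thesis
  proof (rule that[of A A' M d])
    fix y assume y: "y \<in> M"
    then have "chart_inv c y \<in> fst c" "snd c (chart_inv c y) = y"
      using *(4) unfolding chart_inv_def by (blast intro: inv_into_into f_inv_into_f)+
    then show "chart_inv c y \<in> fst c \<and> chart_inv c y \<in> fst c' \<and> snd c (chart_inv c y) = y \<and>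
       snd c' (chart_inv c y) = A *v y + d" using *(5)[OF y] by blast
    show "(transition c c' has_derivative (*v) A) (at y)"
      using transition_has_derivative[OF matrix_vector_mul_linear *(2) y] *(5) by blast
  qed (use * A' in \<open>auto simp: GL_int_def\<close>)
qed

lemma cot_coord_apply:
  assumes "c \<in> \<C>" "x \<in> fst c" "p \<in> cotangent_space \<C> x"
  shows "p (coord_vector \<C> c x u) = cot_coord \<C> c x p \<bullet> u"
proof -
  have l: "linear (\<lambda>u. p (coord_vector \<C> c x u))" using assms by (auto simp: cotangent_space_def)
  have "p (coord_vector \<C> c x u) = p (coord_vector \<C> c x (\<Sum>i\<in>UNIV. u $ i *\<^sub>R axis i 1))"
    using basis_expansion[of u] by (simp only: scalar_mult_eq_scaleR)
  also have "\<dots> = (\<Sum>i\<in>UNIV. u $ i * p (coord_vector \<C> c x (axis i 1)))"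
    using linear_sum[OF l, of "\<lambda>i. u $ i *\<^sub>R axis i 1" UNIV] linear_cmul[OF l] by simp
  finally show ?thesis by (simp add: cot_coord_def inner_vec_def mult.commute)
qed

lemma covec_of_cot_coord:
  assumes "c \<in> \<C>" "x \<in> fst c" "p \<in> cotangent_space \<C> x"
  shows "covec_of \<C> c x (cot_coord \<C> c x p) = p"
proof
  fix v show "covec_of \<C> c x (cot_coord \<C> c x p) v = p v"
  proof (cases "v \<in> tangent_space \<C> x")
    case True
    then show ?thesis
      using cot_coord_apply[OF assms, of "v c"] tangent_eq_coord[OF True assms(1,2)]
      by (metis covec_of_def)
  next
    case False
    then show ?thesis using assms(3) by (simp add: covec_of_def cotangent_space_def)
  qed
qed

lemma covec_of_coord_vector:
  assumes "c \<in> \<C>" "c' \<in> \<C>" "x \<in> fst c" "x \<in> fst c'"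
    "(transition c c' has_derivative (*v) A) (at (snd c x))"
  shows "covec_of \<C> c' x t (coord_vector \<C> c x u) = t \<bullet> (A *v u)"
  using assms coord_vector_eq[OF assms(2,4,5)] coord_vector_tangent by (simp add: covec_of_def)

lemma covec_of_cotangent:
  assumes "c \<in> \<C>" "x \<in> fst c"
  shows "covec_of \<C> c x t \<in> cotangent_space \<C> x"
proof -
  have "linear (\<lambda>u. covec_of \<C> c x t (coord_vector \<C> c' x u))" if c': "c' \<in> \<C>" "x \<in> fst c'" for c'
  proof -
    obtain A where "(transition c' c has_derivative (*v) A) (at (snd c' x))"
      using affE[OF c'(1) assms(1) c'(2) assms(2)] by metis
    from covec_of_coord_vector[OF c'(1) assms(1) c'(2) assms(2) this]
    show ?thesis by (simp add: linear_iff inner_add_right matrix_vector_right_distrib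
        matrix_vector_mult_scaleR)
  qed
  then show ?thesis by (auto simp: cotangent_space_def covec_of_def)
qed

lemma cot_coord_covec_of:
  assumes "c \<in> \<C>" "x \<in> fst c"
  shows "cot_coord \<C> c x (covec_of \<C> c x t) = t"
  using assms by (simp add: cot_coord_def covec_of_def coord_vector_tangent vec_eq_iff inner_axis)

lemma covec_of_change:
  assumes "c \<in> \<C>" "c' \<in> \<C>" "x \<in> fst c" "x \<in> fst c'"
    "(transition c c' has_derivative (*v) A) (at (snd c x))"
  shows "covec_of \<C> c' x t = covec_of \<C> c x (transpose A *v t)"
  using tangent_comp[OF _ assms]
  by (auto simp: covec_of_def fun_eq_iff dot_lmul_matrix transpose_matrix_vector)

lemma covec_of_add: "covec_of \<C> c x s + covec_of \<C> c x t = covec_of \<C> c x (s + t)"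
  by (auto simp: covec_of_def fun_eq_iff inner_add_left)

lemma period_lattice_eq:
  assumes c: "c \<in> \<C>" "x \<in> fst c"
  shows "period_lattice \<C> x = {covec_of \<C> c x k | k. \<forall>i. k $ i \<in> \<int>}"
proof -
  have 1: "(\<lambda>v. \<Sum>i\<in>UNIV. of_int (k i) * dcoord \<C> c' (axis i 1) x v) = covec_of \<C> c' x (\<chi> i. of_int (k i))"
    if "x \<in> fst c'" for c' k
    using that by (auto simp: fun_eq_iff dcoord_def covec_of_def inner_vec_def[of "\<chi> i. _ i"] inner_axis)
  show ?thesis
  proof (intro equalityI subsetI)
    fix p assume "p \<in> period_lattice \<C> x"
    then obtain c' k where c': "c' \<in> \<C>" "x \<in> fst c'" and p: "p = covec_of \<C> c' x (\<chi> i. of_int (k i))"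
      using 1 unfolding period_lattice_def by blast
    obtain A where A: "integral_matrix A" "(transition c c' has_derivative (*v) A) (at (snd c x))"
      using affE[OF c(1) c'(1) c(2) c'(2)] by metis
    have "p = covec_of \<C> c x (transpose A *v (\<chi> i. of_int (k i)))"
      using p covec_of_change[OF c(1) c'(1) c(2) c'(2) A(2)] by simp
    then show "p \<in> {covec_of \<C> c x k | k. \<forall>i. k $ i \<in> \<int>}"
      using integral_matrix_vec(2)[OF A(1), of "\<chi> i. of_int (k i)"] by auto
  next
    fix p assume "p \<in> {covec_of \<C> c x k | k. \<forall>i. k $ i \<in> \<int>}"
    then obtain k where k: "p = covec_of \<C> c x k" "\<forall>i. k $ i \<in> \<int>" by blast
    have "\<forall>i. \<exists>m. k $ i = of_int m" using k(2) by (auto elim: Ints_cases)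
    then obtain k' where "\<And>i. k $ i = of_int (k' i)" by metis
    then have "k = (\<chi> i. of_int (k' i))" by (simp add: vec_eq_iff)
    then have "p = (\<lambda>v. \<Sum>i\<in>UNIV. of_int (k' i) * dcoord \<C> c (axis i 1) x v)"
      unfolding 1[OF c(2)] k(1) by (rule arg_cong)
    then show "p \<in> period_lattice \<C> x"
      unfolding period_lattice_def mem_Collect_eq using c by (intro exI[of _ c] exI[of _ k'] conjI)
  qed
qed

definition pcoset where "pcoset x p = period_lattice \<C> x #>\<^bsub>cot_group \<C> x\<^esub> p"

lemma pcoset_covec_of:
  assumes c: "c \<in> \<C>" "x \<in> fst c"
  shows "pcoset x (covec_of \<C> c x t) = {covec_of \<C> c x s | s. \<forall>i. s $ i - t $ i \<in> \<int>}"
proof -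
  have "pcoset x (covec_of \<C> c x t) = {covec_of \<C> c x (k + t) | k. \<forall>i. k $ i \<in> \<int>}"
    unfolding pcoset_def r_coset_def period_lattice_eq[OF c] additive_group_def covec_of_add[symmetric]
    by auto
  also have "\<dots> = {covec_of \<C> c x s | s. \<forall>i. s $ i - t $ i \<in> \<int>}"
  proof (intro equalityI subsetI)
    fix p assume "p \<in> {covec_of \<C> c x s | s. \<forall>i. s $ i - t $ i \<in> \<int>}"
    then obtain s where "p = covec_of \<C> c x ((s - t) + t)" "\<forall>i. (s - t) $ i \<in> \<int>" by auto
    then show "p \<in> {covec_of \<C> c x (k + t) | k. \<forall>i. k $ i \<in> \<int>}" by blast
  qed (force)
  finally show ?thesis .
qed

lemma ref_fibreE:
  assumes "T \<in> ref_fibre \<C> x" "c \<in> \<C>" "x \<in> fst c"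
  obtains t where "T = pcoset x (covec_of \<C> c x t)"
proof -
  obtain p where "p \<in> cotangent_space \<C> x" "T = pcoset x p"
    using assms(1) unfolding ref_fibre_def carrier_FactGroup pcoset_def additive_group_def by auto
  then show ?thesis using that covec_of_cot_coord[OF assms(2,3)] by metis
qed

lemma pcoset_fibre:
  assumes "c \<in> \<C>" "x \<in> fst c"
  shows "pcoset x (covec_of \<C> c x t) \<in> ref_fibre \<C> x"
  using covec_of_cotangent[OF assms]
  unfolding ref_fibre_def carrier_FactGroup pcoset_def additive_group_def by auto

lemma fibre_chart_eval:
  assumes c: "c \<in> \<C>" "x \<in> fst c" and W: "theta_window W" and s: "s \<in> W" "\<And>i. s $ i - t $ i \<in> \<int>"
  shows "pcoset x (covec_of \<C> c x t) \<in> fst (fibre_chart \<C> x c W)"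
    "snd (fibre_chart \<C> x c W) (pcoset x (covec_of \<C> c x t)) = s"
proof -
  have m: "(\<exists>p\<in>pcoset x (covec_of \<C> c x t). cot_coord \<C> c x p = r) \<longleftrightarrow> (\<forall>i. r $ i - t $ i \<in> \<int>)" for r
    unfolding pcoset_covec_of[OF c] by (force simp: cot_coord_covec_of[OF c])
  show "pcoset x (covec_of \<C> c x t) \<in> fst (fibre_chart \<C> x c W)"
  proof -
    obtain p where "p \<in> pcoset x (covec_of \<C> c x t)" "cot_coord \<C> c x p = s"
      using m s(2) by blast
    then show ?thesis using pcoset_fibre[OF c] s(1) unfolding fibre_chart_def by auto
  qed
  show "snd (fibre_chart \<C> x c W) (pcoset x (covec_of \<C> c x t)) = s"
    unfolding fibre_chart_def snd_conv m
  proof (rule the_equality)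
    fix r assume r: "r \<in> W \<and> (\<forall>i. r $ i - t $ i \<in> \<int>)"
    have "r $ i - s $ i \<in> \<int>" for i
      using r s(2)[of i] Ints_diff[of "r $ i - t $ i" "s $ i - t $ i"] by auto
    then show "r = s" using W r s(1) unfolding theta_window_def by blast
  qed (use s in auto)
qed

lemma fibre_chartE:
  assumes "T \<in> fst (fibre_chart \<C> x c W)" "c \<in> \<C>" "x \<in> fst c" "theta_window W"
  obtains t where "t \<in> W" "T = pcoset x (covec_of \<C> c x t)" "snd (fibre_chart \<C> x c W) T = t"
proof -
  from assms(1) obtain p where T: "T \<in> ref_fibre \<C> x" and p: "p \<in> T" "cot_coord \<C> c x p \<in> W"
    by (auto simp: fibre_chart_def)
  obtain t where t: "T = pcoset x (covec_of \<C> c x t)" using ref_fibreE[OF T assms(2,3)] .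
  obtain s where s: "p = covec_of \<C> c x s" "\<forall>i. s $ i - t $ i \<in> \<int>"
    using p(1) unfolding t pcoset_covec_of[OF assms(2,3)] by blast
  have sW: "s \<in> W" using p(2) s(1) cot_coord_covec_of[OF assms(2,3)] by simp
  have 1: "s $ i - r $ i \<in> \<int> \<longleftrightarrow> t $ i - r $ i \<in> \<int>" for r :: "real^'n" and i
  proof -
    have i: "s $ i - t $ i \<in> \<int>" using s by blast
    show ?thesis using Ints_add[OF i, of "t $ i - r $ i"] Ints_diff[OF _ i, of "s $ i - r $ i"] by auto
  qed
  have "r $ i - s $ i \<in> \<int> \<longleftrightarrow> r $ i - t $ i \<in> \<int>" for r :: "real^'n" and i
    using 1[of i r] by (metis Ints_minus minus_diff_eq)
  then have "{covec_of \<C> c x r | r. \<forall>i. r $ i - t $ i \<in> \<int>} = {covec_of \<C> c x r | r. \<forall>i. r $ i - s $ i \<in> \<int>}"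
    by simp
  then have "T = pcoset x (covec_of \<C> c x s)" using t pcoset_covec_of[OF assms(2,3)] by simp
  moreover have "snd (fibre_chart \<C> x c W) T = s"
    unfolding calculation by (rule fibre_chart_eval) (use assms sW in auto)
  ultimately show ?thesis using that sW by blast
qed

end

lemma theta_window_ball: "theta_window (ball (t::real^'n) (1/2))"
  unfolding theta_window_def
proof (intro conjI ballI impI)
  fix s r :: "real^'n" assume s: "s \<in> ball t (1/2)" "r \<in> ball t (1/2)" and i: "\<forall>i. s $ i - r $ i \<in> \<int>"
  have "dist s r < 1" using s dist_triangle_less_add[of s t "1/2" r "1/2"] by (simp add: dist_commute)
  show "s = r"
  proof (rule vec_eq_iff[THEN iffD2], rule allI)
    fix j
    have "\<bar>s $ j - r $ j\<bar> < 1"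
      using component_le_norm_cart[of "s - r" j] \<open>dist s r < 1\<close> by (simp add: dist_norm)
    with i show "s $ j = r $ j" using Ints_nonzero_abs_less1[of "s $ j - r $ j"] by auto
  qed
qed auto

definition wedge :: "('m, (real^'n) \<times> (real^'n)) chart \<Rightarrow> ('m, (real^'n) \<times> (real^'n)) tvec \<Rightarrow>
    ('m, (real^'n) \<times> (real^'n)) tvec \<Rightarrow> real" where
  "wedge D v w = fst (v D) \<bullet> snd (w D) - fst (w D) \<bullet> snd (v D)"

lemma linear_pair_map:
  fixes A C :: "real^'n^'n"
  shows "linear (\<lambda>(a, t). (A *v a, C *v t))"
  by (auto simp: linear_iff matrix_vector_right_distrib
      linear_scale[OF matrix_vector_mul_linear])

lemma inverse_transpose_inner:
  assumes "A' ** A = mat 1"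
  shows "(A *v h) \<bullet> (transpose A' *v u) = h \<bullet> (u::real^'n)"
proof -
  have "(A *v h) \<bullet> (transpose A' *v u) = (A' *v (A *v h)) \<bullet> u"
    by (simp add: dot_lmul_matrix[symmetric] inner_commute transpose_matrix_vector)
  then show ?thesis using assms by (simp add: matrix_vector_mul_assoc)
qed

context int_affine_atlas
begin

lemma covec_of_change':
  assumes "c \<in> \<C>" "c' \<in> \<C>" "x \<in> fst c" "x \<in> fst c'"
    "(transition c c' has_derivative (*v) A) (at (snd c x))" "A' ** A = mat 1"
  shows "covec_of \<C> c x t = covec_of \<C> c' x (transpose A' *v t)"
proof -
  have "transpose A ** transpose A' = mat 1" using assms(6) by (metis matrix_transpose_mul transpose_mat)
  then show ?thesis using covec_of_change[OF assms(1-5), of "transpose A' *v t"]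
    by (simp add: matrix_vector_mul_assoc del: transpose_matrix_vector)
qed

lemma covec_of_inj:
  assumes "c \<in> \<C>" "x \<in> fst c" "covec_of \<C> c x s = covec_of \<C> c x t"
  shows "s = t"
  using cot_coord_covec_of[OF assms(1,2)] assms(3) by metis

lemma pcoset_eqD:
  assumes "c \<in> \<C>" "x \<in> fst c" "pcoset x (covec_of \<C> c x s) = pcoset x (covec_of \<C> c x t)"
  shows "s $ i - t $ i \<in> \<int>"
proof -
  have "covec_of \<C> c x s \<in> pcoset x (covec_of \<C> c x s)"
    unfolding pcoset_covec_of[OF assms(1,2)] by (simp, rule exI[of _ s]) simp
  then have "covec_of \<C> c x s \<in> pcoset x (covec_of \<C> c x t)"
    unfolding assms(3) .
  then obtain r where "covec_of \<C> c x s = covec_of \<C> c x r" "\<forall>i. r $ i - t $ i \<in> \<int>"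
    unfolding pcoset_covec_of[OF assms(1,2)] by blast
  then show ?thesis using covec_of_inj[OF assms(1,2)] by blast
qed

lemma chart_inv_eqI:
  assumes "inj_on (snd D) (fst D)" "z \<in> fst D" "snd D z = y"
  shows "chart_inv D y = z"
  unfolding chart_inv_def using assms by (rule inv_into_f_eq)

lemma cot_chart_dom: "(x, p) \<in> fst (cot_chart \<C> c) \<longleftrightarrow> x \<in> fst c \<and> p \<in> cotangent_space \<C> x"
  by (simp add: cot_chart_def)

lemma cot_chart_val: "snd (cot_chart \<C> c) (x, p) = (snd c x, cot_coord \<C> c x p)"
  by (simp add: cot_chart_def)

lemma cot_chart_inj:
  assumes "c \<in> \<C>" shows "inj_on (snd (cot_chart \<C> c)) (fst (cot_chart \<C> c))"
proof (rule inj_onI, clarsimp simp: cot_chart_dom cot_chart_val)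
  fix x p x' p'
  assume *: "x \<in> fst c" "x' \<in> fst c" "snd c x = snd c x'" "p \<in> cotangent_space \<C> x"
    "p' \<in> cotangent_space \<C> x'" "cot_coord \<C> c x p = cot_coord \<C> c x' p'"
  then have "x = x'" using inj_chart[OF assms] by (meson inj_onD)
  then show "x = x' \<and> p = p'" using * covec_of_cot_coord[OF assms] by metis
qed

lemma cot_chart_inv:
  assumes "c \<in> \<C>" "y \<in> snd c ` fst c"
  shows "chart_inv (cot_chart \<C> c) (y, t) = (chart_inv c y, covec_of \<C> c (chart_inv c y) t)"
proof (rule chart_inv_eqI[OF cot_chart_inj[OF assms(1)]])
  have x: "chart_inv c y \<in> fst c" "snd c (chart_inv c y) = y"
    using assms(2) unfolding chart_inv_def by (auto intro: inv_into_into f_inv_into_f)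
  show "(chart_inv c y, covec_of \<C> c (chart_inv c y) t) \<in> fst (cot_chart \<C> c)"
    using x covec_of_cotangent[OF assms(1)] by (simp add: cot_chart_dom)
  show "snd (cot_chart \<C> c) (chart_inv c y, covec_of \<C> c (chart_inv c y) t) = (y, t)"
    using x cot_coord_covec_of[OF assms(1)] by (simp add: cot_chart_val)
qed

lemma cot_chart_image:
  assumes "c \<in> \<C>"
  shows "snd (cot_chart \<C> c) ` fst (cot_chart \<C> c) = (snd c ` fst c) \<times> UNIV"
proof (intro equalityI subsetI)
  fix z assume "z \<in> (snd c ` fst c) \<times> (UNIV :: (real^'n) set)"
  then obtain x t where z: "x \<in> fst c" "z = (snd c x, t)" by auto
  have "z = snd (cot_chart \<C> c) (x, covec_of \<C> c x t)"
    using z cot_coord_covec_of[OF assms] by (simp add: cot_chart_val)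
  moreover have "(x, covec_of \<C> c x t) \<in> fst (cot_chart \<C> c)"
    using z covec_of_cotangent[OF assms] by (simp add: cot_chart_dom)
  ultimately show "z \<in> snd (cot_chart \<C> c) ` fst (cot_chart \<C> c)" by blast
qed (auto simp: cot_chart_def)

lemma cot_affine_atlas: "affine_atlas (cot_atlas \<C>)"
proof
  fix D assume "D \<in> cot_atlas \<C>"
  then obtain c where c: "c \<in> \<C>" "D = cot_chart \<C> c" by (auto simp: cot_atlas_def)
  show "inj_on (snd D) (fst D)" using c cot_chart_inj by simp
  show "open (snd D ` fst D)"
    unfolding c(2) cot_chart_image[OF c(1)] using open_chart[OF c(1)] by (simp add: open_Times)
next
  fix D D' e assume D: "D \<in> cot_atlas \<C>" "D' \<in> cot_atlas \<C>" "e \<in> fst D" "e \<in> fst D'"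
  obtain c c' where c: "c \<in> \<C>" "D = cot_chart \<C> c" "c' \<in> \<C>" "D' = cot_chart \<C> c'"
    using D by (auto simp: cot_atlas_def)
  obtain x p where e: "e = (x, p)" by force
  have x: "x \<in> fst c" "x \<in> fst c'" "p \<in> cotangent_space \<C> x"
    using D(3,4) unfolding c e cot_chart_dom by auto
  obtain A A' d M where a: "A ** A' = mat 1" "A' ** A = mat 1"
    "open M" "snd c x \<in> M" "M \<subseteq> snd c ` fst c"
    "\<And>y. y \<in> M \<Longrightarrow> chart_inv c y \<in> fst c \<and> chart_inv c y \<in> fst c' \<and> snd c (chart_inv c y) = y \<and>
       snd c' (chart_inv c y) = A *v y + d"
    "\<And>y. y \<in> M \<Longrightarrow> (transition c c' has_derivative (*v) A) (at y)"
    using affE[OF c(1,3) x(1,2)] by metis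
  have loc: "chart_inv D z \<in> fst D' \<and>
      snd D' (chart_inv D z) = (\<lambda>(a, t). (A *v a, transpose A' *v t)) z + (d, 0)"
    if "z \<in> M \<times> UNIV" for z
  proof -
    obtain y t where z: "z = (y, t)" "y \<in> M" using \<open>z \<in> M \<times> UNIV\<close> by auto
    define xy where "xy = chart_inv c y"
    have xy: "xy \<in> fst c" "xy \<in> fst c'" "snd c xy = y" "snd c' xy = A *v y + d"
      using a(6)[OF z(2)] by (auto simp: xy_def)
    have "chart_inv D z = (xy, covec_of \<C> c xy t)"
      unfolding c(2) z(1) xy_def by (rule cot_chart_inv[OF c(1)]) (use z(2) a(5) in blast)
    moreover have "covec_of \<C> c xy t = covec_of \<C> c' xy (transpose A' *v t)"
      by (rule covec_of_change'[OF c(1,3) xy(1,2) _ a(2)]) (use a(7)[OF z(2)] xy in simp)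
    ultimately show ?thesis
      using xy covec_of_cotangent[OF c(3)] cot_coord_covec_of[OF c(3)]
      by (simp add: c(4) z(1) cot_chart_dom cot_chart_val)
  qed
  show "\<exists>L d M. linear L \<and> open M \<and> snd D e \<in> M \<and> M \<subseteq> snd D ` fst D \<and>
        (\<forall>y\<in>M. chart_inv D y \<in> fst D' \<and> snd D' (chart_inv D y) = L y + d)"
  proof (intro exI conjI ballI)
    show "open (M \<times> (UNIV :: (real^'n) set))" using a(3) by (simp add: open_Times)
    show "snd D e \<in> M \<times> UNIV" using a(4) by (simp add: c e cot_chart_val)
    show "M \<times> UNIV \<subseteq> snd D ` fst D" unfolding c(2) cot_chart_image[OF c(1)] using a(5) by auto
  qed (use loc linear_pair_map in blast)+
qed

lemma ref_chart_dom: "(x, T) \<in> fst (ref_chart \<C> c W) \<longleftrightarrow> x \<in> fst c \<and> T \<in> fst (fibre_chart \<C> x c W)"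
  by (simp add: ref_chart_def)

lemma ref_chart_val: "snd (ref_chart \<C> c W) (x, T) = (snd c x, snd (fibre_chart \<C> x c W) T)"
  by (simp add: ref_chart_def)

lemma ref_chart_pcoset:
  assumes "c \<in> \<C>" "x \<in> fst c" "theta_window W" "t \<in> W"
  shows "(x, pcoset x (covec_of \<C> c x t)) \<in> fst (ref_chart \<C> c W)"
    "snd (ref_chart \<C> c W) (x, pcoset x (covec_of \<C> c x t)) = (snd c x, t)"
  using fibre_chart_eval[OF assms, of t] assms(2) by (simp_all add: ref_chart_dom ref_chart_val)

lemma ref_chartE:
  assumes "e \<in> fst (ref_chart \<C> c W)" "c \<in> \<C>" "theta_window W"
  obtains x t where "x \<in> fst c" "t \<in> W" "e = (x, pcoset x (covec_of \<C> c x t))"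
    "snd (ref_chart \<C> c W) e = (snd c x, t)"
proof -
  obtain x T where e: "e = (x, T)" by force
  have x: "x \<in> fst c" and T: "T \<in> fst (fibre_chart \<C> x c W)"
    using assms(1) unfolding e ref_chart_dom by auto
  from fibre_chartE[OF T assms(2) x assms(3)] show ?thesis
    using that[OF x] e ref_chart_val by metis
qed

lemma ref_chart_inj:
  assumes "c \<in> \<C>" "theta_window W"
  shows "inj_on (snd (ref_chart \<C> c W)) (fst (ref_chart \<C> c W))"
proof (rule inj_onI)
  fix e e' assume e: "e \<in> fst (ref_chart \<C> c W)" "e' \<in> fst (ref_chart \<C> c W)"
    "snd (ref_chart \<C> c W) e = snd (ref_chart \<C> c W) e'"
  obtain x t where 1: "x \<in> fst c" "e = (x, pcoset x (covec_of \<C> c x t))"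
    "snd (ref_chart \<C> c W) e = (snd c x, t)" using ref_chartE[OF e(1) assms] by metis
  obtain x' t' where 2: "x' \<in> fst c" "e' = (x', pcoset x' (covec_of \<C> c x' t'))"
    "snd (ref_chart \<C> c W) e' = (snd c x', t')" using ref_chartE[OF e(2) assms] by metis
  have "x = x'" using 1 2 e(3) inj_chart[OF assms(1)] by (simp add: inj_on_def)
  then show "e = e'" using 1 2 e(3) by simp
qed

lemma ref_chart_inv:
  assumes "c \<in> \<C>" "theta_window W" "y \<in> snd c ` fst c" "t \<in> W"
  shows "chart_inv (ref_chart \<C> c W) (y, t) =
    (chart_inv c y, pcoset (chart_inv c y) (covec_of \<C> c (chart_inv c y) t))"
proof -
  have x: "chart_inv c y \<in> fst c" "snd c (chart_inv c y) = y"
    using assms(3) unfolding chart_inv_def by (auto intro: inv_into_into f_inv_into_f)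
  show ?thesis
    by (rule chart_inv_eqI[OF ref_chart_inj[OF assms(1,2)]])
      (use ref_chart_pcoset[OF assms(1) x(1) assms(2,4)] x in simp_all)
qed

lemma ref_chart_image:
  assumes "c \<in> \<C>" "theta_window W"
  shows "snd (ref_chart \<C> c W) ` fst (ref_chart \<C> c W) = (snd c ` fst c) \<times> W"
proof (intro equalityI subsetI)
  fix z assume "z \<in> (snd c ` fst c) \<times> W"
  then obtain x t where z: "x \<in> fst c" "t \<in> W" "z = (snd c x, t)" by auto
  then show "z \<in> snd (ref_chart \<C> c W) ` fst (ref_chart \<C> c W)"
    using ref_chart_pcoset[OF assms(1) z(1) assms(2) z(2)] by (metis image_eqI)
next
  fix z assume "z \<in> snd (ref_chart \<C> c W) ` fst (ref_chart \<C> c W)"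
  then obtain e where e: "e \<in> fst (ref_chart \<C> c W)" "z = snd (ref_chart \<C> c W) e" by blast
  from ref_chartE[OF e(1) assms] show "z \<in> (snd c ` fst c) \<times> W" using e(2) by (metis SigmaI image_eqI)
qed

lemma ref_local:
  assumes c: "c \<in> \<C>" "c' \<in> \<C>" and W: "theta_window W" "theta_window W'"
    and e: "e \<in> fst (ref_chart \<C> c W)" "e \<in> fst (ref_chart \<C> c' W')"
    and A: "(transition c c' has_derivative (*v) A) (at (snd c (fst e)))" "A' ** A = mat 1"
  shows "\<exists>d M. open M \<and> snd (ref_chart \<C> c W) e \<in> M \<and>
      M \<subseteq> snd (ref_chart \<C> c W) ` fst (ref_chart \<C> c W) \<and>
      (\<forall>z\<in>M. chart_inv (ref_chart \<C> c W) z \<in> fst (ref_chart \<C> c' W') \<and>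
        snd (ref_chart \<C> c' W') (chart_inv (ref_chart \<C> c W) z) =
          (\<lambda>(a, t). (A *v a, transpose A' *v t)) z + d)"
proof -
  obtain x t0 where 1: "x \<in> fst c" "t0 \<in> W" "e = (x, pcoset x (covec_of \<C> c x t0))"
    "snd (ref_chart \<C> c W) e = (snd c x, t0)" using ref_chartE[OF e(1) c(1) W(1)] by metis
  obtain t0' where 2: "x \<in> fst c'" "t0' \<in> W'" "e = (x, pcoset x (covec_of \<C> c' x t0'))"
    using ref_chartE[OF e(2) c(2) W(2)] 1(3) by (metis prod.inject)
  obtain A1 A1' d M where a: "A1' ** A1 = mat 1" "A1 ** A1' = mat 1"
    "open M" "snd c x \<in> M" "M \<subseteq> snd c ` fst c"
    "\<And>y. y \<in> M \<Longrightarrow> chart_inv c y \<in> fst c \<and> chart_inv c y \<in> fst c' \<and> snd c (chart_inv c y) = y \<and>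
       snd c' (chart_inv c y) = A1 *v y + d"
    "\<And>y. y \<in> M \<Longrightarrow> (transition c c' has_derivative (*v) A1) (at y)"
    using affE[OF c(1,2) 1(1) 2(1)] by metis
  have A1: "A1 = A"
    using has_derivative_unique[OF A(1), of "(*v) A1"] a(7)[OF a(4)] 1(3)
    by (simp add: matrix_eq fun_eq_iff)
  define k where "k = t0' - transpose A' *v t0"
  have k: "k $ i \<in> \<int>" for i
  proof -
    have "covec_of \<C> c x t0 = covec_of \<C> c' x (transpose A' *v t0)"
      by (rule covec_of_change'[OF c 1(1) 2(1) _ A(2)]) (use A(1) 1(3) in simp)
    then show ?thesis using pcoset_eqD[OF c(2) 2(1)] 1(3) 2(3) unfolding k_def by simp
  qed
  define N where "N = W \<inter> (\<lambda>t. transpose A' *v t + k) -` W'"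
  have "open N" unfolding N_def
    using W unfolding theta_window_def
    by (intro open_Int open_vimage continuous_intros matrix_vector_mult_linear_continuous_on) auto
  have loc: "chart_inv (ref_chart \<C> c W) z \<in> fst (ref_chart \<C> c' W') \<and>
        snd (ref_chart \<C> c' W') (chart_inv (ref_chart \<C> c W) z) =
          (\<lambda>(a, t). (A *v a, transpose A' *v t)) z + (d, k)" if zM: "z \<in> M \<times> N" for z
  proof -
    obtain y t where z: "z = (y, t)" "y \<in> M" "t \<in> W" "transpose A' *v t + k \<in> W'"
      using zM by (auto simp: N_def)
    define xy where "xy = chart_inv c y"
    have xy: "xy \<in> fst c" "xy \<in> fst c'" "snd c xy = y" "snd c' xy = A *v y + d"
      using a(6)[OF z(2)] A1 by (auto simp: xy_def)
    have i: "chart_inv (ref_chart \<C> c W) z = (xy, pcoset xy (covec_of \<C> c xy t))"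
      unfolding z(1) xy_def by (rule ref_chart_inv[OF c(1) W(1) _ z(3)]) (use z(2) a(5) in blast)
    have ct: "covec_of \<C> c xy t = covec_of \<C> c' xy (transpose A' *v t)"
      by (rule covec_of_change'[OF c xy(1,2) _ A(2)]) (use a(7)[OF z(2)] A1 xy in simp)
    have "transpose A' *v t + k - (transpose A' *v t) = k" by simp
    then have "(transpose A' *v t + k) $ i - (transpose A' *v t) $ i \<in> \<int>" for i using k by simp
    from fibre_chart_eval[OF c(2) xy(2) W(2) z(4) this] xy show ?thesis
      unfolding i ct by (simp add: ref_chart_dom ref_chart_val z(1) del: transpose_matrix_vector)
  qed
  show ?thesis
  proof (intro exI conjI)
    show "open (M \<times> N)" using a(3) \<open>open N\<close> by (rule open_Times)
    show "snd (ref_chart \<C> c W) e \<in> M \<times> N" using a(4) 1 2 by (simp add: N_def k_def)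
    show "M \<times> N \<subseteq> snd (ref_chart \<C> c W) ` fst (ref_chart \<C> c W)"
      unfolding ref_chart_image[OF c(1) W(1)] using a(5) by (auto simp: N_def)
  qed (use loc in blast)
qed

lemma ref_affine_atlas: "affine_atlas (ref_atlas \<C>)"
proof
  fix D assume "D \<in> ref_atlas \<C>"
  then obtain c W where c: "c \<in> \<C>" "theta_window W" "D = ref_chart \<C> c W" by (auto simp: ref_atlas_def)
  show "inj_on (snd D) (fst D)" using c ref_chart_inj by simp
  show "open (snd D ` fst D)"
    unfolding c(3) ref_chart_image[OF c(1,2)] using open_chart[OF c(1)] c(2)
    by (simp add: open_Times theta_window_def)
next
  fix D D' e assume D: "D \<in> ref_atlas \<C>" "D' \<in> ref_atlas \<C>" "e \<in> fst D" "e \<in> fst D'"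
  obtain c W c' W' where c: "c \<in> \<C>" "theta_window W" "D = ref_chart \<C> c W"
    "c' \<in> \<C>" "theta_window W'" "D' = ref_chart \<C> c' W'"
    using D by (auto simp: ref_atlas_def)
  have x: "fst e \<in> fst c" "fst e \<in> fst c'"
    using D(3,4) unfolding c by (cases e; simp add: ref_chart_dom)+
  obtain A A' where a: "A' ** A = mat 1" "(transition c c' has_derivative (*v) A) (at (snd c (fst e)))"
    using affE[OF c(1,4) x] by metis
  from ref_local[OF c(1,4,2,5) D(3,4)[unfolded c] a(2,1)]
  show "\<exists>L d M. linear L \<and> open M \<and> snd D e \<in> M \<and> M \<subseteq> snd D ` fst D \<and>
        (\<forall>y\<in>M. chart_inv D y \<in> fst D' \<and> snd D' (chart_inv D y) = L y + d)"
    unfolding c using linear_pair_map by blast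
qed

end

sublocale int_affine_atlas \<subseteq> R: affine_atlas "ref_atlas \<C>" by (rule ref_affine_atlas)
sublocale int_affine_atlas \<subseteq> Q: affine_atlas "cot_atlas \<C>" by (rule cot_affine_atlas)

context int_affine_atlas
begin

lemma ref_atlasI: "c \<in> \<C> \<Longrightarrow> theta_window W \<Longrightarrow> ref_chart \<C> c W \<in> ref_atlas \<C>"
  unfolding ref_atlas_def by blast

lemma ref_fst: "e \<in> fst (ref_chart \<C> c W) \<Longrightarrow> fst e \<in> fst c"
  by (cases e) (simp add: ref_chart_dom)

lemma ref_deriv:
  assumes c: "c \<in> \<C>" "c' \<in> \<C>" and W: "theta_window W" "theta_window W'"
    and e: "e \<in> fst (ref_chart \<C> c W)" "e \<in> fst (ref_chart \<C> c' W')"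
    and A: "(transition c c' has_derivative (*v) A) (at (snd c (fst e)))" "A' ** A = mat 1"
  shows "(transition (ref_chart \<C> c W) (ref_chart \<C> c' W') has_derivative
    (\<lambda>(a, t). (A *v a, transpose A' *v t))) (at (snd (ref_chart \<C> c W) e))"
proof -
  obtain d M where M: "open M" "snd (ref_chart \<C> c W) e \<in> M"
    "\<And>z. z \<in> M \<Longrightarrow> snd (ref_chart \<C> c' W') (chart_inv (ref_chart \<C> c W) z) =
          (\<lambda>(a, t). (A *v a, transpose A' *v t)) z + d"
    using ref_local[OF assms] by blast
  show ?thesis
    by (rule R.transition_has_derivative[OF linear_pair_map M])
qed

lemma wedge_indep:
  assumes D: "D \<in> ref_atlas \<C>" "D' \<in> ref_atlas \<C>" "e \<in> fst D" "e \<in> fst D'"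
    and v: "v \<in> tangent_space (ref_atlas \<C>) e" "w \<in> tangent_space (ref_atlas \<C>) e"
  shows "wedge D' v w = wedge D v w"
proof -
  obtain c W c' W' where c: "c \<in> \<C>" "theta_window W" "D = ref_chart \<C> c W"
    "c' \<in> \<C>" "theta_window W'" "D' = ref_chart \<C> c' W'"
    using D by (auto simp: ref_atlas_def)
  have x: "fst e \<in> fst c" "fst e \<in> fst c'" using D(3,4) ref_fst unfolding c by blast+
  obtain A A' where a: "A' ** A = mat 1" "(transition c c' has_derivative (*v) A) (at (snd c (fst e)))"
    using affE[OF c(1,4) x] by metis
  note t = ref_deriv[OF c(1,4,2,5) D(3,4)[unfolded c(3,6)] a(2,1), folded c(3,6)]
  note R.tangent_comp[OF v(1) D(1-4) t] R.tangent_comp[OF v(2) D(1-4) t]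
  then show ?thesis
    unfolding wedge_def by (simp add: case_prod_beta inverse_transpose_inner[OF a(1)] del: transpose_matrix_vector)
qed

lemma dtheta_eq:
  assumes c: "c \<in> \<C>" "c' \<in> \<C>" and W: "theta_window W'"
    and e: "fst e \<in> fst c" "e \<in> fst (ref_chart \<C> c' W')"
    and A: "(transition c' c has_derivative (*v) A) (at (snd c' (fst e)))" "A' ** A = mat 1"
    and v: "v \<in> tangent_space (ref_atlas \<C>) e"
  shows "dtheta \<C> c i e v = (transpose A' *v snd (v (ref_chart \<C> c' W'))) $ i"
proof -
  define W where "W = (SOME W. theta_window W \<and> e \<in> fst (ref_chart \<C> c W))"
  obtain x T where xT: "e = (x, T)" by force
  have "T \<in> ref_fibre \<C> x" using e(2) unfolding xT by (simp add: ref_chart_dom fibre_chart_def)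
  then obtain t where "T = pcoset x (covec_of \<C> c x t)" using ref_fibreE c(1) e(1) xT by (metis fst_conv)
  then have "e \<in> fst (ref_chart \<C> c (ball t (1/2)))"
    using ref_chart_pcoset[OF c(1) _ theta_window_ball] e(1) unfolding xT by simp
  then have "\<exists>W. theta_window W \<and> e \<in> fst (ref_chart \<C> c W)" using theta_window_ball by blast
  from someI_ex[OF this] have W0: "theta_window W" "e \<in> fst (ref_chart \<C> c W)"
    unfolding W_def by auto
  have "v (ref_chart \<C> c W) = (\<lambda>(a, t). (A *v a, transpose A' *v t)) (v (ref_chart \<C> c' W'))"
    by (rule R.tangent_comp[OF v _ _ e(2) W0(2)])
      (use ref_atlasI c W W0 ref_deriv[OF c(2,1) W W0(1) e(2) W0(2) A] in blast)+
  then show ?thesis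
    using v W0 unfolding dtheta_def W_def[symmetric] dcoord_def
    by (simp add: case_prod_beta inner_prod_def inner_axis del: transpose_matrix_vector)
qed

lemma ext_deriv_nu_form:
  assumes c: "c \<in> \<C>" "fst e \<in> fst c"
    and v: "v \<in> tangent_space (ref_atlas \<C>) e" "w \<in> tangent_space (ref_atlas \<C>) e"
  shows "ext_deriv (ref_atlas \<C>) (nu_form \<C> c) e v w = wedge (chart_at (ref_atlas \<C>) e) v w"
proof -
  define D where "D = chart_at (ref_atlas \<C>) e"
  have D: "D \<in> ref_atlas \<C>" "e \<in> fst D"
    using R.tangent_iff[OF v(1)] R.chart_at unfolding D_def by blast+
  obtain c' W where c': "c' \<in> \<C>" "theta_window W" "D = ref_chart \<C> c' W"
    using D by (auto simp: ref_atlas_def)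
  have x: "fst e \<in> fst c'" using D(2) ref_fst unfolding c' by blast
  obtain A A' d M where a: "A' ** A = mat 1"
    "open M" "snd c' (fst e) \<in> M" "M \<subseteq> snd c' ` fst c'"
    "\<And>y. y \<in> M \<Longrightarrow> chart_inv c' y \<in> fst c' \<and> chart_inv c' y \<in> fst c \<and> snd c' (chart_inv c' y) = y \<and>
       snd c (chart_inv c' y) = A *v y + d"
    "\<And>y. y \<in> M \<Longrightarrow> (transition c' c has_derivative (*v) A) (at y)"
    using affE[OF c'(1) c(1) x c(2)] by metis
  obtain t0 where t0: "t0 \<in> W" "snd D e = (snd c' (fst e), t0)"
    using ref_chartE[OF D(2)[unfolded c'(3)] c'(1,2)] unfolding c'(3) by (metis fst_conv)
  define comp where "comp = (\<lambda>u y. nu_form \<C> c (chart_inv D y) (coord_vector (ref_atlas \<C>) D (chart_inv D y) u))"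
  have comp: "comp u (y, t) = (A *v y + d) \<bullet> (transpose A' *v snd u)" if y: "y \<in> M" "t \<in> W" for u y t
  proof -
    define xy where "xy = chart_inv c' y"
    define ey where "ey = (xy, pcoset xy (covec_of \<C> c' xy t))"
    have xy: "xy \<in> fst c'" "xy \<in> fst c" "snd c' xy = y" "snd c xy = A *v y + d"
      using a(5)[OF y(1)] by (auto simp: xy_def)
    have i: "chart_inv D (y, t) = ey"
      unfolding c'(3) ey_def xy_def by (rule ref_chart_inv[OF c'(1,2)]) (use y a(4) in auto)
    have ey: "fst ey = xy" "ey \<in> fst D"
      unfolding c'(3) ey_def using ref_chart_pcoset[OF c'(1) xy(1) c'(2) y(2)] by auto
    have tv: "coord_vector (ref_atlas \<C>) D ey u \<in> tangent_space (ref_atlas \<C>) ey"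
      using R.coord_vector_tangent D(1) ey(2) by blast
    have "dtheta \<C> c i ey (coord_vector (ref_atlas \<C>) D ey u) = (transpose A' *v snd u) $ i" for i
      using dtheta_eq[OF c(1) c'(1,2) _ ey(2)[unfolded c'(3)] _ a(1) tv] xy a(6)[OF y(1)] ey
        R.coord_vector_self[OF D(1) ey(2), of u]
      unfolding c'(3)[symmetric] by simp
    then show ?thesis
      unfolding comp_def i nu_form_def ey(1) xy(4) by (simp only: inner_vec_def inner_real_def)
  qed
  have der: "(comp u has_derivative (\<lambda>(h, k). (A *v h) \<bullet> (transpose A' *v snd u))) (at (snd D e))" for u
  proof (rule has_derivative_transform_within_open)
    show "open (M \<times> W)" using a(2) c'(2) by (simp add: open_Times theta_window_def)
    show "snd D e \<in> M \<times> W" using t0 a(3) by simp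
    show "((\<lambda>z. (A *v fst z + d) \<bullet> (transpose A' *v snd u)) has_derivative
        (\<lambda>(h, k). (A *v h) \<bullet> (transpose A' *v snd u))) (at (snd D e))"
      unfolding case_prod_beta
      by (auto intro!: derivative_eq_intros bounded_linear.has_derivative[OF matrix_vector_mul_bounded_linear])
    fix z assume "z \<in> M \<times> W"
    then show "(A *v fst z + d) \<bullet> (transpose A' *v snd u) = comp u z"
      using comp[of "fst z" "snd z" u] by auto
  qed
  have "ext_deriv (ref_atlas \<C>) (nu_form \<C> c) e v w =
      frechet_derivative (comp (w D)) (at (snd D e)) (v D) - frechet_derivative (comp (v D)) (at (snd D e)) (w D)"
    using v by (simp add: ext_deriv_def D_def[symmetric] comp_def Let_def)
  also have "\<dots> = wedge D v w"
    unfolding frechet_derivative_at[OF der, symmetric] wedge_def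
    by (simp add: case_prod_beta inverse_transpose_inner[OF a(1)] del: transpose_matrix_vector)
  finally show ?thesis unfolding D_def .
qed

lemma can_form_eq:
  assumes v: "v \<in> tangent_space (cot_atlas \<C>) e" "w \<in> tangent_space (cot_atlas \<C>) e"
  shows "can_form \<C> e v w = wedge (chart_at (cot_atlas \<C>) e) v w"
proof -
  define D where "D = chart_at (cot_atlas \<C>) e"
  have D: "D \<in> cot_atlas \<C>" "e \<in> fst D"
    using Q.tangent_iff[OF v(1)] Q.chart_at unfolding D_def by blast+
  obtain c where c: "c \<in> \<C>" "D = cot_chart \<C> c" using D by (auto simp: cot_atlas_def)
  define comp where "comp = (\<lambda>u y. taut_form \<C> (chart_inv D y) (coord_vector (cot_atlas \<C>) D (chart_inv D y) u))"
  have comp: "comp u (y, t) = t \<bullet> fst u" if y: "y \<in> snd c ` fst c" for u y t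
  proof -
    define xy where "xy = chart_inv c y"
    define ey where "ey = (xy, covec_of \<C> c xy t)"
    have xy: "xy \<in> fst c" "snd c xy = y"
      using y unfolding xy_def chart_inv_def by (auto intro: inv_into_into f_inv_into_f)
    have i: "chart_inv D (y, t) = ey"
      unfolding c(2) ey_def xy_def by (rule cot_chart_inv[OF c(1) y])
    have ey: "ey \<in> fst D" "snd D ey = (y, t)"
      unfolding c(2) ey_def using xy covec_of_cotangent[OF c(1)] cot_coord_covec_of[OF c(1)]
      by (simp_all add: cot_chart_dom cot_chart_val)
    have tv: "coord_vector (cot_atlas \<C>) D ey u \<in> tangent_space (cot_atlas \<C>) ey"
      using Q.coord_vector_tangent D(1) ey(1) by blast
    have "pushforward (cot_atlas \<C>) \<C> fst ey (coord_vector (cot_atlas \<C>) D ey u) = coord_vector \<C> c xy (fst u)"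
    proof
      fix k
      show "pushforward (cot_atlas \<C>) \<C> fst ey (coord_vector (cot_atlas \<C>) D ey u) k = coord_vector \<C> c xy (fst u) k"
      proof (cases "k \<in> \<C> \<and> xy \<in> fst k")
        case True
        obtain A where A: "(transition c k has_derivative (*v) A) (at y)"
          using affE[OF c(1) conjunct1[OF True] xy(1) conjunct2[OF True]] xy(2) by metis
        have "((\<lambda>z. transition c k (fst z)) has_derivative (\<lambda>z. A *v fst z)) (at (y, t))"
          by (rule has_derivative_compose[OF has_derivative_fst[OF has_derivative_ident]]) (use A in simp)
        then have "((snd k \<circ> fst \<circ> chart_inv D) has_derivative (\<lambda>z. A *v fst z)) (at (snd D ey))"
          unfolding ey(2)
        proof (rule has_derivative_transform_within_open)
          show "open ((snd c ` fst c) \<times> (UNIV :: (real^'n) set))"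
            using open_chart[OF c(1)] by (simp add: open_Times)
          fix z assume z: "z \<in> (snd c ` fst c) \<times> (UNIV :: (real^'n) set)"
          show "transition c k (fst z) = (snd k \<circ> fst \<circ> chart_inv D) z"
            using z cot_chart_inv[OF c(1), of "fst z" "snd z"] unfolding c(2) transition_def by auto
        qed (use y in simp)
        from Q.pushforward_eq[OF tv D(1) ey(1), of k \<C> fst, OF _ _ this]
        have "pushforward (cot_atlas \<C>) \<C> fst ey (coord_vector (cot_atlas \<C>) D ey u) k = A *v fst u"
          using True Q.coord_vector_self[OF D(1) ey(1), of u] by (simp add: ey_def)
        then show ?thesis using coord_vector_eq[of k xy c "(*v) A"] True A xy by simp
      next
        case False
        then show ?thesis by (auto simp: pushforward_def coord_vector_def ey_def)
      qed
    qed
    then have "comp u (y, t) = covec_of \<C> c xy t (coord_vector \<C> c xy (fst u))"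
      unfolding comp_def i taut_form_def using tv by (simp add: ey_def)
    then show ?thesis using coord_vector_tangent[OF c(1) xy(1)] c(1) xy(1) by (simp add: covec_of_def)
  qed
  have eM: "snd D e \<in> (snd c ` fst c) \<times> UNIV" using D(2) unfolding c(2) cot_chart_def by auto
  have der: "(comp u has_derivative (\<lambda>z. snd z \<bullet> fst u)) (at (snd D e))" for u
  proof (rule has_derivative_transform_within_open[OF _ _ eM])
    show "open ((snd c ` fst c) \<times> (UNIV :: (real^'n) set))"
      using open_chart[OF c(1)] by (simp add: open_Times)
    show "((\<lambda>z. snd z \<bullet> fst u) has_derivative (\<lambda>z. snd z \<bullet> fst u)) (at (snd D e))"
      by (auto intro!: derivative_eq_intros)
    fix z assume "z \<in> (snd c ` fst c) \<times> (UNIV :: (real^'n) set)"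
    then show "snd z \<bullet> fst u = comp u z" using comp[of "fst z" u "snd z"] by auto
  qed
  have "can_form \<C> e v w = -
      (frechet_derivative (comp (w D)) (at (snd D e)) (v D) - frechet_derivative (comp (v D)) (at (snd D e)) (w D))"
    using v by (simp add: can_form_def ext_deriv_def D_def[symmetric] comp_def Let_def)
  also have "\<dots> = wedge D v w"
    unfolding frechet_derivative_at[OF der, symmetric] wedge_def by (simp add: inner_commute)
  finally show ?thesis unfolding D_def .
qed

lemma ref_proj_pcoset: "ref_proj \<C> (x, p) = (x, pcoset x p)"
  by (simp add: ref_proj_def pcoset_def)

lemma pushforward_ref_proj:
  assumes c: "c \<in> \<C>" and W: "theta_window W" and x: "x \<in> fst c" and t: "t \<in> W"
    and v: "v \<in> tangent_space (cot_atlas \<C>) (x, covec_of \<C> c x t)"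
  shows "pushforward (cot_atlas \<C>) (ref_atlas \<C>) (ref_proj \<C>) (x, covec_of \<C> c x t) v =
    coord_vector (ref_atlas \<C>) (ref_chart \<C> c W) (x, pcoset x (covec_of \<C> c x t)) (v (cot_chart \<C> c))"
    (is "?l = ?r")
proof
  define D where "D = cot_chart \<C> c"
  define E where "E = ref_chart \<C> c W"
  define p where "p = covec_of \<C> c x t"
  have D: "D \<in> cot_atlas \<C>" "(x, p) \<in> fst D" "snd D (x, p) = (snd c x, t)"
    using c x covec_of_cotangent[OF c x] cot_coord_covec_of[OF c x]
    by (auto simp: D_def p_def cot_atlas_def cot_chart_dom cot_chart_val)
  have E: "E \<in> ref_atlas \<C>" "(x, pcoset x p) \<in> fst E" "snd E (x, pcoset x p) = (snd c x, t)"
    using ref_atlasI[OF c W] ref_chart_pcoset[OF c x W t] by (auto simp: E_def p_def)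
  fix k
  show "?l k = ?r k"
  proof (cases "k \<in> ref_atlas \<C> \<and> (x, pcoset x p) \<in> fst k")
    case True
    obtain L d M where L: "linear L" "open M" "snd E (x, pcoset x p) \<in> M"
      "\<And>z. z \<in> M \<Longrightarrow> snd k (chart_inv E z) = L z + d"
      using R.local_affine[OF E(1) conjunct1[OF True] E(2) conjunct2[OF True]] by blast
    have T: "(transition E k has_derivative L) (at (snd c x, t))"
      using R.transition_has_derivative[OF L(1,2,3)] L(4) unfolding E(3) by blast
    have "((snd k \<circ> ref_proj \<C> \<circ> chart_inv D) has_derivative L) (at (snd D (x, p)))"
      unfolding D(3)
    proof (rule has_derivative_transform_within_open[OF T])
      show "open ((snd c ` fst c) \<times> W)"
        using open_chart[OF c] W by (simp add: open_Times theta_window_def)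
      show "(snd c x, t) \<in> (snd c ` fst c) \<times> W" using x t by simp
      fix z assume "z \<in> (snd c ` fst c) \<times> W"
      then obtain y s where z: "z = (y, s)" "y \<in> snd c ` fst c" "s \<in> W" by auto
      show "transition E k z = (snd k \<circ> ref_proj \<C> \<circ> chart_inv D) z"
        using ref_chart_inv[OF c W z(2,3)] cot_chart_inv[OF c z(2), of s]
        by (simp add: transition_def E_def D_def z(1) ref_proj_pcoset)
    qed
    from Q.pushforward_eq[OF v[folded p_def] D(1,2), of k "ref_atlas \<C>" "ref_proj \<C>", OF _ _ this] True
    have "?l k = L (v D)" by (simp add: p_def ref_proj_pcoset)
    moreover have "?r k = L (v D)"
      using R.coord_vector_eq[of k "(x, pcoset x p)" E L "v D"] True T E(3)
      unfolding E_def D_def p_def by simp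
    ultimately show ?thesis by simp
  next
    case False
    then show ?thesis by (auto simp: pushforward_def coord_vector_def p_def ref_proj_pcoset)
  qed
qed

lemma omega0_eq:
  assumes "v \<in> tangent_space (ref_atlas \<C>) e" "w \<in> tangent_space (ref_atlas \<C>) e"
  shows "omega0 \<C> e v w = wedge (chart_at (ref_atlas \<C>) e) v w"
proof -
  define \<omega> where "\<omega> = (\<lambda>e v w. if v \<in> tangent_space (ref_atlas \<C>) e \<and> w \<in> tangent_space (ref_atlas \<C>) e
     then wedge (chart_at (ref_atlas \<C>) e) v w else 0)"
  let ?q = "pushforward (cot_atlas \<C>) (ref_atlas \<C>) (ref_proj \<C>)"
  have "omega0 \<C> = \<omega>"
    unfolding omega0_def
  proof (rule the_equality, intro conjI)
    show "\<forall>e v w. v \<notin> tangent_space (ref_atlas \<C>) e \<or> w \<notin> tangent_space (ref_atlas \<C>) e \<longrightarrow> \<omega> e v w = 0"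
      by (auto simp: \<omega>_def)
    show "pullback2 (cot_atlas \<C>) (ref_atlas \<C>) (ref_proj \<C>) \<omega> = can_form \<C>"
    proof (intro ext)
      fix e v w
      show "pullback2 (cot_atlas \<C>) (ref_atlas \<C>) (ref_proj \<C>) \<omega> e v w = can_form \<C> e v w"
      proof (cases "v \<in> tangent_space (cot_atlas \<C>) e \<and> w \<in> tangent_space (cot_atlas \<C>) e")
        case True
        define D where "D = chart_at (cot_atlas \<C>) e"
        have D: "D \<in> cot_atlas \<C>" "e \<in> fst D"
          using Q.tangent_iff[OF conjunct1[OF True]] Q.chart_at unfolding D_def by blast+
        obtain c where c: "c \<in> \<C>" "D = cot_chart \<C> c" using D by (auto simp: cot_atlas_def)
        obtain x p where e: "e = (x, p)" by force
        have x: "x \<in> fst c" "p \<in> cotangent_space \<C> x" using D(2) unfolding c e cot_chart_dom by auto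
        define t where "t = cot_coord \<C> c x p"
        have p: "p = covec_of \<C> c x t" using covec_of_cot_coord[OF c(1) x] t_def by simp
        define E where "E = ref_chart \<C> c (ball t (1/2))"
        have E: "E \<in> ref_atlas \<C>" "ref_proj \<C> e \<in> fst E"
          using ref_atlasI[OF c(1) theta_window_ball] ref_chart_pcoset[OF c(1) x(1) theta_window_ball, of t]
          by (auto simp: E_def e p ref_proj_pcoset)
        have q: "?q e u = coord_vector (ref_atlas \<C>) E (ref_proj \<C> e) (u D)"
          if "u \<in> tangent_space (cot_atlas \<C>) e" for u
          using pushforward_ref_proj[OF c(1) theta_window_ball x(1), of t t u] that
          by (simp add: e p E_def c(2) ref_proj_pcoset)
        have tq: "?q e u \<in> tangent_space (ref_atlas \<C>) (ref_proj \<C> e)"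
          if "u \<in> tangent_space (cot_atlas \<C>) e" for u
          unfolding q[OF that] by (rule R.coord_vector_tangent[OF E])
        have "pullback2 (cot_atlas \<C>) (ref_atlas \<C>) (ref_proj \<C>) \<omega> e v w =
            wedge (chart_at (ref_atlas \<C>) (ref_proj \<C> e)) (?q e v) (?q e w)"
          using True tq by (simp add: pullback2_def \<omega>_def)
        also have "\<dots> = wedge E (?q e v) (?q e w)"
          using wedge_indep[OF E(1) R.chart_at(1)[OF E] E(2) R.chart_at(2)[OF E]] tq True by blast
        also have "\<dots> = wedge D v w"
          using True R.coord_vector_self[OF E] by (simp add: wedge_def q)
        also have "\<dots> = can_form \<C> e v w" using can_form_eq True unfolding D_def by metis
        finally show ?thesis .
      next
        case False
        then show ?thesis by (auto simp: pullback2_def can_form_def ext_deriv_def)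
      qed
    qed
  next
    fix \<omega>' assume \<omega>': "(\<forall>e v w. v \<notin> tangent_space (ref_atlas \<C>) e \<or> w \<notin> tangent_space (ref_atlas \<C>) e
        \<longrightarrow> \<omega>' e v w = 0) \<and>
      pullback2 (cot_atlas \<C>) (ref_atlas \<C>) (ref_proj \<C>) \<omega>' = can_form \<C>"
    from \<omega>' have pb: "pullback2 (cot_atlas \<C>) (ref_atlas \<C>) (ref_proj \<C>) \<omega>' = can_form \<C>" by blast
    show "\<omega>' = \<omega>"
    proof (intro ext)
      fix e v w
      show "\<omega>' e v w = \<omega> e v w"
      proof (cases "v \<in> tangent_space (ref_atlas \<C>) e \<and> w \<in> tangent_space (ref_atlas \<C>) e")
        case True
        obtain E where E: "E \<in> ref_atlas \<C>" "e \<in> fst E" using R.tangent_iff True by blast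
        then obtain c W where c: "c \<in> \<C>" "theta_window W" "E = ref_chart \<C> c W"
          by (auto simp: ref_atlas_def)
        obtain x t where x: "x \<in> fst c" "t \<in> W" "e = (x, pcoset x (covec_of \<C> c x t))"
          using ref_chartE[OF E(2)[unfolded c(3)] c(1,2)] by metis
        define p where "p = covec_of \<C> c x t"
        define D where "D = cot_chart \<C> c"
        have D: "D \<in> cot_atlas \<C>" "(x, p) \<in> fst D"
          using c x covec_of_cotangent[OF c(1) x(1)] by (auto simp: D_def p_def cot_atlas_def cot_chart_dom)
        define l where "l u = coord_vector (cot_atlas \<C>) D (x, p) (u E)" for u :: "('b \<times> ('b, real^'n) covec set, (real^'n) \<times> (real^'n)) tvec"
        have l: "l u \<in> tangent_space (cot_atlas \<C>) (x, p)" for u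
          unfolding l_def by (rule Q.coord_vector_tangent[OF D])
        have q: "?q (x, p) (l u) = u" if "u \<in> tangent_space (ref_atlas \<C>) e" for u
        proof -
          have "?q (x, p) (l u) = coord_vector (ref_atlas \<C>) E e (l u D)"
            using pushforward_ref_proj[OF c(1,2) x(1,2), folded p_def, OF l] x(3)
            by (simp add: c(3) D_def p_def)
          also have "l u D = u E" unfolding l_def by (rule Q.coord_vector_self[OF D])
          finally show ?thesis using R.tangent_eq_coord[OF that E] by simp
        qed
        have e: "ref_proj \<C> (x, p) = e" using x(3) by (simp add: ref_proj_pcoset p_def)
        have "\<omega>' e v w = can_form \<C> (x, p) (l v) (l w)"
          unfolding pb[symmetric] pullback2_def using l q True e by simp
        also have "\<dots> = wedge (chart_at (cot_atlas \<C>) (x, p)) (l v) (l w)" by (rule can_form_eq[OF l l])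
        also have "\<dots> = \<omega> e v w"
        proof -
          define D' where "D' = chart_at (cot_atlas \<C>) (x, p)"
          have D': "D' \<in> cot_atlas \<C>" "(x, p) \<in> fst D'" using Q.chart_at[OF D] by (auto simp: D'_def)
          then obtain c' where c': "c' \<in> \<C>" "D' = cot_chart \<C> c'" by (auto simp: cot_atlas_def)
          have x': "x \<in> fst c'" "p \<in> cotangent_space \<C> x" using D'(2) unfolding c'(2) cot_chart_dom by auto
          define t' where "t' = cot_coord \<C> c' x p"
          have p': "p = covec_of \<C> c' x t'" using covec_of_cot_coord[OF c'(1) x'] t'_def by simp
          define E' where "E' = ref_chart \<C> c' (ball t' (1/2))"
          have E': "E' \<in> ref_atlas \<C>" "e \<in> fst E'"
            using ref_atlasI[OF c'(1) theta_window_ball] ref_chart_pcoset[OF c'(1) x'(1) theta_window_ball, of t']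
            by (auto simp: E'_def e[symmetric] p' ref_proj_pcoset)
          have "u E' = l u D'" if "u \<in> tangent_space (ref_atlas \<C>) e" for u
          proof -
            have "?q (x, p) (l u) = coord_vector (ref_atlas \<C>) E' e (l u D')"
              using pushforward_ref_proj[OF c'(1) theta_window_ball x'(1), of t' t', folded p'] l e
              by (simp add: c'(2) E'_def ref_proj_pcoset)
            then show ?thesis using q[OF that] R.coord_vector_self[OF E'] by metis
          qed
          then have "wedge D' (l v) (l w) = wedge E' v w" using True by (simp add: wedge_def)
          also have "\<dots> = wedge (chart_at (ref_atlas \<C>) e) v w"
            using wedge_indep[OF R.chart_at(1)[OF E'] E'(1) R.chart_at(2)[OF E'] E'(2)] True by blast
          finally show ?thesis using True by (simp add: D'_def \<omega>_def)
        qed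
        finally show ?thesis .
      next
        case False
        then have "\<omega>' e v w = 0" using \<omega>' by blast
        then show ?thesis using False unfolding \<omega>_def by auto
      qed
    qed
  qed
  then show ?thesis using assms by (simp add: \<omega>_def)
qed

lemma nu_form_potential_aux:
  assumes "c \<in> \<C>" "fst e \<in> fst c"
    "v \<in> tangent_space (ref_atlas \<C>) e" "w \<in> tangent_space (ref_atlas \<C>) e"
  shows "ext_deriv (ref_atlas \<C>) (nu_form \<C> c) e v w = omega0 \<C> e v w"
  using ext_deriv_nu_form[OF assms] omega0_eq[OF assms(3,4)] by simp

end

lemma chart_locally_affine:
  assumes c: "top_chart B c" "openin (top_of_set B) (fst c')" "int_affine_compatible c c'"
    and x: "x \<in> fst c" "x \<in> fst c'"
  shows "\<exists>A\<in>GL_int. \<exists>d N. openin (top_of_set B) N \<and> x \<in> N \<and> N \<subseteq> fst c \<inter> fst c' \<and>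
    (\<forall>y\<in>N. snd c' y = A *v snd c y + d)"
proof -
  obtain \<psi> where h: "homeomorphism (fst c) (snd c ` fst c) (snd c) \<psi>"
    using c(1) by (auto simp: top_chart_def)
  have oc: "openin (top_of_set B) (fst c)" "open (snd c ` fst c)" using c(1) by (auto simp: top_chart_def)
  define W where "W = fst c \<inter> fst c'"
  have "openin (top_of_set (fst c)) W"
    unfolding W_def using openin_subset_trans[OF openin_Int[OF oc(1) c(2)]] openin_imp_subset[OF oc(1)]
    by blast
  then have "open (snd c ` W)"
    using homeomorphism_imp_open_map[OF h] oc(2) openin_open_trans by blast
  moreover have "snd c x \<in> snd c ` W" using x by (simp add: W_def)
  ultimately obtain r where r: "r > 0" "ball (snd c x) r \<subseteq> snd c ` W"
    using open_contains_ball by blast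
  define N where "N = \<psi> ` ball (snd c x) r"
  have N_eq: "N = fst c \<inter> snd c -` ball (snd c x) r"
    using h r(2) unfolding N_def W_def homeomorphism_def by (auto simp: image_iff) force+
  have NW: "N \<subseteq> W"
    using h r(2) unfolding N_def W_def homeomorphism_def by fastforce
  have "connected N" unfolding N_def
    by (rule connected_continuous_image)
      (use h r(2) in \<open>auto simp: homeomorphism_def W_def intro: continuous_on_subset\<close>)
  have xN: "x \<in> N" using x r(1) by (simp add: N_eq)
  have "openin (top_of_set (fst c)) N"
    unfolding N_eq using h by (auto simp: homeomorphism_def intro: continuous_openin_preimage_gen)
  then have oN: "openin (top_of_set B) N" using openin_trans oc(1) by blast
  have xW: "x \<in> W" using x by (simp add: W_def)
  then have "connected_component_set W x \<in> components W" by (auto simp: components_def)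
  then obtain A d where "A \<in> GL_int" "\<forall>y\<in>connected_component_set W x. snd c' y = A *v snd c y + d"
    using c(3) unfolding int_affine_compatible_def W_def by blast
  moreover have "N \<subseteq> connected_component_set W x"
    by (rule connected_component_maximal[OF xN \<open>connected N\<close> NW])
  ultimately show ?thesis using oN xN NW unfolding W_def by blast
qed

lemma integral_matrix_mult: "integral_matrix A \<Longrightarrow> integral_matrix C \<Longrightarrow> integral_matrix (A ** C)"
  by (auto simp: integral_matrix_def matrix_matrix_mult_def intro!: Ints_sum Ints_mult)

lemma GL_int_mult:
  assumes "A \<in> GL_int" "C \<in> GL_int"
  shows "A ** C \<in> GL_int"
proof -
  obtain A' where A: "A' \<in> GL_int" "A ** A' = mat 1" "A' ** A = mat 1" using GL_intE[OF assms(1)] .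
  obtain C' where C: "C' \<in> GL_int" "C ** C' = mat 1" "C' ** C = mat 1" using GL_intE[OF assms(2)] .
  have "(A ** C) ** (C' ** A') = A ** (C ** C') ** A'" "(C' ** A') ** (A ** C) = C' ** (A' ** A) ** C"
    by (simp_all add: matrix_mul_assoc)
  then have "(A ** C) ** (C' ** A') = mat 1" "(C' ** A') ** (A ** C) = mat 1"
    using A C by simp_all
  then show ?thesis using assms A(1) C(1) integral_matrix_mult unfolding GL_int_def by blast
qed

lemma int_affine_atlas_charts:
  assumes m: "integral_affine_manifold B \<A>"
  shows "int_affine_atlas (int_affine_charts B \<A>)"
proof
  fix c assume "c \<in> int_affine_charts B \<A>"
  then have "top_chart B c" by (simp add: int_affine_charts_def)
  then obtain \<psi> where "homeomorphism (fst c) (snd c ` fst c) (snd c) \<psi>" "open (snd c ` fst c)"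
    by (auto simp: top_chart_def)
  then show "inj_on (snd c) (fst c)" "open (snd c ` fst c)"
    by (auto simp: homeomorphism_def intro: inj_on_inverseI)
next
  fix c c' x
  assume c: "c \<in> int_affine_charts B \<A>" "c' \<in> int_affine_charts B \<A>" and x: "x \<in> fst c" "x \<in> fst c'"
  have t: "top_chart B c" "top_chart B c'" using c by (auto simp: int_affine_charts_def)
  have "x \<in> B" using t(1) x(1) openin_imp_subset unfolding top_chart_def by blast
  then obtain k where k: "k \<in> \<A>" "x \<in> fst k" using m unfolding integral_affine_manifold_def by blast
  have ok: "openin (top_of_set B) (fst k)" using m k unfolding integral_affine_manifold_def top_chart_def by blast
  have comp: "int_affine_compatible c k" "int_affine_compatible c' k"
    using c k by (auto simp: int_affine_charts_def)
  obtain A d N where A: "A \<in> GL_int" "openin (top_of_set B) N" "x \<in> N" "N \<subseteq> fst c \<inter> fst k"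
    "\<forall>y\<in>N. snd k y = A *v snd c y + d"
    using chart_locally_affine[OF t(1) ok comp(1) x(1) k(2)] by blast
  obtain C f N' where C: "C \<in> GL_int" "openin (top_of_set B) N'" "x \<in> N'" "N' \<subseteq> fst c' \<inter> fst k"
    "\<forall>y\<in>N'. snd k y = C *v snd c' y + f"
    using chart_locally_affine[OF t(2) ok comp(2) x(2) k(2)] by blast
  obtain C' where C': "C' \<in> GL_int" "C' ** C = mat 1" using GL_intE[OF C(1)] by metis
  obtain \<psi> where h: "homeomorphism (fst c) (snd c ` fst c) (snd c) \<psi>" "open (snd c ` fst c)"
    using t(1) by (auto simp: top_chart_def)
  have inj: "inj_on (snd c) (fst c)" using h(1) by (auto simp: homeomorphism_def intro: inj_on_inverseI)
  define M where "M = snd c ` (N \<inter> N')"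
  have "openin (top_of_set (fst c)) (N \<inter> N')"
    using openin_subset_trans[OF openin_Int[OF A(2) C(2)]] A(4) t(1) openin_imp_subset
    unfolding top_chart_def by blast
  then have "open M"
    unfolding M_def using homeomorphism_imp_open_map[OF h(1)] h(2) openin_open_trans by blast
  moreover have "snd c x \<in> M" using A(3) C(3) by (simp add: M_def)
  moreover have "M \<subseteq> snd c ` fst c" using A(4) by (auto simp: M_def)
  moreover have "chart_inv c y \<in> fst c' \<and> snd c' (chart_inv c y) = (C' ** A) *v y + C' *v (d - f)"
    if "y \<in> M" for y
  proof -
    obtain z where z: "z \<in> N" "z \<in> N'" "y = snd c z" using \<open>y \<in> M\<close> by (auto simp: M_def)
    have i: "chart_inv c y = z" unfolding chart_inv_def using z A(4) inj by (auto intro: inv_into_f_f)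
    have "C *v snd c' z + f = A *v y + d" using A(5) C(5) z by metis
    then have "C *v snd c' z = A *v y + (d - f)" by (simp add: algebra_simps)
    then have "C' *v (C *v snd c' z) = C' *v (A *v y + (d - f))" by simp
    then show ?thesis
      using i z C(4) C'(2) by (auto simp: matrix_vector_mul_assoc matrix_vector_right_distrib)
  qed
  ultimately show "\<exists>A\<in>GL_int. \<exists>d M. open M \<and> snd c x \<in> M \<and> M \<subseteq> snd c ` fst c \<and>
      (\<forall>y\<in>M. chart_inv c y \<in> fst c' \<and> snd c' (chart_inv c y) = A *v y + d)"
    using GL_int_mult[OF C'(1) A(1)] by blast
qed

context int_affine_atlas
begin

lemma pushforward_Pair:
  assumes u: "u \<in> tangent_space (fibre_atlas \<C> x) T"
  obtains c W where "c \<in> \<C>" "x \<in> fst c" "theta_window W" "(x, T) \<in> fst (ref_chart \<C> c W)"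
    "pushforward (fibre_atlas \<C> x) (ref_atlas \<C>) (Pair x) T u =
      coord_vector (ref_atlas \<C>) (ref_chart \<C> c W) (x, T) (0, u (fibre_chart \<C> x c W))"
proof -
  define K where "K = chart_at (fibre_atlas \<C> x) T"
  have "\<exists>K. K \<in> fibre_atlas \<C> x \<and> T \<in> fst K" using u by (auto simp: tangent_space_def)
  from someI_ex[OF this] have K: "K \<in> fibre_atlas \<C> x" "T \<in> fst K" unfolding K_def chart_at_def by auto
  obtain c W where c: "c \<in> \<C>" "x \<in> fst c" "theta_window W" "K = fibre_chart \<C> x c W"
    using K(1) unfolding fibre_atlas_def by blast
  define D where "D = ref_chart \<C> c W"
  obtain t where t: "t \<in> W" "T = pcoset x (covec_of \<C> c x t)" "snd K T = t"
    using fibre_chartE[OF K(2)[unfolded c(4)] c(1-3)] unfolding c(4) by metis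
  have D: "D \<in> ref_atlas \<C>" "(x, T) \<in> fst D" "snd D (x, T) = (snd c x, t)"
    using ref_atlasI[OF c(1,3)] ref_chart_pcoset[OF c(1,2,3) t(1)] by (auto simp: D_def t(2))
  have injK: "inj_on (snd K) (fst K)"
  proof (rule inj_onI)
    fix S S' assume S: "S \<in> fst K" "S' \<in> fst K" "snd K S = snd K S'"
    show "S = S'" using fibre_chartE[OF S(1)[unfolded c(4)] c(1-3)] fibre_chartE[OF S(2)[unfolded c(4)] c(1-3)] S(3)
      unfolding c(4) by metis
  qed
  have invK: "chart_inv K s = pcoset x (covec_of \<C> c x s)" if "s \<in> W" for s
    by (rule chart_inv_eqI[OF injK]) (use fibre_chart_eval[OF c(1-3) that, of s] c(4) in auto)
  have "pushforward (fibre_atlas \<C> x) (ref_atlas \<C>) (Pair x) T u k = coord_vector (ref_atlas \<C>) D (x, T) (0, u K) k" for k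
  proof (cases "k \<in> ref_atlas \<C> \<and> (x, T) \<in> fst k")
    case True
    obtain L d M where L: "linear L" "open M" "snd D (x, T) \<in> M"
      "\<And>z. z \<in> M \<Longrightarrow> snd k (chart_inv D z) = L z + d"
      using R.local_affine[OF D(1) conjunct1[OF True] D(2) conjunct2[OF True]] by blast
    have LD: "(transition D k has_derivative L) (at (snd c x, t))"
      using R.transition_has_derivative[OF L(1,2,3)] L(4) unfolding D(3) by blast
    have "((\<lambda>s. transition D k (snd c x, s)) has_derivative (\<lambda>s. L (0, s))) (at t)"
      by (rule has_derivative_compose[of "\<lambda>s. (snd c x, s)" "\<lambda>s. (0, s)" t UNIV "transition D k" L, OF _ LD])
        (auto intro!: derivative_eq_intros)
    then have "((snd k \<circ> Pair x \<circ> chart_inv K) has_derivative (\<lambda>s. L (0, s))) (at (snd K T))"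
      unfolding t(3)
    proof (rule has_derivative_transform_within_open)
      show "open W" "t \<in> W" using c(3) t(1) by (auto simp: theta_window_def)
      fix s assume s: "s \<in> W"
      show "transition D k (snd c x, s) = (snd k \<circ> Pair x \<circ> chart_inv K) s"
        using ref_chart_inv[OF c(1,3) _ s, of "snd c x"] c(1,2) invK[OF s]
        by (simp add: transition_def D_def)
    qed
    from frechet_derivative_at[OF this] have "pushforward (fibre_atlas \<C> x) (ref_atlas \<C>) (Pair x) T u k = L (0, u K)"
      using True by (simp add: pushforward_def K_def[symmetric] fun_eq_iff)
    then show ?thesis using R.coord_vector_eq[of k "(x, T)" D L] True LD D(3) by simp
  qed (auto simp: pushforward_def coord_vector_def)
  then show ?thesis using that[OF c(1-3)] D unfolding D_def c(4) by blast
qed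

lemma pushforward_base:
  assumes c: "c \<in> \<C>" "theta_window W" "e \<in> fst (ref_chart \<C> c W)" and w: "w \<in> tangent_space (ref_atlas \<C>) e"
  shows "pushforward (ref_atlas \<C>) \<C> fst e w c = fst (w (ref_chart \<C> c W))"
proof -
  define D where "D = ref_chart \<C> c W"
  have D: "D \<in> ref_atlas \<C>" "e \<in> fst D" using ref_atlasI[OF c(1,2)] c(3) by (auto simp: D_def)
  have "((snd c \<circ> fst \<circ> chart_inv D) has_derivative fst) (at (snd D e))"
  proof (rule has_derivative_transform_within_open[OF has_derivative_fst[OF has_derivative_ident]])
    show "open ((snd c ` fst c) \<times> W)" using open_chart[OF c(1)] c(2) by (simp add: open_Times theta_window_def)
    show "snd D e \<in> (snd c ` fst c) \<times> W" using ref_chart_image[OF c(1,2)] c(3) unfolding D_def by blast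
    fix z assume "z \<in> (snd c ` fst c) \<times> W"
    then show "fst z = (snd c \<circ> fst \<circ> chart_inv D) z"
      using ref_chart_inv[OF c(1,2), of "fst z" "snd z"] c(1) unfolding D_def by auto
  qed
  from R.pushforward_eq[OF w D, of c \<C> fst, OF c(1) ref_fst[OF c(3)] this] show ?thesis by (simp add: D_def)
qed

lemma theta_class_contraction_aux:
  assumes c: "c \<in> \<C>" "x \<in> fst c" and v: "v \<in> tangent_space \<C> x"
    and X: "\<And>T. T \<in> ref_fibre \<C> x \<Longrightarrow> X T \<in> tangent_space (ref_atlas \<C>) (x, T)"
      "\<And>T. T \<in> ref_fibre \<C> x \<Longrightarrow> pushforward (ref_atlas \<C>) \<C> fst (x, T) (X T) = v"
  shows "deRham_class (fibre_atlas \<C> x)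
      (\<lambda>T. pullback1 (fibre_atlas \<C> x) (ref_atlas \<C>) (Pair x) (\<lambda>e. omega0 \<C> e (X (snd e))) T) =
    theta_class \<C> c (v c) x"
proof -
  have "pullback1 (fibre_atlas \<C> x) (ref_atlas \<C>) (Pair x) (\<lambda>e. omega0 \<C> e (X (snd e))) T u =
    fibre_restrict \<C> x (\<lambda>e w. \<Sum>i\<in>UNIV. v c $ i * dtheta \<C> c i e w) T u" for T u
  proof (cases "u \<in> tangent_space (fibre_atlas \<C> x) T")
    case True
    define iu where "iu = pushforward (fibre_atlas \<C> x) (ref_atlas \<C>) (Pair x) T u"
    obtain c' W where c': "c' \<in> \<C>" "x \<in> fst c'" "theta_window W" "(x, T) \<in> fst (ref_chart \<C> c' W)"
      "iu = coord_vector (ref_atlas \<C>) (ref_chart \<C> c' W) (x, T) (0, u (fibre_chart \<C> x c' W))"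
      using pushforward_Pair[OF True] unfolding iu_def by metis
    define D where "D = ref_chart \<C> c' W"
    have D: "D \<in> ref_atlas \<C>" "(x, T) \<in> fst D" using ref_atlasI[OF c'(1,3)] c'(4) by (auto simp: D_def)
    have T: "T \<in> ref_fibre \<C> x" using c'(4) by (simp add: ref_chart_dom fibre_chart_def)
    have iu: "iu \<in> tangent_space (ref_atlas \<C>) (x, T)" "iu D = (0, u (fibre_chart \<C> x c' W))"
      using R.coord_vector_tangent[OF D] R.coord_vector_self[OF D] unfolding c'(5) D_def[symmetric] by auto
    obtain A A' where a: "A' ** A = mat 1" "(transition c' c has_derivative (*v) A) (at (snd c' x))"
      using affE[OF c'(1) c(1) c'(2) c(2)] by metis
    have "omega0 \<C> (x, T) (X T) iu = wedge D (X T) iu"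
      using omega0_eq[OF X(1)[OF T] iu(1)]
        wedge_indep[OF D(1) R.chart_at(1)[OF D] D(2) R.chart_at(2)[OF D] X(1)[OF T] iu(1)] by simp
    also have "\<dots> = v c' \<bullet> snd (iu D)"
      using pushforward_base[OF c'(1,3,4) X(1)[OF T]] X(2)[OF T] iu(2) by (simp add: wedge_def D_def)
    also have "\<dots> = v c \<bullet> (transpose A' *v snd (iu D))"
      using tangent_comp[OF v c'(1) c(1) c'(2) c(2) a(2)] inverse_transpose_inner[OF a(1)] by simp
    also have "\<dots> = (\<Sum>i\<in>UNIV. v c $ i * dtheta \<C> c i (x, T) iu)"
      using dtheta_eq[OF c(1) c'(1,3) _ c'(4) _ a(1) iu(1)] c(2) a(2)
      by (simp add: inner_vec_def D_def del: transpose_matrix_vector)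
    finally show ?thesis using True by (simp add: pullback1_def fibre_restrict_def iu_def)
  next
    case False
    then show ?thesis by (simp add: pullback1_def fibre_restrict_def)
  qed
  then have "(\<lambda>T. pullback1 (fibre_atlas \<C> x) (ref_atlas \<C>) (Pair x) (\<lambda>e. omega0 \<C> e (X (snd e))) T) =
    fibre_restrict \<C> x (\<lambda>e w. \<Sum>i\<in>UNIV. v c $ i * dtheta \<C> c i e w)"
    by (intro ext)
  then show ?thesis unfolding theta_class_def fibre_class_def by (rule arg_cong)
qed

end

lemma nu_form_potential:
  assumes "integral_affine_manifold B \<A>" and "\<C> = int_affine_charts B \<A>"
    and "c \<in> \<C>" and "fst e \<in> fst c"
    and "v \<in> tangent_space (ref_atlas \<C>) e" and "w \<in> tangent_space (ref_atlas \<C>) e"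
  shows "ext_deriv (ref_atlas \<C>) (nu_form \<C> c) e v w = omega0 \<C> e v w"
  using int_affine_atlas.nu_form_potential_aux[OF int_affine_atlas_charts] assms by blast

lemma theta_class_contraction:
  assumes "integral_affine_manifold B \<A>" and "\<C> = int_affine_charts B \<A>"
    and "c \<in> \<C>" and "x \<in> fst c" and "v \<in> tangent_space \<C> x"
    and "\<And>T. T \<in> ref_fibre \<C> x \<Longrightarrow> X T \<in> tangent_space (ref_atlas \<C>) (x, T) \<and>
      pushforward (ref_atlas \<C>) \<C> fst (x, T) (X T) = v"
  shows "deRham_class (fibre_atlas \<C> x)
      (pullback1 (fibre_atlas \<C> x) (ref_atlas \<C>) (Pair x) (\<lambda>e. omega0 \<C> e (X (snd e)))) =
    theta_class \<C> c (v c) x"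
  using int_affine_atlas.theta_class_contraction_aux[OF int_affine_atlas_charts[OF assms(1)], of c x v X]
    assms by blast

end

theory Submission
  imports Defs
begin

text \<open>
  For a chart \<open>k\<close> with coordinates \<open>a\<^sup>i\<close> let \<open>E\<^sub>k = \<Sum>\<^sub>i a\<^sup>i \<partial>/\<partial>a\<^sup>i\<close> be its radiant vector field.  It is not
  flat, but if \<open>k' = A k + d\<close> then the linear parts cancel in \<open>E\<^sub>k\<^sub>' - E\<^sub>k\<close>, which is the flat field with
  constant coordinates \<open>d\<close> in \<open>k'\<close>.  Both classes are represented by differences of radiant fields.

  On the symplectic side, \<open>\<nu>\<^sub>k = \<Sum>\<^sub>i a\<^sup>i d\<theta>\<^sup>i\<close> restricts to the fibre over \<open>x\<close> as a form with the constant
  coefficients \<open>a\<^sup>i(x)\<close>, and \<open>\<Phi>\<close> replaces \<open>[d\<theta>\<^sup>i]\<close> by \<open>\<partial>/\<partial>a\<^sup>i\<close>.  So \<open>\<Phi>\<close> takes \<open>\<tau>\<^sub>\<beta>\<^sub>\<alpha>\<close> to the difference of the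
  radiant fields of the charts \<open>\<kappa> \<beta>\<close> and \<open>\<kappa> \<alpha>\<close> of the cover (\<open>Phi_tau\<close>).

  On the side of the holonomy, continuation of \<open>c\<close> along \<open>\<sigma> \<alpha> x\<close> ends in a chart \<open>c\<^sub>\<alpha>\<close> around \<open>x\<close> whose germ
  depends on \<open>x\<close> in a locally constant way, by the monodromy theorem.  If \<open>c\<^sub>\<beta> = A c\<^sub>\<alpha> + d\<close> near \<open>x\<close>,
  then one continues \<open>c\<close> along \<open>\<sigma> \<beta> x\<close> to \<open>c\<^sub>\<beta>\<close> and back along \<open>\<sigma> \<alpha> x\<close> to \<open>A c + d\<close>, so that \<open>(A, d)\<close> is
  the holonomy of the loop \<open>\<sigma> \<beta> x * (\<sigma> \<alpha> x)\<^sup>-\<^sup>1\<close> (\<open>affine_holonomy_eq\<close>).  Parallel transport of \<open>d\<close> along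
  \<open>\<sigma> \<beta> x\<close> therefore gives the difference of the radiant fields of \<open>c\<^sub>\<beta>\<close> and \<open>c\<^sub>\<alpha>\<close>
  (\<open>crossed_hom_cochain_value\<close>).  Both \<open>c\<^sub>\<alpha>\<close> and \<open>\<kappa> \<alpha>\<close> are integral affine charts, so the difference of
  their radiant fields is flat over \<open>U \<alpha>\<close> (\<open>radiant_diff_flat\<close>), and its coboundary is the
  difference of the two cocycles.

  It remains to see that \<open>\<Phi>\<close> is an isomorphism.  Both local systems are bundles of groups with
  coordinates in \<open>\<real>\<^sup>n\<close> that transform alike under a change of chart, and such bundles have isomorphic Cech
  cohomology (\<open>flat_transfer_iso\<close>).  For the cohomology of the fibres this needs that the classes \<open>[d\<theta>\<^sup>i]\<close>
  are linearly independent (\<open>theta_form_exact\<close>).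
\<close>

section \<open>Cech cohomology of isomorphic presheaves\<close>

lemma comm_group_product_group:
  assumes "\<And>i. i \<in> I \<Longrightarrow> comm_group (G i)"
  shows "comm_group (product_group I G)"
proof (rule group.group_comm_groupI)
  show "group (product_group I G)" using assms comm_group.axioms(2) by (intro product_group) blast
  fix x y assume "x \<in> carrier (product_group I G)" "y \<in> carrier (product_group I G)"
  then show "x \<otimes>\<^bsub>product_group I G\<^esub> y = y \<otimes>\<^bsub>product_group I G\<^esub> x"
    by (auto simp: fun_eq_iff PiE_iff restrict_def intro!: comm_monoid.m_comm comm_group.axioms(1) assms)
qed

lemma (in comm_group) comm_group_restrict:
  assumes "subgroup H G" shows "comm_group (G\<lparr>carrier := H\<rparr>)"
  using subgroup.subgroup_is_group[OF assms is_group] subgroup.subset[OF assms] m_comm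
  by (intro group.group_comm_groupI) auto

text \<open>
  In additive notation \<open>(c - b) - (c - a) + (b - a) = 0\<close>: a Cech coboundary is a cocycle.
\<close>

lemma (in comm_group) double_difference:
  assumes "a \<in> carrier G" "b \<in> carrier G" "c \<in> carrier G"
  shows "(c \<otimes> inv b) \<otimes> inv (c \<otimes> inv a) \<otimes> (b \<otimes> inv a) = \<one>"
proof -
  have "(c \<otimes> inv b) \<otimes> (b \<otimes> inv a) = c \<otimes> ((inv b \<otimes> b) \<otimes> inv a)"
    using assms by (simp only: m_assoc inv_closed m_closed)
  then have "(c \<otimes> inv b) \<otimes> (b \<otimes> inv a) \<otimes> inv (c \<otimes> inv a) = \<one>" using assms by simp
  moreover have "(c \<otimes> inv b) \<otimes> inv (c \<otimes> inv a) \<otimes> (b \<otimes> inv a) =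
      (c \<otimes> inv b) \<otimes> (b \<otimes> inv a) \<otimes> inv (c \<otimes> inv a)"
    using assms by (simp only: m_ac inv_closed m_closed)
  ultimately show ?thesis by simp
qed

lemma (in comm_group) alternating_product_mult:
  assumes "a \<in> carrier G" "b \<in> carrier G" "c \<in> carrier G" "x \<in> carrier G" "y \<in> carrier G" "z \<in> carrier G"
  shows "(a \<otimes> x) \<otimes> inv (b \<otimes> y) \<otimes> (c \<otimes> z) = (a \<otimes> inv b \<otimes> c) \<otimes> (x \<otimes> inv y \<otimes> z)"
  using assms by (simp add: inv_mult m_ac)

text \<open>
  \<open>Op\<close> selects the sets over which sections are considered.  Restriction is that of functions, so the
  functoriality of a presheaf holds by itself and only compatibility with the group structure is
  required.
\<close>

locale abelian_presheaf =
  fixes Op :: "'b set \<Rightarrow> bool" and \<Gamma> :: "'b set \<Rightarrow> ('b \<Rightarrow> 'g) monoid"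
  assumes Op_Int: "Op V \<Longrightarrow> Op W \<Longrightarrow> Op (V \<inter> W)"
    and comm_group_sections: "Op V \<Longrightarrow> comm_group (\<Gamma> V)"
    and restrict_hom: "Op V \<Longrightarrow> Op W \<Longrightarrow> W \<subseteq> V \<Longrightarrow> (\<lambda>s. restrict s W) \<in> hom (\<Gamma> V) (\<Gamma> W)"

locale cech_cover = abelian_presheaf Op \<Gamma>
  for Op :: "'b set \<Rightarrow> bool" and \<Gamma> :: "'b set \<Rightarrow> ('b \<Rightarrow> 'g) monoid" +
  fixes I :: "'i set" and U :: "'i \<Rightarrow> 'b set"
  assumes Op_cover: "\<alpha> \<in> I \<Longrightarrow> Op (U \<alpha>)"
begin

lemma res_closed: "s \<in> carrier (\<Gamma> V) \<Longrightarrow> Op V \<Longrightarrow> Op W \<Longrightarrow> W \<subseteq> V \<Longrightarrow> restrict s W \<in> carrier (\<Gamma> W)"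
  using hom_in_carrier[OF restrict_hom] .

lemma res_mult: "s \<in> carrier (\<Gamma> V) \<Longrightarrow> t \<in> carrier (\<Gamma> V) \<Longrightarrow> Op V \<Longrightarrow> Op W \<Longrightarrow> W \<subseteq> V \<Longrightarrow>
   restrict (s \<otimes>\<^bsub>\<Gamma> V\<^esub> t) W = restrict s W \<otimes>\<^bsub>\<Gamma> W\<^esub> restrict t W"
  using hom_mult[OF restrict_hom] .

lemma group_sections: "Op V \<Longrightarrow> group (\<Gamma> V)"
  using comm_group_sections comm_group.axioms(2) by blast

lemma res_inv: "s \<in> carrier (\<Gamma> V) \<Longrightarrow> Op V \<Longrightarrow> Op W \<Longrightarrow> W \<subseteq> V \<Longrightarrow>
   restrict (inv\<^bsub>\<Gamma> V\<^esub> s) W = inv\<^bsub>\<Gamma> W\<^esub> (restrict s W)"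
  using group_hom.hom_inv[of "\<Gamma> V" "\<Gamma> W" "\<lambda>s. restrict s W" s] restrict_hom group_sections
  by (simp add: group_hom_def group_hom_axioms_def)

lemma Op_cover2: "\<alpha> \<in> I \<Longrightarrow> \<beta> \<in> I \<Longrightarrow> Op (U \<alpha> \<inter> U \<beta>)"
  and Op_cover3: "\<alpha> \<in> I \<Longrightarrow> \<beta> \<in> I \<Longrightarrow> \<gamma> \<in> I \<Longrightarrow> Op (U \<alpha> \<inter> U \<beta> \<inter> U \<gamma>)"
  using Op_Int Op_cover by blast+

lemma comm_group_C0: "comm_group (cech_C0 \<Gamma> I U)"
  unfolding cech_C0_def by (intro comm_group_product_group comm_group_sections Op_cover)

lemma comm_group_C1: "comm_group (cech_C1 \<Gamma> I U)"
  unfolding cech_C1_def by (rule comm_group_product_group) (auto intro: comm_group_sections Op_cover2)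

lemma C1_iff: "s \<in> carrier (cech_C1 \<Gamma> I U) \<longleftrightarrow>
    s \<in> extensional (I \<times> I) \<and> (\<forall>\<alpha>\<in>I. \<forall>\<beta>\<in>I. s (\<alpha>, \<beta>) \<in> carrier (\<Gamma> (U \<alpha> \<inter> U \<beta>)))"
  by (auto simp: cech_C1_def PiE_iff)

lemma C0_iff: "u \<in> carrier (cech_C0 \<Gamma> I U) \<longleftrightarrow> u \<in> extensional I \<and> (\<forall>\<alpha>\<in>I. u \<alpha> \<in> carrier (\<Gamma> (U \<alpha>)))"
  by (auto simp: cech_C0_def PiE_iff)

lemma C1_mult: "\<alpha> \<in> I \<Longrightarrow> \<beta> \<in> I \<Longrightarrow>
    (s \<otimes>\<^bsub>cech_C1 \<Gamma> I U\<^esub> t) (\<alpha>, \<beta>) = s (\<alpha>, \<beta>) \<otimes>\<^bsub>\<Gamma> (U \<alpha> \<inter> U \<beta>)\<^esub> t (\<alpha>, \<beta>)"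
  by (simp add: cech_C1_def)

text \<open>
  The Cech differential of a 1-cochain on a triple intersection.
\<close>

definition delta1 :: "('i \<times> 'i \<Rightarrow> 'b \<Rightarrow> 'g) \<Rightarrow> 'i \<Rightarrow> 'i \<Rightarrow> 'i \<Rightarrow> 'b \<Rightarrow> 'g" where
  "delta1 s \<alpha> \<beta> \<gamma> = (let V = U \<alpha> \<inter> U \<beta> \<inter> U \<gamma> in
       restrict (s (\<beta>, \<gamma>)) V \<otimes>\<^bsub>\<Gamma> V\<^esub> inv\<^bsub>\<Gamma> V\<^esub> (restrict (s (\<alpha>, \<gamma>)) V)
         \<otimes>\<^bsub>\<Gamma> V\<^esub> restrict (s (\<alpha>, \<beta>)) V)"

lemma Z1_iff: "s \<in> carrier (cech_Z1 \<Gamma> I U) \<longleftrightarrow> s \<in> carrier (cech_C1 \<Gamma> I U) \<and>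
    (\<forall>\<alpha>\<in>I. \<forall>\<beta>\<in>I. \<forall>\<gamma>\<in>I. delta1 s \<alpha> \<beta> \<gamma> = \<one>\<^bsub>\<Gamma> (U \<alpha> \<inter> U \<beta> \<inter> U \<gamma>)\<^esub>)"
  by (simp add: cech_Z1_def delta1_def Let_def)

lemma delta1_hom:
  assumes "\<alpha> \<in> I" "\<beta> \<in> I" "\<gamma> \<in> I"
  shows "(\<lambda>s. delta1 s \<alpha> \<beta> \<gamma>) \<in> hom (cech_C1 \<Gamma> I U) (\<Gamma> (U \<alpha> \<inter> U \<beta> \<inter> U \<gamma>))"
proof (rule homI)
  define V where "V = U \<alpha> \<inter> U \<beta> \<inter> U \<gamma>"
  interpret V: comm_group "\<Gamma> V" unfolding V_def using assms by (intro comm_group_sections Op_cover3)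
  have V: "Op V" "Op (U \<alpha> \<inter> U \<beta>)" "Op (U \<beta> \<inter> U \<gamma>)" "Op (U \<alpha> \<inter> U \<gamma>)" "V \<subseteq> U \<alpha> \<inter> U \<beta>" "V \<subseteq> U \<beta> \<inter> U \<gamma>" "V \<subseteq> U \<alpha> \<inter> U \<gamma>"
    using Op_cover2 Op_cover3 assms by (auto simp: V_def)
  have cl: "restrict (s (\<alpha>, \<beta>)) V \<in> carrier (\<Gamma> V)" "restrict (s (\<beta>, \<gamma>)) V \<in> carrier (\<Gamma> V)" "restrict (s (\<alpha>, \<gamma>)) V \<in> carrier (\<Gamma> V)"
    if "s \<in> carrier (cech_C1 \<Gamma> I U)" for s
    using that assms V res_closed unfolding C1_iff by meson+
  show "delta1 s \<alpha> \<beta> \<gamma> \<in> carrier (\<Gamma> (U \<alpha> \<inter> U \<beta> \<inter> U \<gamma>))" if "s \<in> carrier (cech_C1 \<Gamma> I U)" for s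
    using cl[OF that] unfolding delta1_def V_def[symmetric] Let_def by simp
  show "delta1 (s \<otimes>\<^bsub>cech_C1 \<Gamma> I U\<^esub> t) \<alpha> \<beta> \<gamma> =
      delta1 s \<alpha> \<beta> \<gamma> \<otimes>\<^bsub>\<Gamma> (U \<alpha> \<inter> U \<beta> \<inter> U \<gamma>)\<^esub> delta1 t \<alpha> \<beta> \<gamma>"
    if s: "s \<in> carrier (cech_C1 \<Gamma> I U)" and t: "t \<in> carrier (cech_C1 \<Gamma> I U)" for s t
    using cl[OF s] cl[OF t] s t assms V unfolding delta1_def V_def[symmetric] Let_def
    by (simp add: C1_mult res_mult C1_iff V.alternating_product_mult)
qed

text \<open>
  The cocycles are an intersection of kernels of homomorphisms, one for each triple of members of
  the cover.  The whole group is added to the family because there may be no triple at all.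
\<close>

lemma subgroup_Z1: "subgroup (carrier (cech_Z1 \<Gamma> I U)) (cech_C1 \<Gamma> I U)"
proof -
  interpret C1: comm_group "cech_C1 \<Gamma> I U" by (rule comm_group_C1)
  have k: "subgroup (kernel (cech_C1 \<Gamma> I U) (\<Gamma> (U \<alpha> \<inter> U \<beta> \<inter> U \<gamma>)) (\<lambda>s. delta1 s \<alpha> \<beta> \<gamma>)) (cech_C1 \<Gamma> I U)"
    if "\<alpha> \<in> I" "\<beta> \<in> I" "\<gamma> \<in> I" for \<alpha> \<beta> \<gamma>
    using delta1_hom[OF that] group_sections Op_cover3[OF that] C1.is_group
    by (intro group_hom.subgroup_kernel) (auto simp: group_hom_def group_hom_axioms_def)
  have eq: "carrier (cech_Z1 \<Gamma> I U) = \<Inter> (insert (carrier (cech_C1 \<Gamma> I U))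
     ((\<lambda>(\<alpha>, \<beta>, \<gamma>). kernel (cech_C1 \<Gamma> I U) (\<Gamma> (U \<alpha> \<inter> U \<beta> \<inter> U \<gamma>)) (\<lambda>s. delta1 s \<alpha> \<beta> \<gamma>)) ` (I \<times> I \<times> I)))"
    (is "_ = ?J")
  proof (intro equalityI subsetI)
    fix s assume "s \<in> carrier (cech_Z1 \<Gamma> I U)"
    then show "s \<in> ?J" unfolding Z1_iff kernel_def by auto
  next
    fix s assume s: "s \<in> ?J"
    have "delta1 s \<alpha> \<beta> \<gamma> = \<one>\<^bsub>\<Gamma> (U \<alpha> \<inter> U \<beta> \<inter> U \<gamma>)\<^esub>" if "\<alpha> \<in> I" "\<beta> \<in> I" "\<gamma> \<in> I" for \<alpha> \<beta> \<gamma>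
    proof -
      have "(\<alpha>, \<beta>, \<gamma>) \<in> I \<times> I \<times> I" using that by blast
      from InterD[OF s insertI2[OF imageI[OF this]]] show ?thesis by (simp add: kernel_def)
    qed
    moreover have "s \<in> carrier (cech_C1 \<Gamma> I U)" using InterD[OF s insertI1] .
    ultimately show "s \<in> carrier (cech_Z1 \<Gamma> I U)" unfolding Z1_iff by blast
  qed
  show ?thesis
    unfolding eq by (rule C1.subgroups_Inter) (use k C1.subgroup_self in auto)
qed

lemma Z1_eq: "cech_Z1 \<Gamma> I U = (cech_C1 \<Gamma> I U)\<lparr>carrier := carrier (cech_Z1 \<Gamma> I U)\<rparr>"
  by (simp add: cech_Z1_def)

lemma comm_group_Z1: "comm_group (cech_Z1 \<Gamma> I U)"
  using comm_group.comm_group_restrict[OF comm_group_C1 subgroup_Z1] Z1_eq by simp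

lemma Z1_mult: "(\<otimes>\<^bsub>cech_Z1 \<Gamma> I U\<^esub>) = (\<otimes>\<^bsub>cech_C1 \<Gamma> I U\<^esub>)"
  by (simp add: cech_Z1_def)

lemma delta0_hom: "cech_delta0 \<Gamma> I U \<in> hom (cech_C0 \<Gamma> I U) (cech_Z1 \<Gamma> I U)"
proof (rule homI)
  have cl: "restrict (u \<alpha>) V \<in> carrier (\<Gamma> V)" if "u \<in> carrier (cech_C0 \<Gamma> I U)" "\<alpha> \<in> I" "Op V" "V \<subseteq> U \<alpha>" for u \<alpha> V
    using that Op_cover res_closed unfolding C0_iff by blast
  have d: "cech_delta0 \<Gamma> I U u (\<alpha>, \<beta>) =
      restrict (u \<beta>) (U \<alpha> \<inter> U \<beta>) \<otimes>\<^bsub>\<Gamma> (U \<alpha> \<inter> U \<beta>)\<^esub> inv\<^bsub>\<Gamma> (U \<alpha> \<inter> U \<beta>)\<^esub> (restrict (u \<alpha>) (U \<alpha> \<inter> U \<beta>))"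
    if "\<alpha> \<in> I" "\<beta> \<in> I" for u \<alpha> \<beta>
    using that by (simp add: cech_delta0_def Let_def)
  have c1: "cech_delta0 \<Gamma> I U u \<in> carrier (cech_C1 \<Gamma> I U)" if u: "u \<in> carrier (cech_C0 \<Gamma> I U)" for u
    unfolding C1_iff
  proof (intro conjI ballI)
    fix \<alpha> \<beta> assume a: "\<alpha> \<in> I" "\<beta> \<in> I"
    interpret G: comm_group "\<Gamma> (U \<alpha> \<inter> U \<beta>)" using a by (intro comm_group_sections Op_cover2)
    show "cech_delta0 \<Gamma> I U u (\<alpha>, \<beta>) \<in> carrier (\<Gamma> (U \<alpha> \<inter> U \<beta>))"
      unfolding d[OF a] using cl[OF u a(1) Op_cover2[OF a]] cl[OF u a(2) Op_cover2[OF a]] by simp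
  qed (simp add: cech_delta0_def)
  show "cech_delta0 \<Gamma> I U u \<in> carrier (cech_Z1 \<Gamma> I U)" if u: "u \<in> carrier (cech_C0 \<Gamma> I U)" for u
    unfolding Z1_iff
  proof (intro conjI ballI c1[OF u])
    fix \<alpha> \<beta> \<gamma> assume a: "\<alpha> \<in> I" "\<beta> \<in> I" "\<gamma> \<in> I"
    define V where "V = U \<alpha> \<inter> U \<beta> \<inter> U \<gamma>"
    have V: "Op V" "V \<subseteq> U \<alpha>" "V \<subseteq> U \<beta>" "V \<subseteq> U \<gamma>" using Op_cover3[OF a] by (auto simp: V_def)
    interpret V: comm_group "\<Gamma> V" using V by (intro comm_group_sections)
    have r: "restrict (cech_delta0 \<Gamma> I U u (\<mu>, \<nu>)) V = restrict (u \<nu>) V \<otimes>\<^bsub>\<Gamma> V\<^esub> inv\<^bsub>\<Gamma> V\<^esub> (restrict (u \<mu>) V)"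
      if "\<mu> \<in> I" "\<nu> \<in> I" "V \<subseteq> U \<mu> \<inter> U \<nu>" for \<mu> \<nu>
    proof -
      interpret G: comm_group "\<Gamma> (U \<mu> \<inter> U \<nu>)" using that by (intro comm_group_sections Op_cover2)
      have W: "Op (U \<mu> \<inter> U \<nu>)" using Op_cover2 that by blast
      have c: "restrict (u \<mu>) (U \<mu> \<inter> U \<nu>) \<in> carrier (\<Gamma> (U \<mu> \<inter> U \<nu>))" "restrict (u \<nu>) (U \<mu> \<inter> U \<nu>) \<in> carrier (\<Gamma> (U \<mu> \<inter> U \<nu>))"
        using cl[OF u that(1) W] cl[OF u that(2) W] by auto
      show ?thesis unfolding d[OF that(1,2)]
        using c that(3) W V(1) by (simp add: res_mult res_inv restrict_restrict Int_absorb1)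
    qed
    show "delta1 (cech_delta0 \<Gamma> I U u) \<alpha> \<beta> \<gamma> = \<one>\<^bsub>\<Gamma> (U \<alpha> \<inter> U \<beta> \<inter> U \<gamma>)\<^esub>"
      unfolding delta1_def V_def[symmetric] Let_def using a V
      by (simp add: r cl[OF u] V.double_difference)
  qed
  show "cech_delta0 \<Gamma> I U (u \<otimes>\<^bsub>cech_C0 \<Gamma> I U\<^esub> v) =
      cech_delta0 \<Gamma> I U u \<otimes>\<^bsub>cech_Z1 \<Gamma> I U\<^esub> cech_delta0 \<Gamma> I U v"
    if u: "u \<in> carrier (cech_C0 \<Gamma> I U)" and v: "v \<in> carrier (cech_C0 \<Gamma> I U)" for u v
  proof (rule extensionalityI[of _ "I \<times> I"])
    show "cech_delta0 \<Gamma> I U u \<otimes>\<^bsub>cech_Z1 \<Gamma> I U\<^esub> cech_delta0 \<Gamma> I U v \<in> extensional (I \<times> I)"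
      by (simp add: Z1_mult cech_C1_def)
    fix p assume "p \<in> I \<times> I"
    then obtain \<alpha> \<beta> where p: "p = (\<alpha>, \<beta>)" and a: "\<alpha> \<in> I" "\<beta> \<in> I" by blast
    interpret G: comm_group "\<Gamma> (U \<alpha> \<inter> U \<beta>)" using a by (intro comm_group_sections Op_cover2)
    have W: "Op (U \<alpha> \<inter> U \<beta>)" using Op_cover2 a by blast
    have c: "restrict (w \<nu>) (U \<alpha> \<inter> U \<beta>) \<in> carrier (\<Gamma> (U \<alpha> \<inter> U \<beta>))" if "w \<in> carrier (cech_C0 \<Gamma> I U)" "\<nu> = \<alpha> \<or> \<nu> = \<beta>" for w \<nu>
      using cl[OF that(1) _ W] a that(2) by auto
    have m: "restrict ((u \<otimes>\<^bsub>cech_C0 \<Gamma> I U\<^esub> v) \<nu>) (U \<alpha> \<inter> U \<beta>) =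
      restrict (u \<nu>) (U \<alpha> \<inter> U \<beta>) \<otimes>\<^bsub>\<Gamma> (U \<alpha> \<inter> U \<beta>)\<^esub> restrict (v \<nu>) (U \<alpha> \<inter> U \<beta>)" if "\<nu> = \<alpha> \<or> \<nu> = \<beta>" for \<nu>
      using u v a that W Op_cover by (auto simp: cech_C0_def PiE_iff intro!: res_mult)
    show "cech_delta0 \<Gamma> I U (u \<otimes>\<^bsub>cech_C0 \<Gamma> I U\<^esub> v) p = (cech_delta0 \<Gamma> I U u \<otimes>\<^bsub>cech_Z1 \<Gamma> I U\<^esub> cech_delta0 \<Gamma> I U v) p"
      unfolding p Z1_mult C1_mult[OF a] d[OF a] using c[OF u] c[OF v]
      by (simp add: m G.inv_mult G.m_ac)
  qed (simp add: cech_delta0_def)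
qed

lemma subgroup_B1: "subgroup (cech_B1 \<Gamma> I U) (cech_Z1 \<Gamma> I U)"
  unfolding cech_B1_def using delta0_hom comm_group_C0 comm_group_Z1
  by (intro group_hom.img_is_subgroup) (auto simp: group_hom_def group_hom_axioms_def comm_group_def)

lemma normal_B1: "cech_B1 \<Gamma> I U \<lhd> cech_Z1 \<Gamma> I U"
  using comm_group.subgroup_imp_normal[OF comm_group_Z1 subgroup_B1] .

lemma group_H1: "group (cech_H1 \<Gamma> I U)"
  unfolding cech_H1_def by (rule normal.factorgroup_is_group[OF normal_B1])

lemma cech_class_hom: "cech_class \<Gamma> I U \<in> hom (cech_Z1 \<Gamma> I U) (cech_H1 \<Gamma> I U)"
  unfolding cech_H1_def cech_class_def using normal.r_coset_hom_Mod[OF normal_B1] .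

lemma carrier_H1: "carrier (cech_H1 \<Gamma> I U) = cech_class \<Gamma> I U ` carrier (cech_Z1 \<Gamma> I U)"
  unfolding cech_H1_def cech_class_def carrier_FactGroup ..

lemma cech_class_eq_one_iff:
  assumes "s \<in> carrier (cech_Z1 \<Gamma> I U)"
  shows "cech_class \<Gamma> I U s = \<one>\<^bsub>cech_H1 \<Gamma> I U\<^esub> \<longleftrightarrow> s \<in> cech_B1 \<Gamma> I U"
proof -
  interpret Z: comm_group "cech_Z1 \<Gamma> I U" by (rule comm_group_Z1)
  show ?thesis using Z.coset_join1[OF _ assms subgroup_B1] Z.coset_join2[OF assms subgroup_B1]
    unfolding cech_H1_def cech_class_def by (auto simp: FactGroup_def)
qed

lemma cech_class_coboundary:
  assumes s: "s \<in> carrier (cech_Z1 \<Gamma> I U)" and u: "u \<in> carrier (cech_C0 \<Gamma> I U)"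
  shows "cech_class \<Gamma> I U (cech_delta0 \<Gamma> I U u \<otimes>\<^bsub>cech_Z1 \<Gamma> I U\<^esub> s) = cech_class \<Gamma> I U s"
proof -
  interpret Z: comm_group "cech_Z1 \<Gamma> I U" by (rule comm_group_Z1)
  have b: "cech_delta0 \<Gamma> I U u \<in> cech_B1 \<Gamma> I U" using u by (simp add: cech_B1_def)
  then have "cech_delta0 \<Gamma> I U u \<in> carrier (cech_Z1 \<Gamma> I U)" using subgroup.subset[OF subgroup_B1] by blast
  then show ?thesis
    using Z.coset_mult_assoc[OF subgroup.subset[OF subgroup_B1] _ s] Z.coset_join2[OF _ subgroup_B1 b]
    unfolding cech_class_def by metis
qed

end

text \<open>
  By the assumptions on \<open>h\<close>, the homomorphism \<open>s \<mapsto> [h s]\<close> is onto and its kernel is the group of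
  coboundaries, so this is the first isomorphism theorem.
\<close>

lemma cech_H1_induced_iso:
  assumes "cech_cover Op \<Gamma> I U" "cech_cover Op \<Gamma>' I U"
    and h: "h \<in> hom (cech_Z1 \<Gamma> I U) (cech_Z1 \<Gamma>' I U)"
    and surj: "h ` carrier (cech_Z1 \<Gamma> I U) = carrier (cech_Z1 \<Gamma>' I U)"
    and B1: "\<And>s. s \<in> carrier (cech_Z1 \<Gamma> I U) \<Longrightarrow> h s \<in> cech_B1 \<Gamma>' I U \<longleftrightarrow> s \<in> cech_B1 \<Gamma> I U"
  shows "(\<lambda>K. the_elem ((\<lambda>s. cech_class \<Gamma>' I U (h s)) ` K)) \<in> iso (cech_H1 \<Gamma> I U) (cech_H1 \<Gamma>' I U)"
    and "s \<in> carrier (cech_Z1 \<Gamma> I U) \<Longrightarrow>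
      the_elem ((\<lambda>s. cech_class \<Gamma>' I U (h s)) ` cech_class \<Gamma> I U s) = cech_class \<Gamma>' I U (h s)"
proof -
  interpret S: cech_cover Op \<Gamma> I U by fact
  interpret T: cech_cover Op \<Gamma>' I U by fact
  interpret Z: comm_group "cech_Z1 \<Gamma> I U" by (rule S.comm_group_Z1)
  interpret h: group_hom "cech_Z1 \<Gamma> I U" "cech_H1 \<Gamma>' I U" "\<lambda>s. cech_class \<Gamma>' I U (h s)"
    using hom_compose[OF h T.cech_class_hom] T.group_H1
    by (auto simp: o_def group_hom_def group_hom_axioms_def intro: Z.is_group)
  have hc: "h s \<in> carrier (cech_Z1 \<Gamma>' I U)" if "s \<in> carrier (cech_Z1 \<Gamma> I U)" for s
    using hom_in_carrier[OF h that] .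
  have k: "kernel (cech_Z1 \<Gamma> I U) (cech_H1 \<Gamma>' I U) (\<lambda>s. cech_class \<Gamma>' I U (h s)) = cech_B1 \<Gamma> I U"
    unfolding kernel_def using B1 T.cech_class_eq_one_iff hc subgroup.subset[OF S.subgroup_B1] by blast
  have "(\<lambda>s. cech_class \<Gamma>' I U (h s)) ` carrier (cech_Z1 \<Gamma> I U) = carrier (cech_H1 \<Gamma>' I U)"
    unfolding T.carrier_H1 surj[symmetric] image_image ..
  from h.FactGroup_iso_set[OF this]
  show "(\<lambda>K. the_elem ((\<lambda>s. cech_class \<Gamma>' I U (h s)) ` K)) \<in> iso (cech_H1 \<Gamma> I U) (cech_H1 \<Gamma>' I U)"
    unfolding k cech_H1_def[of \<Gamma>] .
  assume s: "s \<in> carrier (cech_Z1 \<Gamma> I U)"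
  have "cech_class \<Gamma>' I U (h t) = cech_class \<Gamma>' I U (h s)" if t: "t \<in> cech_class \<Gamma> I U s" for t
  proof -
    obtain b where b: "b \<in> cech_B1 \<Gamma> I U" "t = b \<otimes>\<^bsub>cech_Z1 \<Gamma> I U\<^esub> s"
      using t by (auto simp: cech_class_def r_coset_def)
    then have "b \<in> carrier (cech_Z1 \<Gamma> I U)" "cech_class \<Gamma>' I U (h b) = \<one>\<^bsub>cech_H1 \<Gamma>' I U\<^esub>"
      unfolding k[symmetric] kernel_def by auto
    then show ?thesis using s b(2) by (simp add: h.hom_mult)
  qed
  moreover have "s \<in> cech_class \<Gamma> I U s"
    unfolding cech_class_def using Z.rcos_self[OF s S.subgroup_B1] .
  ultimately show "the_elem ((\<lambda>s. cech_class \<Gamma>' I U (h s)) ` cech_class \<Gamma> I U s) = cech_class \<Gamma>' I U (h s)"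
    by (intro the_elem_image_unique) blast+
qed

text \<open>
  A map of presheaves is a family of homomorphisms that commutes with restriction.
\<close>

locale presheaf_map = S: cech_cover Op \<Gamma> I U + T: cech_cover Op \<Gamma>' I U
  for Op :: "'b set \<Rightarrow> bool" and \<Gamma> :: "'b set \<Rightarrow> ('b \<Rightarrow> 'g) monoid"
    and \<Gamma>' :: "'b set \<Rightarrow> ('b \<Rightarrow> 'h) monoid" and I :: "'i set" and U :: "'i \<Rightarrow> 'b set" +
  fixes \<Theta> :: "'b set \<Rightarrow> ('b \<Rightarrow> 'g) \<Rightarrow> 'b \<Rightarrow> 'h"
  assumes map_hom: "Op V \<Longrightarrow> \<Theta> V \<in> hom (\<Gamma> V) (\<Gamma>' V)"
    and map_restrict: "Op V \<Longrightarrow> Op W \<Longrightarrow> W \<subseteq> V \<Longrightarrow> s \<in> carrier (\<Gamma> V) \<Longrightarrow>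
      restrict (\<Theta> V s) W = \<Theta> W (restrict s W)"
begin

definition cochain_map :: "('i \<times> 'i \<Rightarrow> 'b \<Rightarrow> 'g) \<Rightarrow> 'i \<times> 'i \<Rightarrow> 'b \<Rightarrow> 'h" where
  "cochain_map s = (\<lambda>(\<alpha>, \<beta>)\<in>I \<times> I. \<Theta> (U \<alpha> \<inter> U \<beta>) (s (\<alpha>, \<beta>)))"

lemma map_group_hom: "Op V \<Longrightarrow> group_hom (\<Gamma> V) (\<Gamma>' V) (\<Theta> V)"
  using map_hom S.group_sections T.group_sections by (simp add: group_hom_def group_hom_axioms_def)

lemma cochain_map_C1:
  assumes "s \<in> carrier (cech_C1 \<Gamma> I U)" shows "cochain_map s \<in> carrier (cech_C1 \<Gamma>' I U)"
  using assms hom_in_carrier[OF map_hom[OF S.Op_cover2]] unfolding S.C1_iff T.C1_iff cochain_map_def by auto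

lemma cochain_map_hom: "cochain_map \<in> hom (cech_Z1 \<Gamma> I U) (cech_Z1 \<Gamma>' I U)"
proof (rule homI)
  fix s assume "s \<in> carrier (cech_Z1 \<Gamma> I U)"
  then have s: "s \<in> carrier (cech_C1 \<Gamma> I U)" and t: "\<And>\<alpha> \<beta> \<gamma>. \<alpha> \<in> I \<Longrightarrow> \<beta> \<in> I \<Longrightarrow> \<gamma> \<in> I \<Longrightarrow>
      S.delta1 s \<alpha> \<beta> \<gamma> = \<one>\<^bsub>\<Gamma> (U \<alpha> \<inter> U \<beta> \<inter> U \<gamma>)\<^esub>"
    unfolding S.Z1_iff by blast+
  show "cochain_map s \<in> carrier (cech_Z1 \<Gamma>' I U)"
    unfolding T.Z1_iff
  proof (intro conjI ballI cochain_map_C1[OF s])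
    fix \<alpha> \<beta> \<gamma> assume a: "\<alpha> \<in> I" "\<beta> \<in> I" "\<gamma> \<in> I"
    define V where "V = U \<alpha> \<inter> U \<beta> \<inter> U \<gamma>"
    have V: "Op V" using S.Op_cover3[OF a] by (simp add: V_def)
    have sub: "V \<subseteq> U \<beta> \<inter> U \<gamma>" "V \<subseteq> U \<alpha> \<inter> U \<gamma>" "V \<subseteq> U \<alpha> \<inter> U \<beta>" by (auto simp: V_def)
    interpret \<theta>: group_hom "\<Gamma> V" "\<Gamma>' V" "\<Theta> V" by (rule map_group_hom[OF V])
    have r: "restrict (cochain_map s (\<mu>, \<nu>)) V = \<Theta> V (restrict (s (\<mu>, \<nu>)) V) \<and> restrict (s (\<mu>, \<nu>)) V \<in> carrier (\<Gamma> V)"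
      if "\<mu> \<in> I" "\<nu> \<in> I" "V \<subseteq> U \<mu> \<inter> U \<nu>" for \<mu> \<nu>
    proof -
      have c: "s (\<mu>, \<nu>) \<in> carrier (\<Gamma> (U \<mu> \<inter> U \<nu>))" using s that unfolding S.C1_iff by blast
      have W: "Op (U \<mu> \<inter> U \<nu>)" using S.Op_cover2 that by blast
      show ?thesis using map_restrict[OF W V that(3) c] S.res_closed[OF c W V that(3)] that(1,2)
        by (simp add: cochain_map_def)
    qed
    have "T.delta1 (cochain_map s) \<alpha> \<beta> \<gamma> = \<Theta> V (S.delta1 s \<alpha> \<beta> \<gamma>)"
      unfolding T.delta1_def S.delta1_def V_def[symmetric] Let_def
      using r[OF a(2,3)] r[OF a(1,3)] r[OF a(1,2)] sub by simp
    then show "T.delta1 (cochain_map s) \<alpha> \<beta> \<gamma> = \<one>\<^bsub>\<Gamma>' (U \<alpha> \<inter> U \<beta> \<inter> U \<gamma>)\<^esub>"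
      using t[OF a] by (simp add: V_def[symmetric])
  qed
next
  fix s t assume "s \<in> carrier (cech_Z1 \<Gamma> I U)" "t \<in> carrier (cech_Z1 \<Gamma> I U)"
  then have st: "s (\<alpha>, \<beta>) \<in> carrier (\<Gamma> (U \<alpha> \<inter> U \<beta>))" "t (\<alpha>, \<beta>) \<in> carrier (\<Gamma> (U \<alpha> \<inter> U \<beta>))"
    if "\<alpha> \<in> I" "\<beta> \<in> I" for \<alpha> \<beta>
    using that unfolding S.Z1_iff S.C1_iff by blast+
  show "cochain_map (s \<otimes>\<^bsub>cech_Z1 \<Gamma> I U\<^esub> t) = cochain_map s \<otimes>\<^bsub>cech_Z1 \<Gamma>' I U\<^esub> cochain_map t"
  proof (rule extensionalityI[of _ "I \<times> I"])
    fix p assume "p \<in> I \<times> I"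
    then obtain \<alpha> \<beta> where p: "p = (\<alpha>, \<beta>)" and a: "\<alpha> \<in> I" "\<beta> \<in> I" by blast
    show "cochain_map (s \<otimes>\<^bsub>cech_Z1 \<Gamma> I U\<^esub> t) p = (cochain_map s \<otimes>\<^bsub>cech_Z1 \<Gamma>' I U\<^esub> cochain_map t) p"
      unfolding p S.Z1_mult T.Z1_mult T.C1_mult[OF a] using a S.C1_mult[OF a]
        hom_mult[OF map_hom[OF S.Op_cover2[OF a]] st[OF a]]
      by (simp add: cochain_map_def)
  qed (simp_all add: cochain_map_def T.Z1_mult cech_C1_def)
qed

lemma cochain_map_coboundary:
  assumes "s \<in> cech_B1 \<Gamma> I U" shows "cochain_map s \<in> cech_B1 \<Gamma>' I U"
proof -
  obtain u where u: "u \<in> carrier (cech_C0 \<Gamma> I U)" and s: "s = cech_delta0 \<Gamma> I U u"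
    using assms by (auto simp: cech_B1_def)
  define w where "w = (\<lambda>\<alpha>\<in>I. \<Theta> (U \<alpha>) (u \<alpha>))"
  have w: "w \<in> carrier (cech_C0 \<Gamma>' I U)"
    using u hom_in_carrier[OF map_hom[OF S.Op_cover]] unfolding S.C0_iff T.C0_iff w_def by auto
  have "cochain_map s (\<alpha>, \<beta>) = cech_delta0 \<Gamma>' I U w (\<alpha>, \<beta>)" if a: "\<alpha> \<in> I" "\<beta> \<in> I" for \<alpha> \<beta>
  proof -
    define V where "V = U \<alpha> \<inter> U \<beta>"
    have V: "Op V" using S.Op_cover2[OF a] by (simp add: V_def)
    interpret \<theta>: group_hom "\<Gamma> V" "\<Gamma>' V" "\<Theta> V" by (rule map_group_hom[OF V])
    have "restrict (u \<nu>) V \<in> carrier (\<Gamma> V) \<and> restrict (w \<nu>) V = \<Theta> V (restrict (u \<nu>) V)" if "\<nu> \<in> I" "V \<subseteq> U \<nu>" for \<nu>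
    proof -
      have c: "u \<nu> \<in> carrier (\<Gamma> (U \<nu>))" using u that unfolding S.C0_iff by blast
      show ?thesis
        using map_restrict[OF S.Op_cover[OF that(1)] V that(2) c] S.res_closed[OF c S.Op_cover[OF that(1)] V that(2)] that(1)
        by (simp add: w_def)
    qed
    note c = this
    have sub: "V \<subseteq> U \<alpha>" "V \<subseteq> U \<beta>" by (auto simp: V_def)
    show ?thesis
      using a c[OF a(1) sub(1)] c[OF a(2) sub(2)] by (simp add: s cochain_map_def cech_delta0_def Let_def V_def[symmetric])
  qed
  then have "cochain_map s = cech_delta0 \<Gamma>' I U w"
    by (auto simp: fun_eq_iff cochain_map_def cech_delta0_def)
  then show ?thesis using w unfolding cech_B1_def by blast
qed

end

text \<open>
  A map of presheaves takes cocycles to cocycles and coboundaries to coboundaries.  If it has an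
  inverse, the same holds for the inverse, so the cocycles and the coboundaries correspond.
\<close>

lemma presheaf_iso_cech_H1:
  assumes "presheaf_map Op \<Gamma> \<Gamma>' I U \<Theta>" "presheaf_map Op \<Gamma>' \<Gamma> I U \<Theta>'"
    and inv: "\<And>V s. Op V \<Longrightarrow> s \<in> carrier (\<Gamma> V) \<Longrightarrow> \<Theta>' V (\<Theta> V s) = s"
      "\<And>V s. Op V \<Longrightarrow> s \<in> carrier (\<Gamma>' V) \<Longrightarrow> \<Theta> V (\<Theta>' V s) = s"
  shows "(\<lambda>K. the_elem ((\<lambda>s. cech_class \<Gamma>' I U (presheaf_map.cochain_map I U \<Theta> s)) ` K))
      \<in> iso (cech_H1 \<Gamma> I U) (cech_H1 \<Gamma>' I U)" (is ?iso)
    and "s \<in> carrier (cech_Z1 \<Gamma> I U) \<Longrightarrow>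
      the_elem ((\<lambda>s. cech_class \<Gamma>' I U (presheaf_map.cochain_map I U \<Theta> s)) ` cech_class \<Gamma> I U s) =
      cech_class \<Gamma>' I U (presheaf_map.cochain_map I U \<Theta> s)" (is "_ \<Longrightarrow> ?val s")
proof -
  interpret F: presheaf_map Op \<Gamma> \<Gamma>' I U \<Theta> by fact
  interpret G: presheaf_map Op \<Gamma>' \<Gamma> I U \<Theta>' by fact
  have inv1: "G.cochain_map (F.cochain_map s) = s" if "s \<in> carrier (cech_Z1 \<Gamma> I U)" for s
  proof (rule extensionalityI[of _ "I \<times> I"])
    show "s \<in> extensional (I \<times> I)" using that unfolding F.S.Z1_iff F.S.C1_iff by blast
    fix p assume "p \<in> I \<times> I"
    then obtain \<alpha> \<beta> where p: "p = (\<alpha>, \<beta>)" and a: "\<alpha> \<in> I" "\<beta> \<in> I" by blast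
    have "s p \<in> carrier (\<Gamma> (U \<alpha> \<inter> U \<beta>))" using that a unfolding p F.S.Z1_iff F.S.C1_iff by blast
    from inv(1)[OF F.S.Op_cover2[OF a] this] show "G.cochain_map (F.cochain_map s) p = s p"
      using a by (simp add: p F.cochain_map_def G.cochain_map_def)
  qed (simp add: G.cochain_map_def)
  have inv2: "F.cochain_map (G.cochain_map s) = s" if "s \<in> carrier (cech_Z1 \<Gamma>' I U)" for s
  proof (rule extensionalityI[of _ "I \<times> I"])
    show "s \<in> extensional (I \<times> I)" using that unfolding F.T.Z1_iff F.T.C1_iff by blast
    fix p assume "p \<in> I \<times> I"
    then obtain \<alpha> \<beta> where p: "p = (\<alpha>, \<beta>)" and a: "\<alpha> \<in> I" "\<beta> \<in> I" by blast
    have "s p \<in> carrier (\<Gamma>' (U \<alpha> \<inter> U \<beta>))" using that a unfolding p F.T.Z1_iff F.T.C1_iff by blast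
    from inv(2)[OF F.S.Op_cover2[OF a] this] show "F.cochain_map (G.cochain_map s) p = s p"
      using a by (simp add: p F.cochain_map_def G.cochain_map_def)
  qed (simp add: F.cochain_map_def)
  have surj: "F.cochain_map ` carrier (cech_Z1 \<Gamma> I U) = carrier (cech_Z1 \<Gamma>' I U)"
  proof (intro equalityI subsetI)
    fix s assume s: "s \<in> carrier (cech_Z1 \<Gamma>' I U)"
    then show "s \<in> F.cochain_map ` carrier (cech_Z1 \<Gamma> I U)"
      using hom_in_carrier[OF G.cochain_map_hom s] inv2[OF s] by (metis imageI)
  qed (use hom_in_carrier[OF F.cochain_map_hom] in blast)
  have B1: "F.cochain_map s \<in> cech_B1 \<Gamma>' I U \<longleftrightarrow> s \<in> cech_B1 \<Gamma> I U" if "s \<in> carrier (cech_Z1 \<Gamma> I U)" for s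
    using F.cochain_map_coboundary[of s] G.cochain_map_coboundary[of "F.cochain_map s"] inv1[OF that] by auto
  note * = cech_H1_induced_iso[OF F.S.cech_cover_axioms F.T.cech_cover_axioms F.cochain_map_hom surj B1]
  show ?iso by (rule *(1))
  show "s \<in> carrier (cech_Z1 \<Gamma> I U) \<Longrightarrow> ?val s" by (rule *(2))
qed

section \<open>Flat sections of bundles of groups with constant coordinates\<close>

locale integral_affine_mfd =
  fixes B :: "'b::topological_space set" and \<A> \<C> :: "('b, real^'n) chart set"
  assumes manifold: "integral_affine_manifold B \<A>" and charts: "\<C> = int_affine_charts B \<A>"

sublocale integral_affine_mfd \<subseteq> int_affine_atlas \<C>
  using int_affine_atlas_charts[OF manifold] charts by simp

context integral_affine_mfd
begin

abbreviation openB :: "'b set \<Rightarrow> bool" where "openB \<equiv> openin (top_of_set B)"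

lemma top_chart: "c \<in> \<C> \<Longrightarrow> top_chart B c"
  using charts by (simp add: int_affine_charts_def)

lemma openB_chart: "c \<in> \<C> \<Longrightarrow> openB (fst c)"
  using top_chart top_chart_def by blast

lemma chart_homeomorphism: "c \<in> \<C> \<Longrightarrow> homeomorphism (fst c) (snd c ` fst c) (snd c) (chart_inv c)"
proof -
  assume c: "c \<in> \<C>"
  obtain \<psi> where h: "homeomorphism (fst c) (snd c ` fst c) (snd c) \<psi>"
    using top_chart[OF c] by (auto simp: top_chart_def)
  have "\<psi> y = chart_inv c y" if y: "y \<in> snd c ` fst c" for y
  proof -
    obtain x where "x \<in> fst c" "y = snd c x" using y by blast
    then show ?thesis using homeomorphism_apply1[OF h] c by simp
  qed
  then show ?thesis by (intro homeomorphism_cong[OF h]) auto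
qed

lemma atlas_charts: "\<A> \<subseteq> \<C>"
  using manifold charts by (auto simp: integral_affine_manifold_def int_affine_charts_def)

lemma chart_around: "x \<in> B \<Longrightarrow> \<exists>c\<in>\<C>. x \<in> fst c"
  using manifold atlas_charts unfolding integral_affine_manifold_def by blast

lemma chart_dom_B: "c \<in> \<C> \<Longrightarrow> fst c \<subseteq> B"
  using openB_chart openin_imp_subset by blast

text \<open>
  A small ball in the coordinates is an open and path connected neighbourhood in \<open>B\<close>.
\<close>

lemma chart_nbhd:
  assumes c: "c \<in> \<C>" and M: "open M" "snd c x \<in> M" "M \<subseteq> snd c ` fst c" and x: "x \<in> fst c"
  obtains N where "openB N" "x \<in> N" "N \<subseteq> fst c" "path_connected N" "snd c ` N \<subseteq> M"
proof -
  obtain r where r: "r > 0" "ball (snd c x) r \<subseteq> M" using M(1,2) open_contains_ball by blast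
  note h = chart_homeomorphism[OF c]
  define N where "N = chart_inv c ` ball (snd c x) r"
  have sub: "ball (snd c x) r \<subseteq> snd c ` fst c" using r(2) M(3) by blast
  have img: "snd c ` N = ball (snd c x) r"
    unfolding N_def image_image using homeomorphism_apply2[OF h] sub by (force simp: image_iff)
  have NF: "N \<subseteq> fst c" unfolding N_def using sub homeomorphism_image2[OF h] by blast
  have N_eq: "N = fst c \<inter> snd c -` ball (snd c x) r"
  proof (intro equalityI subsetI)
    fix y assume "y \<in> fst c \<inter> snd c -` ball (snd c x) r"
    then show "y \<in> N" unfolding N_def using c by (metis Int_iff image_eqI inv_chart vimageD)
  qed (use img NF in auto)
  have "openin (top_of_set (fst c)) N"
    unfolding N_eq using homeomorphism_cont1[OF h] by (intro continuous_openin_preimage_gen) auto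
  then have "openB N" using openin_trans openB_chart[OF c] by blast
  moreover have "path_connected N" unfolding N_def
    by (intro path_connected_continuous_image continuous_on_subset[OF homeomorphism_cont2[OF h] sub])
      (simp add: convex_imp_path_connected)
  moreover have "x \<in> N" using x r(1) by (simp add: N_eq)
  ultimately show ?thesis using that[of N] NF img r(2) by simp
qed

lemma chart_change:
  assumes "c \<in> \<C>" "c' \<in> \<C>" "x \<in> fst c" "x \<in> fst c'"
  obtains A A' d N where "A \<in> GL_int" "A ** A' = mat 1"
    "openB N" "x \<in> N" "N \<subseteq> fst c \<inter> fst c'"
    "\<And>y. y \<in> N \<Longrightarrow> snd c' y = A *v snd c y + d"
    "\<And>y. y \<in> N \<Longrightarrow> (transition c c' has_derivative (*v) A) (at (snd c y))"
proof -
  obtain A A' d M where A: "integral_matrix A" "integral_matrix A'" "A ** A' = mat 1" "A' ** A = mat 1"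
    "open M" "snd c x \<in> M" "M \<subseteq> snd c ` fst c"
    "\<And>y. y \<in> M \<Longrightarrow> chart_inv c y \<in> fst c \<and> chart_inv c y \<in> fst c' \<and> snd c (chart_inv c y) = y \<and>
       snd c' (chart_inv c y) = A *v y + d"
    "\<And>y. y \<in> M \<Longrightarrow> (transition c c' has_derivative (*v) A) (at y)"
    using affE[OF assms] by metis
  obtain N where N: "openB N" "x \<in> N" "N \<subseteq> fst c" "snd c ` N \<subseteq> M"
    using chart_nbhd[OF assms(1) A(5-7) assms(3)] by metis
  have i: "chart_inv c (snd c y) = y" "snd c y \<in> M" if "y \<in> N" for y
    using that N assms(1) by auto
  show ?thesis
  proof (rule that[of A A' N d])
    show "A \<in> GL_int" using A(1-4) by (auto simp: GL_int_def)
    show "N \<subseteq> fst c \<inter> fst c'" using N(3) A(8) i by (metis Int_subset_iff subsetI)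
    show "snd c' y = A *v snd c y + d" if "y \<in> N" for y using A(8)[OF i(2)[OF that]] i(1)[OF that] by simp
    show "(transition c c' has_derivative (*v) A) (at (snd c y))" if "y \<in> N" for y using A(9) i(2)[OF that] .
  qed (use A N in auto)
qed

end

text \<open>
  A bundle of groups \<open>G\<close> with a coordinate system for every chart: \<open>k c r x\<close> is the element of \<open>G x\<close>
  with coordinates \<open>r\<close> in the chart \<open>c\<close>.  Coordinates change by the linear part of the change of charts,
  which is locally constant.  The elements of \<open>G x\<close> that have coordinates form a copy of \<open>\<real>\<^sup>n\<close>, in which
  the flat sections take their values.
\<close>

locale flat_system = integral_affine_mfd B \<A> \<C>
  for B :: "'b::topological_space set" and \<A> \<C> :: "('b, real^'n) chart set" +
  fixes G :: "'b \<Rightarrow> 'g monoid" and k :: "('b, real^'n) chart \<Rightarrow> real^'n \<Rightarrow> 'b \<Rightarrow> 'g"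
  assumes k_closed: "c \<in> \<C> \<Longrightarrow> x \<in> fst c \<Longrightarrow> k c r x \<in> carrier (G x)"
    and k_mult: "c \<in> \<C> \<Longrightarrow> x \<in> fst c \<Longrightarrow> k c r x \<otimes>\<^bsub>G x\<^esub> k c s x = k c (r + s) x"
    and k_one: "c \<in> \<C> \<Longrightarrow> x \<in> fst c \<Longrightarrow> \<one>\<^bsub>G x\<^esub> = k c 0 x"
    and k_inj: "c \<in> \<C> \<Longrightarrow> x \<in> fst c \<Longrightarrow> k c r x = k c s x \<Longrightarrow> r = s"
    and k_change: "c \<in> \<C> \<Longrightarrow> c' \<in> \<C> \<Longrightarrow> x \<in> fst c \<Longrightarrow> x \<in> fst c' \<Longrightarrow>
      (transition c c' has_derivative (*v) A) (at (snd c x)) \<Longrightarrow> k c r x = k c' (A *v r) x"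
begin

abbreviation Flat :: "'b set \<Rightarrow> ('b \<Rightarrow> 'g) monoid" where "Flat \<equiv> flat_sections B \<C> G k"

lemma flatI:
  assumes "s \<in> extensional V"
    and "\<And>x. x \<in> V \<Longrightarrow> \<exists>c\<in>\<C>. \<exists>N r. openB N \<and> x \<in> N \<and> N \<subseteq> V \<inter> fst c \<and> (\<forall>y\<in>N. s y = k c r y)"
  shows "s \<in> carrier (Flat V)"
proof -
  have "s x \<in> carrier (G x)" if x: "x \<in> V" for x
  proof -
    obtain c N r where "c \<in> \<C>" "x \<in> N" "N \<subseteq> V \<inter> fst c" "\<forall>y\<in>N. s y = k c r y" using assms(2)[OF x] by blast
    then show ?thesis using k_closed[of c x r] by (metis Int_iff subsetD)
  qed
  then show ?thesis using assms by (simp add: flat_sections_def PiE_iff)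
qed

lemma flatD:
  assumes "s \<in> carrier (Flat V)" "x \<in> V"
  shows "\<exists>c\<in>\<C>. \<exists>N r. openB N \<and> x \<in> N \<and> N \<subseteq> V \<inter> fst c \<and> (\<forall>y\<in>N. s y = k c r y)"
  using assms by (simp add: flat_sections_def)

text \<open>
  As the linear part of a change of charts is locally constant, flatness may be tested in any chart.
\<close>

lemma flat_chart:
  assumes "s \<in> carrier (Flat V)" "x \<in> V" "c \<in> \<C>" "x \<in> fst c"
  obtains N r where "openB N" "x \<in> N" "N \<subseteq> V \<inter> fst c" "\<And>y. y \<in> N \<Longrightarrow> s y = k c r y"
proof -
  obtain c' N r where c': "c' \<in> \<C>" "openB N" "x \<in> N" "N \<subseteq> V \<inter> fst c'" "\<forall>y\<in>N. s y = k c' r y"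
    using flatD[OF assms(1,2)] by blast
  have x: "x \<in> fst c'" using c' by blast
  obtain A d N' where A: "openB N'" "x \<in> N'" "N' \<subseteq> fst c' \<inter> fst c"
    "\<And>y. y \<in> N' \<Longrightarrow> (transition c' c has_derivative (*v) A) (at (snd c' y))"
    using chart_change[OF c'(1) assms(3) x assms(4)] by metis
  show ?thesis
  proof (rule that[of "N \<inter> N'" "A *v r"])
    show "openB (N \<inter> N')" "x \<in> N \<inter> N'" "N \<inter> N' \<subseteq> V \<inter> fst c" using c' A by auto
    fix y assume y: "y \<in> N \<inter> N'"
    then have "y \<in> fst c'" "y \<in> fst c" using A(3) by auto
    from k_change[OF c'(1) assms(3) this A(4)] show "s y = k c (A *v r) y" using y c'(5) by simp
  qed
qed

lemma flat_value:
  assumes "s \<in> carrier (Flat V)" "x \<in> V" "c \<in> \<C>" "x \<in> fst c"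
  obtains r where "s x = k c r x"
  using flat_chart[OF assms] by metis

lemma flat_ext: "s \<in> carrier (Flat V) \<Longrightarrow> s \<in> extensional V"
  by (simp add: flat_sections_def PiE_iff)

lemma flat_mult: "s \<otimes>\<^bsub>Flat V\<^esub> t = (\<lambda>x\<in>V. s x \<otimes>\<^bsub>G x\<^esub> t x)"
  by (simp add: flat_sections_def)

lemma flat_one: "\<one>\<^bsub>Flat V\<^esub> = (\<lambda>x\<in>V. \<one>\<^bsub>G x\<^esub>)"
  by (simp add: flat_sections_def)

text \<open>
  Products and inverses of flat sections are flat because their coordinates are functions of constant
  coordinates.
\<close>

lemma flat_fun:
  assumes V: "openB V" and s: "s \<in> carrier (Flat V)" and t: "t \<in> carrier (Flat V)"
    and m: "\<And>c x r q. c \<in> \<C> \<Longrightarrow> x \<in> V \<Longrightarrow> x \<in> fst c \<Longrightarrow> s x = k c r x \<Longrightarrow> t x = k c q x \<Longrightarrow> m x = k c (f r q) x"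
  shows "restrict m V \<in> carrier (Flat V)"
proof (rule flatI)
  fix x assume x: "x \<in> V"
  then obtain c where c: "c \<in> \<C>" "x \<in> fst c" using chart_around openin_imp_subset[OF V] by blast
  obtain N r where N: "openB N" "x \<in> N" "N \<subseteq> V \<inter> fst c" "\<And>y. y \<in> N \<Longrightarrow> s y = k c r y"
    using flat_chart[OF s x c] by blast
  obtain N' q where N': "openB N'" "x \<in> N'" "N' \<subseteq> V \<inter> fst c" "\<And>y. y \<in> N' \<Longrightarrow> t y = k c q y"
    using flat_chart[OF t x c] by blast
  have "openB (N \<inter> N') \<and> x \<in> N \<inter> N' \<and> N \<inter> N' \<subseteq> V \<inter> fst c \<and> (\<forall>y\<in>N \<inter> N'. restrict m V y = k c (f r q) y)"
    using N N' m[OF c(1)] by auto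
  then show "\<exists>c\<in>\<C>. \<exists>N r. openB N \<and> x \<in> N \<and> N \<subseteq> V \<inter> fst c \<and> (\<forall>y\<in>N. restrict m V y = k c r y)"
    using c(1) by blast
qed simp

lemma flat_one_closed: "openB V \<Longrightarrow> \<one>\<^bsub>Flat V\<^esub> \<in> carrier (Flat V)"
proof (rule flatI)
  fix x assume V: "openB V" and x: "x \<in> V"
  then obtain c where c: "c \<in> \<C>" "x \<in> fst c" using chart_around openin_imp_subset[OF V] by blast
  have "openB (V \<inter> fst c) \<and> x \<in> V \<inter> fst c \<and> V \<inter> fst c \<subseteq> V \<inter> fst c \<and> (\<forall>y\<in>V \<inter> fst c. \<one>\<^bsub>Flat V\<^esub> y = k c 0 y)"
    using c x openB_chart[OF c(1)] V k_one by (auto simp: flat_one)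
  then show "\<exists>c\<in>\<C>. \<exists>N r. openB N \<and> x \<in> N \<and> N \<subseteq> V \<inter> fst c \<and> (\<forall>y\<in>N. \<one>\<^bsub>Flat V\<^esub> y = k c r y)"
    using c(1) by blast
qed (simp add: flat_one)

lemma comm_group_flat:
  assumes V: "openB V"
  shows "comm_group (Flat V)"
proof -
  have cx: "\<exists>c\<in>\<C>. x \<in> fst c" if "x \<in> V" for x
    using that chart_around openin_imp_subset[OF V] by blast
  have val: "\<exists>r. s x = k c r x" if "s \<in> carrier (Flat V)" "x \<in> V" "c \<in> \<C>" "x \<in> fst c" for s x c
    using flat_value[OF that] by blast
  show ?thesis
  proof (rule comm_groupI)
    fix s t assume s: "s \<in> carrier (Flat V)" and t: "t \<in> carrier (Flat V)"
    show "s \<otimes>\<^bsub>Flat V\<^esub> t \<in> carrier (Flat V)"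
      unfolding flat_mult by (rule flat_fun[OF V s t, of _ "(+)"]) (simp add: k_mult)
    show "s \<otimes>\<^bsub>Flat V\<^esub> t = t \<otimes>\<^bsub>Flat V\<^esub> s"
      unfolding flat_mult
    proof (rule restrict_ext)
      fix x assume x: "x \<in> V"
      obtain c where c: "c \<in> \<C>" "x \<in> fst c" using cx[OF x] by blast
      obtain r q where "s x = k c r x" "t x = k c q x" using val[OF s x c] val[OF t x c] by blast
      then show "s x \<otimes>\<^bsub>G x\<^esub> t x = t x \<otimes>\<^bsub>G x\<^esub> s x" by (simp add: k_mult c add.commute)
    qed
    fix u assume u: "u \<in> carrier (Flat V)"
    show "s \<otimes>\<^bsub>Flat V\<^esub> t \<otimes>\<^bsub>Flat V\<^esub> u = s \<otimes>\<^bsub>Flat V\<^esub> (t \<otimes>\<^bsub>Flat V\<^esub> u)"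
      unfolding flat_mult
    proof (rule restrict_ext)
      fix x assume x: "x \<in> V"
      obtain c where c: "c \<in> \<C>" "x \<in> fst c" using cx[OF x] by blast
      obtain r q p where "s x = k c r x" "t x = k c q x" "u x = k c p x"
        using val[OF s x c] val[OF t x c] val[OF u x c] by blast
      then show "(\<lambda>x\<in>V. s x \<otimes>\<^bsub>G x\<^esub> t x) x \<otimes>\<^bsub>G x\<^esub> u x = s x \<otimes>\<^bsub>G x\<^esub> (\<lambda>x\<in>V. t x \<otimes>\<^bsub>G x\<^esub> u x) x"
        using x by (simp add: k_mult c add.assoc)
    qed
  next
    fix s assume s: "s \<in> carrier (Flat V)"
    show "\<one>\<^bsub>Flat V\<^esub> \<otimes>\<^bsub>Flat V\<^esub> s = s"
    proof (rule extensionalityI[of _ V])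
      fix x assume x: "x \<in> V"
      obtain c where c: "c \<in> \<C>" "x \<in> fst c" using cx[OF x] by blast
      obtain r where "s x = k c r x" using val[OF s x c] by blast
      then show "(\<one>\<^bsub>Flat V\<^esub> \<otimes>\<^bsub>Flat V\<^esub> s) x = s x" using x by (simp add: k_mult c k_one[OF c] flat_mult flat_one)
    qed (simp_all add: flat_mult flat_ext[OF s])
    \<comment> \<open>The inverse section: in some chart around each point, negate the coordinates.\<close>
    define w where "w = (\<lambda>x. k (SOME c. c \<in> \<C> \<and> x \<in> fst c) (- (THE r. s x = k (SOME c. c \<in> \<C> \<and> x \<in> fst c) r x)) x)"
    have w: "w x = k c (- r) x" if c: "c \<in> \<C>" "x \<in> fst c" and r: "s x = k c r x" for c x r
    proof -
      define c' where "c' = (SOME c. c \<in> \<C> \<and> x \<in> fst c)"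
      have "\<exists>c. c \<in> \<C> \<and> x \<in> fst c" using c by blast
      from someI_ex[OF this] have c': "c' \<in> \<C>" "x \<in> fst c'" unfolding c'_def by auto
      obtain A where A: "(transition c c' has_derivative (*v) A) (at (snd c x))"
        using affE[OF c(1) c'(1) c(2) c'(2)] by metis
      note ch = k_change[OF c(1) c'(1) c(2) c'(2) A]
      have "(THE r. s x = k c' r x) = A *v r" using r ch k_inj[OF c'] by (intro the_equality) auto
      then show ?thesis unfolding w_def c'_def[symmetric] ch
        by (simp add: linear_neg[OF matrix_vector_mul_linear])
    qed
    have wc: "restrict w V \<in> carrier (Flat V)"
      by (rule flat_fun[OF V s s, of _ "\<lambda>r q. - r"]) (rule w)
    have "restrict w V \<otimes>\<^bsub>Flat V\<^esub> s = \<one>\<^bsub>Flat V\<^esub>"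
      unfolding flat_mult flat_one
    proof (rule restrict_ext)
      fix x assume x: "x \<in> V"
      obtain c where c: "c \<in> \<C>" "x \<in> fst c" using cx[OF x] by blast
      obtain r where r: "s x = k c r x" using val[OF s x c] by blast
      show "restrict w V x \<otimes>\<^bsub>G x\<^esub> s x = \<one>\<^bsub>G x\<^esub>"
        using x r w[OF c r] by (simp add: k_mult c k_one[OF c])
    qed
    then show "\<exists>y\<in>carrier (Flat V). y \<otimes>\<^bsub>Flat V\<^esub> s = \<one>\<^bsub>Flat V\<^esub>" using wc by blast
  qed (rule flat_one_closed[OF V])
qed

lemma flat_restrict:
  assumes "s \<in> carrier (Flat V)" "openB W" "W \<subseteq> V"
  shows "restrict s W \<in> carrier (Flat W)"
proof (rule flatI)
  fix x assume x: "x \<in> W"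
  obtain c N r where c: "c \<in> \<C>" "openB N" "x \<in> N" "N \<subseteq> V \<inter> fst c" "\<forall>y\<in>N. s y = k c r y"
    using flatD[OF assms(1)] assms(3) x by blast
  have "openB (N \<inter> W) \<and> x \<in> N \<inter> W \<and> N \<inter> W \<subseteq> W \<inter> fst c \<and> (\<forall>y\<in>N \<inter> W. restrict s W y = k c r y)"
    using c assms x by auto
  then show "\<exists>c\<in>\<C>. \<exists>N r. openB N \<and> x \<in> N \<and> N \<subseteq> W \<inter> fst c \<and> (\<forall>y\<in>N. restrict s W y = k c r y)"
    using c(1) by blast
qed simp

lemma flat_presheaf: "abelian_presheaf openB Flat"
proof (rule abelian_presheaf.intro)
  show "(\<lambda>s. restrict s W) \<in> hom (Flat V) (Flat W)" if "openB V" "openB W" "W \<subseteq> V" for V W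
    using flat_restrict that by (intro homI) (auto simp: flat_mult fun_eq_iff)
  show "comm_group (Flat V)" if "openB V" for V by (rule comm_group_flat[OF that])
qed (rule openin_Int)

end

lemma (in flat_system) flat_inv:
  assumes V: "openB V" and s: "s \<in> carrier (Flat V)" and x: "x \<in> V" and c: "c \<in> \<C>" "x \<in> fst c" and r: "s x = k c r x"
  shows "(inv\<^bsub>Flat V\<^esub> s) x = k c (- r) x"
proof -
  interpret V: comm_group "Flat V" by (rule comm_group_flat[OF V])
  obtain q where q: "(inv\<^bsub>Flat V\<^esub> s) x = k c q x" using flat_value[OF V.inv_closed[OF s] x c] .
  have "(inv\<^bsub>Flat V\<^esub> s \<otimes>\<^bsub>Flat V\<^esub> s) x = \<one>\<^bsub>Flat V\<^esub> x" using V.l_inv[OF s] by simp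
  then have "k c (q + r) x = k c 0 x"
    unfolding flat_mult flat_one using x by (simp add: q r k_mult[OF c] k_one[OF c])
  then have "q + r = 0" using k_inj[OF c] by blast
  then show ?thesis using q by (simp add: add_eq_0_iff2)
qed

text \<open>
  Pointwise, the cochain is a difference \<open>e \<nu> - e \<mu>\<close>, so its differential vanishes.  It is in general not
  a coboundary, since the \<open>e \<mu>\<close> may vary from point to point.  The cocycle \<open>\<tau>\<close> has this form.
\<close>

lemma (in flat_system) flat_cocycleI:
  assumes U: "\<And>\<alpha>. \<alpha> \<in> I \<Longrightarrow> openB (U \<alpha>)" and s: "s \<in> carrier (cech_C1 Flat I U)"
    and e: "\<And>y \<alpha> \<beta> \<gamma>. \<alpha> \<in> I \<Longrightarrow> \<beta> \<in> I \<Longrightarrow> \<gamma> \<in> I \<Longrightarrow> y \<in> U \<alpha> \<inter> U \<beta> \<inter> U \<gamma> \<Longrightarrow>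
      \<exists>c\<in>\<C>. y \<in> fst c \<and> (\<exists>e. \<forall>\<mu>\<in>{\<alpha>, \<beta>, \<gamma>}. \<forall>\<nu>\<in>{\<alpha>, \<beta>, \<gamma>}. s (\<mu>, \<nu>) y = k c (e \<nu> - e \<mu>) y)"
  shows "s \<in> carrier (cech_Z1 Flat I U)"
proof -
  interpret cech_cover openB Flat I U
    using U flat_presheaf by (simp add: cech_cover_def cech_cover_axioms_def)
  show ?thesis
    unfolding Z1_iff
  proof (intro conjI ballI s)
    fix \<alpha> \<beta> \<gamma> assume a: "\<alpha> \<in> I" "\<beta> \<in> I" "\<gamma> \<in> I"
    define V where "V = U \<alpha> \<inter> U \<beta> \<inter> U \<gamma>"
    have V: "openB V" using Op_cover3[OF a] by (simp add: V_def)
    have r: "restrict (s (\<mu>, \<nu>)) V \<in> carrier (Flat V)" if "\<mu> \<in> {\<alpha>, \<beta>, \<gamma>}" "\<nu> \<in> {\<alpha>, \<beta>, \<gamma>}" for \<mu> \<nu>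
    proof -
      have "\<mu> \<in> I" "\<nu> \<in> I" "V \<subseteq> U \<mu> \<inter> U \<nu>" using that a by (auto simp: V_def)
      then show ?thesis using s V flat_restrict unfolding C1_iff by blast
    qed
    show "delta1 s \<alpha> \<beta> \<gamma> = \<one>\<^bsub>Flat (U \<alpha> \<inter> U \<beta> \<inter> U \<gamma>)\<^esub>"
      unfolding delta1_def V_def[symmetric] Let_def
    proof (rule extensionalityI[of _ V])
      fix y assume y: "y \<in> V"
      obtain c e where c: "c \<in> \<C>" "y \<in> fst c"
        and e: "\<And>\<mu> \<nu>. \<mu> \<in> {\<alpha>, \<beta>, \<gamma>} \<Longrightarrow> \<nu> \<in> {\<alpha>, \<beta>, \<gamma>} \<Longrightarrow> s (\<mu>, \<nu>) y = k c (e \<nu> - e \<mu>) y"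
        using e[OF a, of y] y unfolding V_def by blast
      have v: "restrict (s (\<mu>, \<nu>)) V y = k c (e \<nu> - e \<mu>) y" if "\<mu> \<in> {\<alpha>, \<beta>, \<gamma>}" "\<nu> \<in> {\<alpha>, \<beta>, \<gamma>}" for \<mu> \<nu>
        using e[OF that] y by simp
      have "(inv\<^bsub>Flat V\<^esub> (restrict (s (\<alpha>, \<gamma>)) V)) y = k c (- (e \<gamma> - e \<alpha>)) y"
        by (rule flat_inv[OF V r y c v]) auto
      then show "(restrict (s (\<beta>, \<gamma>)) V \<otimes>\<^bsub>Flat V\<^esub> inv\<^bsub>Flat V\<^esub> restrict (s (\<alpha>, \<gamma>)) V \<otimes>\<^bsub>Flat V\<^esub> restrict (s (\<alpha>, \<beta>)) V) y = \<one>\<^bsub>Flat V\<^esub> y"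
        using y v[of \<beta> \<gamma>] v[of \<alpha> \<beta>] by (simp add: flat_mult flat_one k_mult[OF c] k_one[OF c])
    qed (simp_all add: flat_mult flat_one)
  qed
qed

text \<open>
  The element of the second bundle over \<open>x\<close> with the same coordinates as \<open>h\<close>.  By the common rule for
  the change of coordinates it does not depend on the chart (\<open>transfer_eq\<close>).
\<close>

definition flat_transfer ::
  "('b, real^'n) chart set \<Rightarrow> (('b, real^'n) chart \<Rightarrow> real^'n \<Rightarrow> 'b \<Rightarrow> 'g) \<Rightarrow>
    (('b, real^'n) chart \<Rightarrow> real^'n \<Rightarrow> 'b \<Rightarrow> 'h) \<Rightarrow> 'b \<Rightarrow> 'g \<Rightarrow> 'h" where
  "flat_transfer \<C> k k' x h = (THE v. \<exists>c\<in>\<C>. x \<in> fst c \<and> (\<exists>r. h = k c r x \<and> v = k' c r x))"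

locale flat_system_pair = S: flat_system B \<A> \<C> G k + T: flat_system B \<A> \<C> G' k'
  for B :: "'b::topological_space set" and \<A> \<C> :: "('b, real^'n) chart set"
    and G :: "'b \<Rightarrow> 'g monoid" and k :: "('b, real^'n) chart \<Rightarrow> real^'n \<Rightarrow> 'b \<Rightarrow> 'g"
    and G' :: "'b \<Rightarrow> 'h monoid" and k' :: "('b, real^'n) chart \<Rightarrow> real^'n \<Rightarrow> 'b \<Rightarrow> 'h"
begin

lemma transfer_eq:
  assumes c: "c \<in> \<C>" "x \<in> fst c"
  shows "flat_transfer \<C> k k' x (k c r x) = k' c r x"
  unfolding flat_transfer_def
proof (rule the_equality)
  show "\<exists>c'\<in>\<C>. x \<in> fst c' \<and> (\<exists>q. k c r x = k c' q x \<and> k' c r x = k' c' q x)" using c by blast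
  fix v assume "\<exists>c'\<in>\<C>. x \<in> fst c' \<and> (\<exists>q. k c r x = k c' q x \<and> v = k' c' q x)"
  then obtain c' q where c': "c' \<in> \<C>" "x \<in> fst c'" and q: "k c r x = k c' q x" "v = k' c' q x" by blast
  obtain A where A: "(transition c c' has_derivative (*v) A) (at (snd c x))"
    using S.affE[OF c(1) c'(1) c(2) c'(2)] by metis
  have "q = A *v r" using q(1) S.k_change[OF c(1) c'(1) c(2) c'(2) A] S.k_inj[OF c'] by metis
  then show "v = k' c r x" using q(2) T.k_change[OF c(1) c'(1) c(2) c'(2) A] by simp
qed

definition section_map :: "'b set \<Rightarrow> ('b \<Rightarrow> 'g) \<Rightarrow> 'b \<Rightarrow> 'h" where
  "section_map V s = (\<lambda>x\<in>V. flat_transfer \<C> k k' x (s x))"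

lemma section_map_closed:
  assumes V: "S.openB V" and s: "s \<in> carrier (S.Flat V)"
  shows "section_map V s \<in> carrier (T.Flat V)"
proof (rule T.flatI)
  fix x assume x: "x \<in> V"
  then obtain c where c: "c \<in> \<C>" "x \<in> fst c" using S.chart_around openin_imp_subset[OF V] by blast
  obtain N r where N: "S.openB N" "x \<in> N" "N \<subseteq> V \<inter> fst c" "\<And>y. y \<in> N \<Longrightarrow> s y = k c r y"
    using S.flat_chart[OF s x c] by blast
  have "\<forall>y\<in>N. section_map V s y = k' c r y"
    using N(3,4) transfer_eq[OF c(1)] by (auto simp: section_map_def)
  then show "\<exists>c\<in>\<C>. \<exists>N r. S.openB N \<and> x \<in> N \<and> N \<subseteq> V \<inter> fst c \<and> (\<forall>y\<in>N. section_map V s y = k' c r y)"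
    using c(1) N by blast
qed (simp add: section_map_def)

lemma section_map_hom: "S.openB V \<Longrightarrow> section_map V \<in> hom (S.Flat V) (T.Flat V)"
proof (rule homI)
  assume V: "S.openB V"
  fix s t assume s: "s \<in> carrier (S.Flat V)" and t: "t \<in> carrier (S.Flat V)"
  show "section_map V (s \<otimes>\<^bsub>S.Flat V\<^esub> t) = section_map V s \<otimes>\<^bsub>T.Flat V\<^esub> section_map V t"
    unfolding section_map_def T.flat_mult
  proof (rule restrict_ext)
    fix x assume x: "x \<in> V"
    then obtain c where c: "c \<in> \<C>" "x \<in> fst c" using S.chart_around openin_imp_subset[OF V] by blast
    obtain r where r: "s x = k c r x" using S.flat_value[OF s x c] .
    obtain q where q: "t x = k c q x" using S.flat_value[OF t x c] .
    show "flat_transfer \<C> k k' x ((s \<otimes>\<^bsub>S.Flat V\<^esub> t) x) =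
      (\<lambda>x\<in>V. flat_transfer \<C> k k' x (s x)) x \<otimes>\<^bsub>G' x\<^esub> (\<lambda>x\<in>V. flat_transfer \<C> k k' x (t x)) x"
      using x by (simp add: S.flat_mult r q S.k_mult T.k_mult c transfer_eq)
  qed
qed (rule section_map_closed)

lemma section_map_presheaf_map:
  assumes "\<And>\<alpha>. \<alpha> \<in> I \<Longrightarrow> S.openB (U \<alpha>)"
  shows "presheaf_map S.openB S.Flat T.Flat I U section_map"
proof -
  have "section_map V s = restrict (section_map V' s') V" if "V \<subseteq> V'" "s = restrict s' V" for V V' s s'
    using that by (auto simp: section_map_def fun_eq_iff)
  then show ?thesis
    using assms section_map_hom S.flat_presheaf T.flat_presheaf
    by (auto simp: presheaf_map_def presheaf_map_axioms_def cech_cover_def cech_cover_axioms_def)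
qed

end

lemma flat_system_pair_swap: "flat_system_pair B \<A> \<C> G k G' k' \<Longrightarrow> flat_system_pair B \<A> \<C> G' k' G k"
  by (simp add: flat_system_pair_def)

lemma (in flat_system_pair) section_map_inverse:
  assumes V: "S.openB V" and s: "s \<in> carrier (S.Flat V)"
  shows "flat_system_pair.section_map \<C> k' k V (section_map V s) = s"
proof -
  interpret R: flat_system_pair B \<A> \<C> G' k' G k
    by (rule flat_system_pair_swap) unfold_locales
  show ?thesis
  proof (rule extensionalityI[of _ V])
    fix x assume x: "x \<in> V"
    then obtain c where c: "c \<in> \<C>" "x \<in> fst c" using S.chart_around openin_imp_subset[OF V] by blast
    obtain r where r: "s x = k c r x" using S.flat_value[OF s x c] .
    then show "R.section_map V (section_map V s) x = s x"
      using x by (simp add: R.section_map_def section_map_def transfer_eq[OF c] R.transfer_eq[OF c])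
  qed (simp_all add: R.section_map_def S.flat_ext[OF s])
qed

text \<open>
  The fibrewise transfer of coordinates is an isomorphism of presheaves, with the transfer in the
  other direction as its inverse.
\<close>

lemma (in flat_system_pair) flat_transfer_iso:
  assumes U: "\<And>\<alpha>. \<alpha> \<in> I \<Longrightarrow> S.openB (U \<alpha>)"
  defines "F \<equiv> (\<lambda>s. \<lambda>(\<alpha>, \<beta>)\<in>I \<times> I. \<lambda>x\<in>U \<alpha> \<inter> U \<beta>. flat_transfer \<C> k k' x (s (\<alpha>, \<beta>) x))"
  shows "(\<lambda>K. the_elem ((\<lambda>s. cech_class T.Flat I U (F s)) ` K)) \<in> iso (cech_H1 S.Flat I U) (cech_H1 T.Flat I U)"
    and "s \<in> carrier (cech_Z1 S.Flat I U) \<Longrightarrow> F s \<in> carrier (cech_Z1 T.Flat I U) \<and>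
      the_elem ((\<lambda>s. cech_class T.Flat I U (F s)) ` cech_class S.Flat I U s) = cech_class T.Flat I U (F s)"
proof -
  interpret R: flat_system_pair B \<A> \<C> G' k' G k
    by (rule flat_system_pair_swap) unfold_locales
  interpret P: presheaf_map S.openB S.Flat T.Flat I U section_map
    by (rule section_map_presheaf_map[OF U])
  have F: "P.cochain_map = F"
    unfolding F_def by (intro ext) (simp add: P.cochain_map_def section_map_def fun_eq_iff)
  have Q: "presheaf_map S.openB T.Flat S.Flat I U R.section_map"
    by (rule R.section_map_presheaf_map[OF U])
  note iso = presheaf_iso_cech_H1[OF P.presheaf_map_axioms Q]
  show "(\<lambda>K. the_elem ((\<lambda>s. cech_class T.Flat I U (F s)) ` K)) \<in> iso (cech_H1 S.Flat I U) (cech_H1 T.Flat I U)"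
    unfolding F[symmetric] by (rule iso(1)) (simp_all add: section_map_inverse R.section_map_inverse)
  assume s: "s \<in> carrier (cech_Z1 S.Flat I U)"
  show "F s \<in> carrier (cech_Z1 T.Flat I U) \<and>
      the_elem ((\<lambda>s. cech_class T.Flat I U (F s)) ` cech_class S.Flat I U s) = cech_class T.Flat I U (F s)"
    unfolding F[symmetric]
    by (intro conjI hom_in_carrier[OF P.cochain_map_hom s] iso(2))
      (simp_all add: section_map_inverse R.section_map_inverse s)
qed

section \<open>Translation-invariant forms on a fibre\<close>

lemma frechet_derivative_cong_open:
  assumes "open S" "x \<in> S" "\<And>y. y \<in> S \<Longrightarrow> f y = g y" "f differentiable (at x)"
  shows "frechet_derivative g (at x) = frechet_derivative f (at x)"
proof -
  have "(f has_derivative frechet_derivative f (at x)) (at x)" using assms(4) frechet_derivative_works by blast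
  then have "(g has_derivative frechet_derivative f (at x)) (at x)"
    by (rule has_derivative_transform_within_open[OF _ assms(1-3)])
  then show ?thesis by (rule frechet_derivative_at[symmetric])
qed

lemma frechet_derivative_sum2:
  assumes "f differentiable (at x)" "g differentiable (at x)"
  shows "frechet_derivative (\<lambda>y. f y + g y) (at x) = (\<lambda>v. frechet_derivative f (at x) v + frechet_derivative g (at x) v)"
proof -
  have "(f has_derivative frechet_derivative f (at x)) (at x)" "(g has_derivative frechet_derivative g (at x)) (at x)"
    using assms frechet_derivative_works by blast+
  from frechet_derivative_at[OF has_derivative_add[OF this], symmetric] show ?thesis .
qed

lemma Ck_on_cong:
  assumes "open S" "\<And>x. x \<in> S \<Longrightarrow> f x = g x" "Ck_on k S f"
  shows "Ck_on k S g"
  using assms(2,3)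
proof (induction k arbitrary: f g)
  case 0
  then show ?case using continuous_on_cong by (metis Ck_on.simps(1))
next
  case (Suc k)
  have f: "f differentiable_on S" "\<And>v. Ck_on k S (\<lambda>x. frechet_derivative f (at x) v)"
    using Suc.prems(2) by auto
  have "g differentiable_on S"
    unfolding differentiable_on_eq_differentiable_at[OF assms(1)]
  proof
    fix x assume x: "x \<in> S"
    then obtain D where "(f has_derivative D) (at x)"
      using f(1) differentiable_on_eq_differentiable_at[OF assms(1)] differentiable_def by blast
    from has_derivative_transform_within_open[OF this assms(1) x Suc.prems(1)]
    show "g differentiable (at x)" by (auto simp: differentiable_def)
  qed
  moreover have "frechet_derivative f (at x) v = frechet_derivative g (at x) v" if "x \<in> S" for x v
  proof -
    have "f differentiable (at x)" using f(1) that differentiable_on_eq_differentiable_at[OF assms(1)] by blast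
    from frechet_derivative_cong_open[OF assms(1) that Suc.prems(1) this] show ?thesis by simp
  qed
  then have "Ck_on k S (\<lambda>x. frechet_derivative g (at x) v)" for v
    by (rule Suc.IH[OF _ f(2)])
  ultimately show ?case by simp
qed

lemma Ck_on_const: "Ck_on k S (\<lambda>_. c)"
  by (induction k arbitrary: c) (simp_all add: frechet_derivative_const)

lemma Ck_on_add:
  assumes "open S" "Ck_on k S f" "Ck_on k S g"
  shows "Ck_on k S (\<lambda>x. f x + g x)"
  using assms(2,3)
proof (induction k arbitrary: f g)
  case 0
  then show ?case by (simp add: continuous_on_add)
next
  case (Suc k)
  have d: "f differentiable (at x)" "g differentiable (at x)" if "x \<in> S" for x
    using Suc.prems that differentiable_on_eq_differentiable_at[OF assms(1)] by auto
  have 1: "Ck_on k S (\<lambda>x. frechet_derivative f (at x) v + frechet_derivative g (at x) v)" for v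
    using Suc by simp
  have 2: "frechet_derivative f (at x) v + frechet_derivative g (at x) v =
      frechet_derivative (\<lambda>x. f x + g x) (at x) v" if "x \<in> S" for x v
    using frechet_derivative_sum2[OF d[OF that]] by simp
  have "Ck_on k S (\<lambda>x. frechet_derivative (\<lambda>x. f x + g x) (at x) v)" for v
    by (rule Ck_on_cong[OF assms(1) 2 1])
  then show ?case using Suc.prems by (simp add: differentiable_on_add)
qed

lemma smooth_on_cong: "open S \<Longrightarrow> (\<And>x. x \<in> S \<Longrightarrow> f x = g x) \<Longrightarrow> smooth_on S f \<Longrightarrow> smooth_on S g"
  unfolding smooth_on_def using Ck_on_cong by blast

context affine_atlas
begin

lemma smooth_function_differentiable:
  assumes "smooth_function \<C> f" "c \<in> \<C>" "x \<in> fst c"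
  shows "(f \<circ> chart_inv c) differentiable (at (snd c x))"
proof -
  have "Ck_on (Suc 0) (snd c ` fst c) (f \<circ> chart_inv c)"
    using assms unfolding smooth_function_def smooth_on_def by blast
  then have "(f \<circ> chart_inv c) differentiable_on (snd c ` fst c)" by simp
  then show ?thesis
    using assms(3) differentiable_on_eq_differentiable_at[OF open_chart[OF assms(2)]] by blast
qed

text \<open>
  By the chain rule, the chart chosen in the definition of the differential may be replaced by any other.
\<close>

lemma differential_eq:
  assumes f: "smooth_function \<C> f" and c: "c \<in> \<C>" "x \<in> fst c" and v: "v \<in> tangent_space \<C> x"
  shows "differential \<C> f x v = frechet_derivative (f \<circ> chart_inv c) (at (snd c x)) (v c)"
proof -
  define c' where "c' = chart_at \<C> x"
  have c': "c' \<in> \<C>" "x \<in> fst c'" using chart_at[OF c] by (auto simp: c'_def)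
  obtain L e M where 1: "linear L" "open M" "snd c' x \<in> M"
    "\<And>y. y \<in> M \<Longrightarrow> chart_inv c' y \<in> fst c \<and> snd c (chart_inv c' y) = L y + e"
    using local_affine[OF c'(1) c(1) c'(2) c(2)] by blast
  have t: "(transition c' c has_derivative L) (at (snd c' x))"
    using transition_has_derivative[OF 1(1,2,3)] 1(4) by blast
  define D where "D = frechet_derivative (f \<circ> chart_inv c) (at (snd c x))"
  have D: "((f \<circ> chart_inv c) has_derivative D) (at (snd c x))"
    using smooth_function_differentiable[OF f c] frechet_derivative_works unfolding D_def by blast
  have "transition c' c (snd c' x) = snd c x" using c' by (simp add: transition_def)
  then have comp: "((f \<circ> chart_inv c) \<circ> transition c' c has_derivative (D \<circ> L)) (at (snd c' x))"
    by (intro diff_chain_at t) (use D in simp)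
  have "((f \<circ> chart_inv c') has_derivative (D \<circ> L)) (at (snd c' x))"
  proof (rule has_derivative_transform_within_open[OF comp 1(2,3)])
    fix y assume "y \<in> M"
    then have "chart_inv c (snd c (chart_inv c' y)) = chart_inv c' y"
      using 1(4) inv_chart[OF c(1)] by blast
    then show "((f \<circ> chart_inv c) \<circ> transition c' c) y = (f \<circ> chart_inv c') y"
      by (simp add: transition_def)
  qed
  from frechet_derivative_at[OF this, symmetric] have "differential \<C> f x v = D (L (v c'))"
    using v by (simp add: differential_def c'_def[symmetric] Let_def)
  then show ?thesis using tangent_comp[OF v c'(1) c(1) c'(2) c(2) t] by (simp add: D_def)
qed

lemma exact_zero: "0 \<in> exact_form1s \<C>"
proof -
  have "smooth_function \<C> (\<lambda>_. 0)"
    by (auto simp: smooth_function_def smooth_on_def o_def Ck_on_const)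
  moreover have "differential \<C> (\<lambda>_. 0) = 0"
    by (intro ext) (simp add: differential_def o_def frechet_derivative_const)
  ultimately show ?thesis unfolding exact_form1s_def by (metis (mono_tags) imageI mem_Collect_eq)
qed

lemma exact_add:
  assumes "\<eta> \<in> exact_form1s \<C>" "\<zeta> \<in> exact_form1s \<C>" shows "\<eta> + \<zeta> \<in> exact_form1s \<C>"
proof -
  obtain f g where f: "smooth_function \<C> f" "\<eta> = differential \<C> f"
    and g: "smooth_function \<C> g" "\<zeta> = differential \<C> g"
    using assms by (auto simp: exact_form1s_def)
  have "smooth_function \<C> (\<lambda>x. f x + g x)"
    unfolding smooth_function_def smooth_on_def
  proof (intro ballI allI)
    fix c k assume "c \<in> \<C>"
    then show "Ck_on k (snd c ` fst c) ((\<lambda>x. f x + g x) \<circ> chart_inv c)"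
      using Ck_on_add[OF open_chart, of c k "f \<circ> chart_inv c" "g \<circ> chart_inv c"] f g
      by (simp add: smooth_function_def smooth_on_def o_def)
  qed
  moreover have "differential \<C> (\<lambda>x. f x + g x) x v = (\<eta> + \<zeta>) x v" for x v
  proof (cases "v \<in> tangent_space \<C> x")
    case True
    then obtain c where c: "c \<in> \<C>" "x \<in> fst c" using tangent_iff by blast
    have "(\<lambda>x. f x + g x) \<circ> chart_inv c = (\<lambda>y. (f \<circ> chart_inv c) y + (g \<circ> chart_inv c) y)" by auto
    then show ?thesis
      using frechet_derivative_sum2[OF smooth_function_differentiable[OF f(1) c] smooth_function_differentiable[OF g(1) c]]
        differential_eq[OF calculation c True] differential_eq[OF f(1) c True] differential_eq[OF g(1) c True]
      by (simp add: f(2) g(2))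
  qed (simp add: f(2) g(2) differential_def)
  then have "differential \<C> (\<lambda>x. f x + g x) = \<eta> + \<zeta>" by (intro ext)
  ultimately show ?thesis unfolding exact_form1s_def by (metis (mono_tags) imageI mem_Collect_eq)
qed

lemma deRham_class_eq: "deRham_class \<C> \<eta> = (\<lambda>h. h + \<eta>) ` exact_form1s \<C>"
  by (auto simp: deRham_class_def r_coset_def closed_form1s_def additive_group_def)

text \<open>
  The sum of two cosets of the exact forms is a coset because the exact forms are closed under
  addition and contain \<open>0\<close>.
\<close>

lemma deRham_class_mult:
  "deRham_class \<C> \<eta> \<otimes>\<^bsub>deRham_H1 \<C>\<^esub> deRham_class \<C> \<zeta> = deRham_class \<C> (\<eta> + \<zeta>)"
proof -
  have "deRham_class \<C> \<eta> \<otimes>\<^bsub>deRham_H1 \<C>\<^esub> deRham_class \<C> \<zeta> =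
      {a + b | a b. a \<in> deRham_class \<C> \<eta> \<and> b \<in> deRham_class \<C> \<zeta>}"
    by (auto simp: deRham_H1_def FactGroup_def set_mult_def closed_form1s_def additive_group_def)
  also have "\<dots> = {(h + \<eta>) + (h' + \<zeta>) | h h'. h \<in> exact_form1s \<C> \<and> h' \<in> exact_form1s \<C>}"
    unfolding deRham_class_eq by blast
  also have "\<dots> = (\<lambda>h. h + (\<eta> + \<zeta>)) ` exact_form1s \<C>"
  proof (intro equalityI subsetI)
    fix a assume "a \<in> {(h + \<eta>) + (h' + \<zeta>) | h h'. h \<in> exact_form1s \<C> \<and> h' \<in> exact_form1s \<C>}"
    then obtain h h' where "h \<in> exact_form1s \<C>" "h' \<in> exact_form1s \<C>" "a = (h + h') + (\<eta> + \<zeta>)"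
      by (auto simp: add_ac)
    then show "a \<in> (\<lambda>h. h + (\<eta> + \<zeta>)) ` exact_form1s \<C>" using exact_add by blast
  next
    fix a assume "a \<in> (\<lambda>h. h + (\<eta> + \<zeta>)) ` exact_form1s \<C>"
    then obtain h where "h \<in> exact_form1s \<C>" "a = (h + \<eta>) + (0 + \<zeta>)" by (auto simp: add_ac)
    then show "a \<in> {(h + \<eta>) + (h' + \<zeta>) | h h'. h \<in> exact_form1s \<C> \<and> h' \<in> exact_form1s \<C>}"
      using exact_zero by blast
  qed
  finally show ?thesis unfolding deRham_class_eq .
qed

lemma deRham_class_zero: "\<one>\<^bsub>deRham_H1 \<C>\<^esub> = deRham_class \<C> 0"
  unfolding deRham_class_eq by (simp add: deRham_H1_def)

lemma deRham_class_eqD: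
  assumes "deRham_class \<C> \<eta> = deRham_class \<C> \<zeta>" shows "\<eta> - \<zeta> \<in> exact_form1s \<C>"
proof -
  have "0 + \<eta> \<in> deRham_class \<C> \<eta>" unfolding deRham_class_eq using exact_zero by (rule imageI)
  then obtain h where "h \<in> exact_form1s \<C>" "\<eta> = h + \<zeta>" unfolding assms unfolding deRham_class_eq by auto
  then show ?thesis by simp
qed

end

context int_affine_atlas
begin

lemma fibre_chart_inj:
  assumes "c \<in> \<C>" "x \<in> fst c" "theta_window W"
  shows "inj_on (snd (fibre_chart \<C> x c W)) (fst (fibre_chart \<C> x c W))"
  by (rule inj_onI) (metis fibre_chartE[OF _ assms])

lemma fibre_chart_inv:
  assumes "c \<in> \<C>" "x \<in> fst c" "theta_window W" "t \<in> W"
  shows "chart_inv (fibre_chart \<C> x c W) t = pcoset x (covec_of \<C> c x t)"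
  by (rule chart_inv_eqI[OF fibre_chart_inj[OF assms(1-3)]]) (use fibre_chart_eval[OF assms, of t] in auto)

lemma fibre_chart_image:
  assumes "c \<in> \<C>" "x \<in> fst c" "theta_window W"
  shows "snd (fibre_chart \<C> x c W) ` fst (fibre_chart \<C> x c W) = W"
proof (intro equalityI subsetI)
  fix t assume t: "t \<in> W"
  have "pcoset x (covec_of \<C> c x t) \<in> fst (fibre_chart \<C> x c W)"
    "t = snd (fibre_chart \<C> x c W) (pcoset x (covec_of \<C> c x t))"
    using fibre_chart_eval[OF assms t, of t] by simp_all
  then show "t \<in> snd (fibre_chart \<C> x c W) ` fst (fibre_chart \<C> x c W)" by (rule rev_image_eqI)
next
  fix t assume "t \<in> snd (fibre_chart \<C> x c W) ` fst (fibre_chart \<C> x c W)"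
  then obtain T where "T \<in> fst (fibre_chart \<C> x c W)" "t = snd (fibre_chart \<C> x c W) T" by blast
  then show "t \<in> W" using fibre_chartE[OF _ assms] by metis
qed

lemma fibre_window:
  assumes "T \<in> ref_fibre \<C> x" "c \<in> \<C>" "x \<in> fst c"
  obtains W where "theta_window W" "T \<in> fst (fibre_chart \<C> x c W)"
proof -
  obtain t where "T = pcoset x (covec_of \<C> c x t)" using ref_fibreE[OF assms] .
  then show ?thesis using that[OF theta_window_ball] fibre_chart_eval(1)[OF assms(2,3) theta_window_ball, of t t "t"] by simp
qed

text \<open>
  The fibre coordinates of two charts with linear change \<open>A\<close> differ by the inverse transpose of \<open>A\<close> and
  a translation \<open>k\<close>.  As the coordinates are defined modulo \<open>\<int>\<^sup>n\<close>, this \<open>k\<close> is integral.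
\<close>

lemma fibre_local:
  assumes c: "c \<in> \<C>" "c' \<in> \<C>" "x \<in> fst c" "x \<in> fst c'" and W: "theta_window W" "theta_window W'"
    and T: "T \<in> fst (fibre_chart \<C> x c W)" "T \<in> fst (fibre_chart \<C> x c' W')"
    and A: "(transition c c' has_derivative (*v) A) (at (snd c x))" "A' ** A = mat 1"
  shows "\<exists>d M. open M \<and> snd (fibre_chart \<C> x c W) T \<in> M \<and> M \<subseteq> W \<and>
      (\<forall>t\<in>M. chart_inv (fibre_chart \<C> x c W) t \<in> fst (fibre_chart \<C> x c' W') \<and>
        snd (fibre_chart \<C> x c' W') (chart_inv (fibre_chart \<C> x c W) t) = transpose A' *v t + d)"
proof -
  obtain t0 where 1: "t0 \<in> W" "T = pcoset x (covec_of \<C> c x t0)" "snd (fibre_chart \<C> x c W) T = t0"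
    using fibre_chartE[OF T(1) c(1,3) W(1)] by metis
  obtain t0' where 2: "t0' \<in> W'" "T = pcoset x (covec_of \<C> c' x t0')"
    using fibre_chartE[OF T(2) c(2,4) W(2)] by metis
  note ch = covec_of_change'[OF c A]
  define k where "k = t0' - transpose A' *v t0"
  have k: "k $ i \<in> \<int>" for i
    using pcoset_eqD[OF c(2,4), of t0' "transpose A' *v t0" i] 1(2) 2(2) ch unfolding k_def by simp
  define N where "N = W \<inter> (\<lambda>t. transpose A' *v t + k) -` W'"
  have "open N" unfolding N_def
    using W unfolding theta_window_def
    by (intro open_Int open_vimage continuous_intros matrix_vector_mult_linear_continuous_on) auto
  moreover have "chart_inv (fibre_chart \<C> x c W) t \<in> fst (fibre_chart \<C> x c' W') \<and>
      snd (fibre_chart \<C> x c' W') (chart_inv (fibre_chart \<C> x c W) t) = transpose A' *v t + k" if "t \<in> N" for t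
  proof -
    have t: "t \<in> W" "transpose A' *v t + k \<in> W'" using that by (auto simp: N_def)
    have "(transpose A' *v t + k) $ i - (transpose A' *v t) $ i \<in> \<int>" for i using k by simp
    from fibre_chart_eval[OF c(2,4) W(2) t(2) this] show ?thesis
      unfolding fibre_chart_inv[OF c(1,3) W(1) t(1)] ch by simp
  qed
  moreover have "snd (fibre_chart \<C> x c W) T \<in> N" "N \<subseteq> W" using 1 2 by (auto simp: N_def k_def)
  ultimately show ?thesis by blast
qed

lemma fibre_affine_atlas: "affine_atlas (fibre_atlas \<C> x)"
proof
  fix K assume "K \<in> fibre_atlas \<C> x"
  then obtain c W where c: "c \<in> \<C>" "x \<in> fst c" "theta_window W" "K = fibre_chart \<C> x c W" by (auto simp: fibre_atlas_def)
  show "inj_on (snd K) (fst K)" "open (snd K ` fst K)"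
    using c fibre_chart_inj fibre_chart_image by (auto simp: theta_window_def)
next
  fix K K' T assume K: "K \<in> fibre_atlas \<C> x" "K' \<in> fibre_atlas \<C> x" "T \<in> fst K" "T \<in> fst K'"
  obtain c W c' W' where c: "c \<in> \<C>" "x \<in> fst c" "theta_window W" "K = fibre_chart \<C> x c W"
    "c' \<in> \<C>" "x \<in> fst c'" "theta_window W'" "K' = fibre_chart \<C> x c' W'"
    using K by (auto simp: fibre_atlas_def)
  obtain A A' where a: "A' ** A = mat 1" "(transition c c' has_derivative (*v) A) (at (snd c x))"
    using affE[OF c(1,5,2,6)] by metis
  from fibre_local[OF c(1,5,2,6,3,7) K(3,4)[unfolded c] a(2,1)]
  show "\<exists>L d M. linear L \<and> open M \<and> snd K T \<in> M \<and> M \<subseteq> snd K ` fst K \<and>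
        (\<forall>y\<in>M. chart_inv K y \<in> fst K' \<and> snd K' (chart_inv K y) = L y + d)"
    unfolding c fibre_chart_image[OF c(1-3)] using matrix_vector_mul_linear by blast
qed

lemma fibre_deriv:
  assumes c: "c \<in> \<C>" "c' \<in> \<C>" "x \<in> fst c" "x \<in> fst c'" and W: "theta_window W" "theta_window W'"
    and T: "T \<in> fst (fibre_chart \<C> x c W)" "T \<in> fst (fibre_chart \<C> x c' W')"
    and A: "(transition c c' has_derivative (*v) A) (at (snd c x))" "A' ** A = mat 1"
  shows "(transition (fibre_chart \<C> x c W) (fibre_chart \<C> x c' W') has_derivative (*v) (transpose A'))
    (at (snd (fibre_chart \<C> x c W) T))"
proof -
  interpret F: affine_atlas "fibre_atlas \<C> x" by (rule fibre_affine_atlas)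
  obtain d M where "open M" "snd (fibre_chart \<C> x c W) T \<in> M"
    "\<And>t. t \<in> M \<Longrightarrow> snd (fibre_chart \<C> x c' W') (chart_inv (fibre_chart \<C> x c W) t) = transpose A' *v t + d"
    using fibre_local[OF assms] by blast
  then show ?thesis by (rule F.transition_has_derivative[OF matrix_vector_mul_linear])
qed

lemma fibre_atlasI: "c \<in> \<C> \<Longrightarrow> x \<in> fst c \<Longrightarrow> theta_window W \<Longrightarrow> fibre_chart \<C> x c W \<in> fibre_atlas \<C> x"
  unfolding fibre_atlas_def by blast

definition theta_form :: "('b, real^'n) chart \<Rightarrow> real^'n \<Rightarrow> 'b \<Rightarrow> (('b, real^'n) covec set, real^'n) form1" where
  "theta_form c r x = fibre_restrict \<C> x (\<lambda>e v. \<Sum>i\<in>UNIV. r $ i * dtheta \<C> c i e v)"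

lemma theta_class_form: "theta_class \<C> c r x = deRham_class (fibre_atlas \<C> x) (theta_form c r x)"
  by (simp add: theta_class_def fibre_class_def theta_form_def)

lemma theta_form_outside: "u \<notin> tangent_space (fibre_atlas \<C> x) T \<Longrightarrow> theta_form c r x T u = 0"
  by (simp add: theta_form_def fibre_restrict_def pullback1_def)

lemma theta_form_eq:
  assumes c: "c \<in> \<C>" "x \<in> fst c" and W: "theta_window W" and T: "T \<in> fst (fibre_chart \<C> x c W)"
    and u: "u \<in> tangent_space (fibre_atlas \<C> x) T"
  shows "theta_form c r x T u = r \<bullet> u (fibre_chart \<C> x c W)"
proof -
  interpret F: affine_atlas "fibre_atlas \<C> x" by (rule fibre_affine_atlas)
  define iu where "iu = pushforward (fibre_atlas \<C> x) (ref_atlas \<C>) (Pair x) T u"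
  obtain c' W' where c': "c' \<in> \<C>" "x \<in> fst c'" "theta_window W'" "(x, T) \<in> fst (ref_chart \<C> c' W')"
    "iu = coord_vector (ref_atlas \<C>) (ref_chart \<C> c' W') (x, T) (0, u (fibre_chart \<C> x c' W'))"
    using pushforward_Pair[OF u] unfolding iu_def by metis
  define D where "D = ref_chart \<C> c' W'"
  have D: "D \<in> ref_atlas \<C>" "(x, T) \<in> fst D" using ref_atlasI[OF c'(1,3)] c'(4) by (auto simp: D_def)
  have iu: "iu \<in> tangent_space (ref_atlas \<C>) (x, T)" "iu D = (0, u (fibre_chart \<C> x c' W'))"
    using R.coord_vector_tangent[OF D] R.coord_vector_self[OF D] unfolding c'(5) D_def[symmetric] by auto
  obtain A A' where a: "A' ** A = mat 1" "(transition c' c has_derivative (*v) A) (at (snd c' x))"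
    using affE[OF c'(1) c(1) c'(2) c(2)] by metis
  have T': "T \<in> fst (fibre_chart \<C> x c' W')" using c'(4) by (simp add: ref_chart_dom)
  have uK: "u (fibre_chart \<C> x c W) = transpose A' *v u (fibre_chart \<C> x c' W')"
    by (rule F.tangent_comp[OF u fibre_atlasI[OF c'(1-3)] fibre_atlasI[OF c W] T' T
        fibre_deriv[OF c'(1) c(1) c'(2) c(2) c'(3) W T' T a(2,1)]])
  have "dtheta \<C> c i (x, T) iu = (transpose A' *v u (fibre_chart \<C> x c' W')) $ i" for i
    using dtheta_eq[OF c(1) c'(1,3) _ c'(4) _ a(1) iu(1)] c(2) a(2) iu(2) by (simp add: D_def)
  then show ?thesis
    using u by (simp add: theta_form_def fibre_restrict_def pullback1_def iu_def[symmetric] uK inner_vec_def)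
qed

text \<open>
  The coefficients of \<open>d\<theta>\<^sup>i\<close> change by \<open>A\<close> like those of \<open>\<partial>/\<partial>a\<^sup>i\<close>, since \<open>\<theta>\<close> changes by the inverse transpose.
\<close>

lemma theta_form_change:
  assumes c: "c \<in> \<C>" "c' \<in> \<C>" "x \<in> fst c" "x \<in> fst c'"
    and A: "(transition c c' has_derivative (*v) A) (at (snd c x))"
  shows "theta_form c r x = theta_form c' (A *v r) x"
proof (intro ext)
  interpret F: affine_atlas "fibre_atlas \<C> x" by (rule fibre_affine_atlas)
  fix T u show "theta_form c r x T u = theta_form c' (A *v r) x T u"
  proof (cases "u \<in> tangent_space (fibre_atlas \<C> x) T")
    case True
    obtain A1 A' where a: "A' ** A1 = mat 1" "(transition c c' has_derivative (*v) A1) (at (snd c x))"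
      using affE[OF c] by metis
    have A1: "A1 = A" using has_derivative_unique[OF A a(2)] by (simp add: matrix_eq fun_eq_iff)
    have "T \<in> ref_fibre \<C> x"
      using F.tangent_iff[OF True] by (auto simp: fibre_atlas_def fibre_chart_def)
    then obtain W W' where W: "theta_window W" "T \<in> fst (fibre_chart \<C> x c W)"
      "theta_window W'" "T \<in> fst (fibre_chart \<C> x c' W')"
      using fibre_window c by metis
    have "u (fibre_chart \<C> x c' W') = transpose A' *v u (fibre_chart \<C> x c W)"
      by (rule F.tangent_comp[OF True fibre_atlasI[OF c(1,3) W(1)] fibre_atlasI[OF c(2,4) W(3)] W(2,4)
          fibre_deriv[OF c W(1,3,2,4) A]]) (use a A1 in simp)
    then show ?thesis
      using theta_form_eq[OF c(1,3) W(1,2) True] theta_form_eq[OF c(2,4) W(3,4) True]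
        inverse_transpose_inner[OF a(1)] by (simp add: A1 del: transpose_matrix_vector)
  qed (simp add: theta_form_outside)
qed

text \<open>
  In every chart of the fibre the coefficients are constant; hence the form is smooth and closed.
\<close>

lemma theta_form_closed:
  assumes c: "c \<in> \<C>" "x \<in> fst c"
  shows "theta_form c r x \<in> carrier (closed_form1s (fibre_atlas \<C> x))"
proof -
  interpret F: affine_atlas "fibre_atlas \<C> x" by (rule fibre_affine_atlas)
  have const: "\<exists>q. \<forall>T\<in>fst K. \<forall>u. theta_form c r x T (coord_vector (fibre_atlas \<C> x) K T u) = q \<bullet> u"
    if K: "K \<in> fibre_atlas \<C> x" for K
  proof -
    obtain c' W where c': "c' \<in> \<C>" "x \<in> fst c'" "theta_window W" "K = fibre_chart \<C> x c' W"
      using K by (auto simp: fibre_atlas_def)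
    obtain A where A: "(transition c c' has_derivative (*v) A) (at (snd c x))"
      using affE[OF c(1) c'(1) c(2) c'(2)] by metis
    have "theta_form c r x T (coord_vector (fibre_atlas \<C> x) K T u) = (A *v r) \<bullet> u" if T: "T \<in> fst K" for T u
      unfolding theta_form_change[OF c(1) c'(1) c(2) c'(2) A]
      using theta_form_eq[OF c'(1-3) _ F.coord_vector_tangent[OF K T]] F.coord_vector_self[OF K T] T
      unfolding c'(4) by simp
    then show ?thesis by blast
  qed
  have inv: "chart_inv K y \<in> fst K" if "y \<in> snd K ` fst K" for K :: "(('b, real^'n) covec set, real^'n) chart" and y
    using that unfolding chart_inv_def by (rule inv_into_into)
  have sm: "smooth_form1 (fibre_atlas \<C> x) (theta_form c r x)"
    unfolding smooth_form1_def
  proof (intro conjI allI ballI)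
    fix T show "theta_form c r x T \<in> cotangent_space (fibre_atlas \<C> x) T"
      unfolding cotangent_space_def
    proof (intro CollectI conjI allI impI ballI theta_form_outside)
      fix K assume K: "K \<in> fibre_atlas \<C> x" "T \<in> fst K"
      obtain q where "\<And>u. theta_form c r x T (coord_vector (fibre_atlas \<C> x) K T u) = q \<bullet> u"
        using const[OF K(1)] K(2) by blast
      then show "linear (\<lambda>u. theta_form c r x T (coord_vector (fibre_atlas \<C> x) K T u))"
        by (simp add: linear_iff inner_add_right)
    qed
  next
    fix K u assume K: "K \<in> fibre_atlas \<C> x"
    obtain q where q: "\<And>T u. T \<in> fst K \<Longrightarrow> theta_form c r x T (coord_vector (fibre_atlas \<C> x) K T u) = q \<bullet> u"
      using const[OF K] by blast
    show "smooth_on (snd K ` fst K) (\<lambda>y. theta_form c r x (chart_inv K y) (coord_vector (fibre_atlas \<C> x) K (chart_inv K y) u))"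
      by (rule smooth_on_cong[OF F.open_chart[OF K], of "\<lambda>_. q \<bullet> u"])
        (use q inv in \<open>auto simp: smooth_on_def Ck_on_const\<close>)
  qed
  have "ext_deriv (fibre_atlas \<C> x) (theta_form c r x) T v w = 0" for T v w
  proof (cases "v \<in> tangent_space (fibre_atlas \<C> x) T \<and> w \<in> tangent_space (fibre_atlas \<C> x) T")
    case True
    define K where "K = chart_at (fibre_atlas \<C> x) T"
    have K: "K \<in> fibre_atlas \<C> x" "T \<in> fst K"
      using F.tangent_iff F.chart_at True unfolding K_def by blast+
    obtain q where q: "\<And>T u. T \<in> fst K \<Longrightarrow> theta_form c r x T (coord_vector (fibre_atlas \<C> x) K T u) = q \<bullet> u"
      using const[OF K(1)] by blast
    have "frechet_derivative (\<lambda>y. theta_form c r x (chart_inv K y) (coord_vector (fibre_atlas \<C> x) K (chart_inv K y) u))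
        (at (snd K T)) = (\<lambda>_. 0)" for u
      using frechet_derivative_cong_open[OF F.open_chart[OF K(1)] imageI[OF K(2)], of "\<lambda>_. q \<bullet> u"
          "\<lambda>y. theta_form c r x (chart_inv K y) (coord_vector (fibre_atlas \<C> x) K (chart_inv K y) u)"]
        q[OF inv] by (simp add: frechet_derivative_const)
    then show ?thesis using True by (simp add: ext_deriv_def K_def[symmetric] Let_def)
  qed (auto simp: ext_deriv_def)
  then have "ext_deriv (fibre_atlas \<C> x) (theta_form c r x) = 0" by (intro ext) simp
  then show ?thesis using sm by (simp add: closed_form1s_def additive_group_def)
qed

lemma theta_form_add: "theta_form c r x + theta_form c s x = theta_form c (r + s) x"
  by (intro ext) (simp add: theta_form_def fibre_restrict_def pullback1_def sum.distrib algebra_simps)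

lemma theta_form_zero: "theta_form c 0 x = 0"
  by (intro ext) (simp add: theta_form_def fibre_restrict_def pullback1_def)

text \<open>
  If \<open>\<Sum>\<^sub>i r\<^sub>i d\<theta>\<^sup>i = df\<close> on the torus, lift \<open>f\<close> to a function \<open>g\<close> on \<open>\<real>\<^sup>n\<close>.  Then \<open>g t - r \<bullet> t\<close> has derivative \<open>0\<close>
  and is constant.  But \<open>g\<close> is periodic, so that its increment \<open>r\<^sub>i\<close> along the \<open>i\<close>-th unit vector is \<open>0\<close>.
\<close>

lemma theta_form_exact:
  assumes c: "c \<in> \<C>" "x \<in> fst c" and ex: "theta_form c r x \<in> exact_form1s (fibre_atlas \<C> x)"
  shows "r = 0"
proof -
  interpret F: affine_atlas "fibre_atlas \<C> x" by (rule fibre_affine_atlas)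
  obtain f where f: "smooth_function (fibre_atlas \<C> x) f" "theta_form c r x = differential (fibre_atlas \<C> x) f"
    using ex by (auto simp: exact_form1s_def)
  define g where "g = (\<lambda>t. f (pcoset x (covec_of \<C> c x t)))"
  have g: "(g has_derivative (\<lambda>w. r \<bullet> w)) (at t)" for t
  proof -
    define K where "K = fibre_chart \<C> x c (ball t (1/2))"
    define T where "T = pcoset x (covec_of \<C> c x t)"
    have K: "K \<in> fibre_atlas \<C> x" "T \<in> fst K" "snd K T = t"
      using fibre_atlasI[OF c theta_window_ball] fibre_chart_eval[OF c theta_window_ball, of t t t]
      by (auto simp: K_def T_def)
    have "frechet_derivative (f \<circ> chart_inv K) (at t) w = r \<bullet> w" for w
    proof -
      note tv = F.coord_vector_tangent[OF K(1,2), of w] and self = F.coord_vector_self[OF K(1,2), of w]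
      show ?thesis
        using F.differential_eq[OF f(1) K(1,2) tv] theta_form_eq[OF c theta_window_ball _ tv] K(2,3) self
        unfolding f(2)[symmetric] by (simp add: K_def)
    qed
    then have "((f \<circ> chart_inv K) has_derivative (\<lambda>w. r \<bullet> w)) (at t)"
      using F.smooth_function_differentiable[OF f(1) K(1,2)] K(3) frechet_derivative_works
      by (metis (no_types, lifting) ext)
    then show ?thesis
    proof (rule has_derivative_transform_within_open[of _ _ _ _ "ball t (1/2)"])
      fix s assume "s \<in> ball t (1/2)"
      then show "(f \<circ> chart_inv K) s = g s"
        using fibre_chart_inv[OF c theta_window_ball] by (simp add: g_def K_def)
    qed auto
  qed
  have "((\<lambda>t. g t - r \<bullet> t) has_derivative (\<lambda>_. 0)) (at t)" for t
    using has_derivative_diff[OF g[of t] has_derivative_inner_right[OF has_derivative_ident, of r]] by simp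
  then obtain d where d: "\<And>t. g t - r \<bullet> t = d"
    using has_derivative_zero_constant[of UNIV "\<lambda>t. g t - r \<bullet> t"] by auto
  show "r = 0"
  proof (rule vec_eq_iff[THEN iffD2], rule allI)
    fix i
    have "s $ j - axis i 1 $ j \<in> \<int> \<longleftrightarrow> s $ j - 0 $ j \<in> \<int>" for s :: "real^'n" and j
    proof -
      have "(axis i 1 :: real^'n) $ j \<in> \<int>" by (simp add: axis_def)
      then show ?thesis using Ints_add[of "s $ j - axis i 1 $ j" "axis i 1 $ j"] Ints_diff[of "s $ j" "axis i 1 $ j"] by auto
    qed
    then have "pcoset x (covec_of \<C> c x (axis i 1)) = pcoset x (covec_of \<C> c x 0)"
      unfolding pcoset_covec_of[OF c] by simp
    then have "g (axis i 1) = g 0" by (simp add: g_def)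
    then show "r $ i = 0 $ i" using d[of "axis i 1"] d[of 0] by (simp add: inner_axis)
  qed
qed

lemma theta_class_inj:
  assumes c: "c \<in> \<C>" "x \<in> fst c" and eq: "theta_class \<C> c r x = theta_class \<C> c s x"
  shows "r = s"
proof -
  interpret F: affine_atlas "fibre_atlas \<C> x" by (rule fibre_affine_atlas)
  have "theta_form c r x - theta_form c s x = theta_form c (r - s) x"
    using theta_form_add[of c "r - s" x s] by (simp add: algebra_simps)
  then have "theta_form c (r - s) x \<in> exact_form1s (fibre_atlas \<C> x)"
    using F.deRham_class_eqD eq unfolding theta_class_form by metis
  then show ?thesis using theta_form_exact[OF c] by fastforce
qed

end

section \<open>Continuation of charts and monodromy\<close>

lemma affine_map_eqD:
  fixes A A' :: "real^'n^'n"
  assumes "open M" "y \<in> M" "\<And>z. z \<in> M \<Longrightarrow> A *v z + d = A' *v z + d'"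
  shows "A = A'" "d = d'"
proof -
  have der: "((\<lambda>z. A *v z + d) has_derivative (*v) A) (at y)" for A :: "real^'n^'n" and d
    by (intro has_derivative_add_const linear_imp_has_derivative matrix_vector_mul_linear)
  have "((\<lambda>z. A' *v z + d') has_derivative (*v) A) (at y)"
    by (rule has_derivative_transform_within_open[OF der assms])
  from has_derivative_unique[OF this der] show A: "A = A'" by (simp add: matrix_eq fun_eq_iff)
  show "d = d'" using assms(3)[OF assms(2)] A by simp
qed

context integral_affine_mfd
begin

lemma open_chart_image:
  assumes "c \<in> \<C>" "openB N" "N \<subseteq> fst c" shows "open (snd c ` N)"
proof -
  have "openin (top_of_set (fst c)) N"
    using openin_subset_trans[OF assms(2,3)] chart_dom_B[OF assms(1)] by blast
  then show ?thesis
    using homeomorphism_imp_open_map[OF chart_homeomorphism[OF assms(1)]] open_chart[OF assms(1)] openin_open_trans by blast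
qed

text \<open>
  An affine map is determined by its values on a non-empty open set.  This is the identity theorem
  behind the uniqueness of continuation and of the holonomy.
\<close>

lemma chart_affine_eqD:
  fixes A A' :: "real^'n^'n"
  assumes "c \<in> \<C>" "openB N" "N \<subseteq> fst c" "x \<in> N" "\<And>y. y \<in> N \<Longrightarrow> A *v snd c y + d = A' *v snd c y + d'"
  shows "A = A'" "d = d'"
  using affine_map_eqD[OF open_chart_image[OF assms(1-3)] imageI[OF assms(4)], of A d A' d'] assms(5) by auto

lemma germ_refl: "c \<in> \<C> \<Longrightarrow> x \<in> fst c \<Longrightarrow> germ_eq B x c c"
  unfolding germ_eq_def using openB_chart by blast

lemma germ_sym: "germ_eq B x c c' \<Longrightarrow> germ_eq B x c' c"
  unfolding germ_eq_def by (metis inf_commute)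

lemma germ_trans: "germ_eq B x c c' \<Longrightarrow> germ_eq B x c' c'' \<Longrightarrow> germ_eq B x c c''"
proof -
  assume "germ_eq B x c c'" "germ_eq B x c' c''"
  then obtain N N' where "openB N" "x \<in> N" "N \<subseteq> fst c \<inter> fst c'" "\<forall>y\<in>N. snd c y = snd c' y"
    "openB N'" "x \<in> N'" "N' \<subseteq> fst c' \<inter> fst c''" "\<forall>y\<in>N'. snd c' y = snd c'' y"
    unfolding germ_eq_def by blast
  then show ?thesis unfolding germ_eq_def by (intro exI[of _ "N \<inter> N'"]) auto
qed

lemma germ_near: "germ_eq B x c c' \<Longrightarrow> \<exists>N. openB N \<and> x \<in> N \<and> (\<forall>y\<in>N. germ_eq B y c c')"
  unfolding germ_eq_def by blast

text \<open>
  On a set where the change of charts is a single affine map, the two charts have the same germ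
  either everywhere or nowhere.
\<close>

lemma germ_locally_constant:
  assumes "c \<in> \<C>" "c' \<in> \<C>" "x \<in> fst c" "x \<in> fst c'"
  obtains N where "openB N" "x \<in> N" "\<And>y z. y \<in> N \<Longrightarrow> z \<in> N \<Longrightarrow> germ_eq B y c c' \<Longrightarrow> germ_eq B z c c'"
proof -
  obtain A N d where A: "openB N" "x \<in> N" "N \<subseteq> fst c \<inter> fst c'"
    "\<And>y. y \<in> N \<Longrightarrow> snd c' y = A *v snd c y + d"
    using chart_change[OF assms] by metis
  show ?thesis
  proof (rule that[OF A(1,2)])
    fix y z assume y: "y \<in> N" and z: "z \<in> N" and g: "germ_eq B y c c'"
    obtain M where M: "openB M" "y \<in> M" "M \<subseteq> fst c \<inter> fst c'" "\<forall>w\<in>M. snd c w = snd c' w"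
      using g unfolding germ_eq_def by blast
    have MN: "openB (M \<inter> N)" "M \<inter> N \<subseteq> fst c" "y \<in> M \<inter> N" using M(1-3) A(1,3) y by auto
    have eq: "mat 1 *v snd c w + 0 = A *v snd c w + d" if w: "w \<in> M \<inter> N" for w
    proof -
      have "snd c w = snd c' w" using M(4) w by blast
      also have "\<dots> = A *v snd c w + d" using A(4) w by blast
      finally show ?thesis by simp
    qed
    have "snd c w = snd c' w" if "w \<in> N" for w
      using A(4)[OF that] chart_affine_eqD[OF assms(1) MN eq, symmetric] by simp
    then have "\<forall>w\<in>N. snd c w = snd c' w" by blast
    then show "germ_eq B z c c'" unfolding germ_eq_def using A(1,3) z by blast
  qed
qed

definition affine_image :: "real^'n^'n \<Rightarrow> real^'n \<Rightarrow> ('b, real^'n) chart \<Rightarrow> ('b, real^'n) chart" where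
  "affine_image A d c = (fst c, \<lambda>x. A *v snd c x + d)"

lemma affine_image_simps [simp]: "fst (affine_image A d c) = fst c" "snd (affine_image A d c) x = A *v snd c x + d"
  by (simp_all add: affine_image_def)

text \<open>
  The affine images of the charts of the maximal atlas are again charts of it.  They supply the
  charts in which a continuation goes on.
\<close>

lemma affine_image_chart:
  assumes A: "A \<in> GL_int" and c: "c \<in> \<C>"
  shows "affine_image A d c \<in> \<C>"
proof -
  obtain A' where A': "A' \<in> GL_int" "A ** A' = mat 1" "A' ** A = mat 1" using GL_intE[OF A] .
  have inv: "A' *v ((A *v y + d) - d) = y" "A *v (A' *v (z - d)) + d = z" for y z
    using A' by (simp_all add: matrix_vector_mul_assoc)
  let ?k = "affine_image A d c"
  note h = chart_homeomorphism[OF c]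
  have img: "snd ?k ` fst ?k = (\<lambda>z. A' *v (z - d)) -` (snd c ` fst c)"
  proof (intro equalityI subsetI)
    fix z assume "z \<in> (\<lambda>z. A' *v (z - d)) -` (snd c ` fst c)"
    then obtain x where "x \<in> fst c" "A' *v (z - d) = snd c x" by auto
    then have "snd ?k x = z" using inv(2)[of z] by simp
    then show "z \<in> snd ?k ` fst ?k" using \<open>x \<in> fst c\<close> by force
  qed (use inv(1) in auto)
  have cA': "continuous_on S (\<lambda>z. A' *v (z - d))" for S
    by (intro continuous_intros matrix_vector_mult_linear_continuous_on
        continuous_on_compose2[of UNIV "(*v) A'" S "\<lambda>z. z - d"]) auto
  have "homeomorphism (fst ?k) (snd ?k ` fst ?k) (snd ?k) (\<lambda>z. chart_inv c (A' *v (z - d)))"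
    unfolding homeomorphism_def
  proof (intro conjI ballI)
    show "continuous_on (fst ?k) (snd ?k)"
      using homeomorphism_cont1[OF h] unfolding affine_image_def fst_conv snd_conv
      by (intro continuous_intros continuous_on_compose2[of UNIV "(*v) A" "fst c" "snd c"] matrix_vector_mult_linear_continuous_on) auto
    show "continuous_on (snd ?k ` fst ?k) (\<lambda>z. chart_inv c (A' *v (z - d)))"
      by (rule continuous_on_compose2[OF homeomorphism_cont2[OF h] cA']) (use img in auto)
    show "(\<lambda>z. chart_inv c (A' *v (z - d))) ` (snd ?k ` fst ?k) = fst ?k"
      using c by (simp add: image_image inv(1)[simplified])
    show "chart_inv c (A' *v (snd ?k x - d)) = x" if "x \<in> fst ?k" for x
      using that c inv(1)[of "snd c x"] by simp
    show "snd ?k (chart_inv c (A' *v (z - d))) = z" if "z \<in> snd ?k ` fst ?k" for z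
      using that c inv(1) by auto
  qed (rule refl)
  moreover have "open (snd ?k ` fst ?k)"
    unfolding img by (rule open_vimage[OF open_chart[OF c] cA'])
  ultimately have "top_chart B ?k" using openB_chart[OF c] unfolding top_chart_def by auto
  moreover have "int_affine_compatible ?k c'" if c': "c' \<in> \<A>" for c'
    unfolding int_affine_compatible_def
  proof
    fix K assume "K \<in> components (fst ?k \<inter> fst c')"
    then have "K \<in> components (fst c \<inter> fst c')" by simp
    moreover have "int_affine_compatible c c'" using c c' charts by (simp add: int_affine_charts_def)
    ultimately obtain C e where C: "C \<in> GL_int" "\<forall>x\<in>K. snd c' x = C *v snd c x + e"
      unfolding int_affine_compatible_def by blast
    have aff: "C *v y + e = (C ** A') *v (A *v y + d) + (e - C *v (A' *v d))" for y
    proof -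
      have "A' *v (A *v y + d) = y + A' *v d"
        using A' by (simp add: matrix_vector_right_distrib matrix_vector_mul_assoc)
      then have "(C ** A') *v (A *v y + d) = C *v y + C *v (A' *v d)"
        unfolding matrix_vector_mul_assoc[symmetric] by (simp only: matrix_vector_right_distrib)
      then show ?thesis by simp
    qed
    have "\<forall>x\<in>K. snd c' x = (C ** A') *v snd ?k x + (e - C *v (A' *v d))"
    proof
      fix x assume "x \<in> K"
      then have "snd c' x = C *v snd c x + e" using C(2) by blast
      also note aff
      finally show "snd c' x = (C ** A') *v snd ?k x + (e - C *v (A' *v d))" unfolding affine_image_simps .
    qed
    then show "\<exists>A\<in>GL_int. \<exists>d. \<forall>x\<in>K. snd c' x = A *v snd ?k x + d"
      using GL_int_mult[OF C(1) A'(1)] by blast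
  qed
  ultimately show ?thesis using charts by (simp add: int_affine_charts_def)
qed

lemma affine_image_germ: "germ_eq B x c c' \<Longrightarrow> germ_eq B x (affine_image A d c) (affine_image A d c')"
  unfolding germ_eq_def by auto

lemma germ_match:
  assumes "c \<in> \<C>" "c' \<in> \<C>" "x \<in> fst c" "x \<in> fst c'"
  obtains A d where "A \<in> GL_int" "germ_eq B x c' (affine_image A d c)"
proof -
  obtain A d N where A: "A \<in> GL_int" "openB N" "x \<in> N" "N \<subseteq> fst c \<inter> fst c'"
    "\<And>y. y \<in> N \<Longrightarrow> snd c' y = A *v snd c y + d"
    using chart_change[OF assms] by metis
  then have "germ_eq B x c' (affine_image A d c)" unfolding germ_eq_def by auto
  then show ?thesis using that A(1) by blast
qed

text \<open>
  Continuation over an arbitrary set of parameters and without initial condition, as needed for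
  restricting, gluing and reparametrizing continuations.
\<close>

definition continues_on :: "real set \<Rightarrow> (real \<Rightarrow> 'b) \<Rightarrow> (real \<Rightarrow> ('b, real^'n) chart) \<Rightarrow> bool" where
  "continues_on J g F \<longleftrightarrow> (\<forall>t\<in>J. F t \<in> \<C> \<and> g t \<in> fst (F t)) \<and>
     (\<forall>t\<in>J. \<exists>e>0. \<forall>s\<in>J. \<bar>s - t\<bar> < e \<longrightarrow> germ_eq B (g s) (F t) (F s))"

lemma continuation_iff: "continuation B \<C> g c F \<longleftrightarrow> continues_on {0..1} g F \<and> germ_eq B (g 0) c (F 0)"
  unfolding continuation_def continues_on_def by blast

lemma continues_on_subset: "continues_on J g F \<Longrightarrow> J' \<subseteq> J \<Longrightarrow> continues_on J' g F"
  unfolding continues_on_def by (meson subsetD)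

lemma continues_on_cong: "continues_on J g F \<Longrightarrow> (\<And>t. t \<in> J \<Longrightarrow> g t = g' t) \<Longrightarrow> continues_on J g' F"
  unfolding continues_on_def by simp

lemma continues_on_const: "c \<in> \<C> \<Longrightarrow> g ` J \<subseteq> fst c \<Longrightarrow> continues_on J g (\<lambda>_. c)"
  unfolding continues_on_def using germ_refl zero_less_one by (meson image_subset_iff)

lemma continues_on_affine: "continues_on J g F \<Longrightarrow> A \<in> GL_int \<Longrightarrow> continues_on J g (\<lambda>t. affine_image A d (F t))"
  unfolding continues_on_def using affine_image_chart affine_image_germ by (metis affine_image_simps(1))

lemma continues_on_reparam:
  assumes F: "continues_on J g F" and f: "continuous_on J' f" "f ` J' \<subseteq> J"
  shows "continues_on J' (\<lambda>t. g (f t)) (\<lambda>t. F (f t))"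
  unfolding continues_on_def
proof (intro conjI ballI)
  fix t assume t: "t \<in> J'"
  then have ft: "f t \<in> J" using f(2) by blast
  then obtain e where e: "e > 0" "\<forall>s\<in>J. \<bar>s - f t\<bar> < e \<longrightarrow> germ_eq B (g s) (F (f t)) (F s)"
    using F unfolding continues_on_def by blast
  obtain d where "d > 0" "\<forall>s\<in>J'. dist s t < d \<longrightarrow> dist (f s) (f t) < e"
    using f(1) t e(1) unfolding continuous_on_iff by blast
  then show "\<exists>d>0. \<forall>s\<in>J'. \<bar>s - t\<bar> < d \<longrightarrow> germ_eq B (g (f s)) (F (f t)) (F (f s))"
    using e(2) f(2) unfolding dist_real_def by blast
qed (use F f(2) in \<open>auto simp: continues_on_def\<close>)

lemma stays_near:
  assumes "continuous_on J g" "g ` J \<subseteq> B" "openB N" "(t::'a::metric_space) \<in> J" "g t \<in> N"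
  obtains e where "e > 0" "\<And>s. s \<in> J \<Longrightarrow> dist s t < e \<Longrightarrow> g s \<in> N"
proof -
  have "openin (top_of_set J) (J \<inter> g -` N)"
    using assms by (intro continuous_openin_preimage[of _ _ B]) auto
  then have "\<exists>e>0. \<forall>s\<in>J. dist s t < e \<longrightarrow> s \<in> J \<inter> g -` N"
    using assms(4,5) unfolding openin_euclidean_subtopology_iff by blast
  then show ?thesis using that by blast
qed

lemma germ_stays_near:
  assumes "continuous_on J g" "g ` J \<subseteq> B" "(t::'a::metric_space) \<in> J" "germ_eq B (g t) c c'"
  obtains e where "e > 0" "\<And>s. s \<in> J \<Longrightarrow> dist s t < e \<Longrightarrow> germ_eq B (g s) c c'"
proof -
  obtain N where "openB N" "g t \<in> N" "\<forall>y\<in>N. germ_eq B y c c'" using germ_near[OF assms(4)] by blast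
  then show ?thesis using stays_near[OF assms(1,2) _ assms(3)] that by metis
qed

text \<open>
  The set of parameters at which two continuations have the same germ is open and closed.
\<close>

lemma continues_on_unique:
  assumes J: "connected J" "continuous_on J g" "g ` J \<subseteq> B" and F: "continues_on J g F" "continues_on J g F'"
    and ab: "a \<in> J" "b \<in> J" "germ_eq B (g a) (F a) (F' a)"
  shows "germ_eq B (g b) (F b) (F' b)"
proof (rule connected_induction_simple[where P = "\<lambda>t. germ_eq B (g t) (F t) (F' t)", OF J(1) ab])
  fix t assume t: "t \<in> J"
  have C: "F t \<in> \<C>" "F' t \<in> \<C>" "g t \<in> fst (F t)" "g t \<in> fst (F' t)" using F t unfolding continues_on_def by auto
  obtain N where N: "openB N" "g t \<in> N"
    "\<And>y z. y \<in> N \<Longrightarrow> z \<in> N \<Longrightarrow> germ_eq B y (F t) (F' t) \<Longrightarrow> germ_eq B z (F t) (F' t)"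
    using germ_locally_constant[OF C] by blast
  obtain e1 where e1: "e1 > 0" "\<And>s. s \<in> J \<Longrightarrow> dist s t < e1 \<Longrightarrow> g s \<in> N"
    using stays_near[OF J(2,3) N(1) t N(2)] by blast
  obtain e2 where e2: "e2 > 0" "\<forall>s\<in>J. \<bar>s - t\<bar> < e2 \<longrightarrow> germ_eq B (g s) (F t) (F s)"
    using F(1) t unfolding continues_on_def by blast
  obtain e3 where e3: "e3 > 0" "\<forall>s\<in>J. \<bar>s - t\<bar> < e3 \<longrightarrow> germ_eq B (g s) (F' t) (F' s)"
    using F(2) t unfolding continues_on_def by blast
  define e where "e = min e1 (min e2 e3)"
  have *: "germ_eq B (g s) (F s) (F' s) \<longleftrightarrow> germ_eq B (g s) (F t) (F' t)" if "s \<in> J" "dist s t < e" for s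
    using that e2(2) e3(2) germ_trans germ_sym unfolding e_def dist_real_def by (metis min_less_iff_conj)
  show "\<exists>T. openin (top_of_set J) T \<and> t \<in> T \<and>
      (\<forall>x\<in>T. \<forall>y\<in>T. germ_eq B (g x) (F x) (F' x) \<longrightarrow> germ_eq B (g y) (F y) (F' y))"
  proof (intro exI conjI ballI impI)
    show "openin (top_of_set J) (J \<inter> ball t e)" by blast
    show "t \<in> J \<inter> ball t e" using t e1 e2 e3 by (simp add: e_def)
    fix x y assume "x \<in> J \<inter> ball t e" "y \<in> J \<inter> ball t e" and g: "germ_eq B (g x) (F x) (F' x)"
    then have xy: "x \<in> J" "dist x t < e" "y \<in> J" "dist y t < e" by (auto simp: dist_commute)
    have "g x \<in> N" "g y \<in> N" using xy e1(2) by (auto simp: e_def)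
    then show "germ_eq B (g y) (F y) (F' y)" using *[OF xy(1,2)] *[OF xy(3,4)] g N(3) by blast
  qed
qed

text \<open>
  Only the parameter \<open>m\<close> needs an argument: to its right, the germ of \<open>F m\<close> agrees with that of \<open>F' m\<close> by
  continuity of \<open>g\<close>, and the latter agrees with \<open>F'\<close>.
\<close>

lemma continues_on_glue:
  assumes g: "continuous_on {a..b} g" "g ` {a..b} \<subseteq> B" and m: "a \<le> m" "m \<le> b"
    and F: "continues_on {a..m} g F" and F': "continues_on {m..b} g F'" and germ: "germ_eq B (g m) (F m) (F' m)"
  shows "continues_on {a..b} g (\<lambda>t. if t \<le> m then F t else F' t)" (is "continues_on _ _ ?H")
  unfolding continues_on_def
proof (intro conjI ballI)
  fix t assume t: "t \<in> {a..b}"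
  show "?H t \<in> \<C>" "g t \<in> fst (?H t)" using F F' t unfolding continues_on_def by auto
  consider "t < m" | "t = m" | "t > m" by linarith
  then show "\<exists>e>0. \<forall>s\<in>{a..b}. \<bar>s - t\<bar> < e \<longrightarrow> germ_eq B (g s) (?H t) (?H s)"
  proof cases
    case 1
    then have "t \<in> {a..m}" using t by auto
    then obtain e where "e > 0" "\<forall>s\<in>{a..m}. \<bar>s - t\<bar> < e \<longrightarrow> germ_eq B (g s) (F t) (F s)"
      using F unfolding continues_on_def by blast
    then show ?thesis using 1 by (intro exI[of _ "min e (m - t)"]) auto
  next
    case 2
    have "m \<in> {a..m}" "m \<in> {m..b}" "m \<in> {a..b}" using m by auto
    then obtain e e' where e: "e > 0" "\<forall>s\<in>{a..m}. \<bar>s - m\<bar> < e \<longrightarrow> germ_eq B (g s) (F m) (F s)"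
      "e' > 0" "\<forall>s\<in>{m..b}. \<bar>s - m\<bar> < e' \<longrightarrow> germ_eq B (g s) (F' m) (F' s)"
      using F F' unfolding continues_on_def by blast
    obtain e'' where e'': "e'' > 0" "\<And>s. s \<in> {a..b} \<Longrightarrow> dist s m < e'' \<Longrightarrow> germ_eq B (g s) (F m) (F' m)"
      using germ_stays_near[OF g \<open>m \<in> {a..b}\<close> germ] by blast
    have "germ_eq B (g s) (F m) (?H s)" if s: "s \<in> {a..b}" "\<bar>s - m\<bar> < min e (min e' e'')" for s
    proof (cases "s \<le> m")
      case True then show ?thesis using s e(2) by auto
    next
      case False
      then have "germ_eq B (g s) (F' m) (F' s)" using s e(4) by auto
      moreover have "germ_eq B (g s) (F m) (F' m)" using e''(2)[OF s(1)] s(2) by (simp add: dist_real_def)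
      ultimately show ?thesis using False germ_trans by simp blast
    qed
    then show ?thesis using 2 e(1,3) e''(1) by (intro exI[of _ "min e (min e' e'')"]) auto
  next
    case 3
    then have "t \<in> {m..b}" using t by auto
    then obtain e where "e > 0" "\<forall>s\<in>{m..b}. \<bar>s - t\<bar> < e \<longrightarrow> germ_eq B (g s) (F' t) (F' s)"
      using F' unfolding continues_on_def by blast
    then show ?thesis using 3 by (intro exI[of _ "min e (t - m)"]) auto
  qed
qed

text \<open>
  The set of \<open>t\<close> such that \<open>c\<close> can be continued up to \<open>t\<close> is open and closed: while \<open>g\<close> stays in the domain
  of a chart \<open>k\<close>, a continuation is prolonged by the affine image of \<open>k\<close> that matches its last germ.
\<close>

lemma continuation_exists:
  assumes g: "path g" "path_image g \<subseteq> B" and c: "c \<in> \<C>" "g 0 \<in> fst c"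
  obtains F where "continuation B \<C> g c F"
proof -
  have g': "continuous_on {0..1} g" "g ` {0..1} \<subseteq> B" using g by (auto simp: path_def path_image_def)
  have "\<exists>F. continues_on {0..1} g F \<and> germ_eq B (g 0) c (F 0)"
  proof (rule connected_induction_simple[of "{0..1}" 0 1 "\<lambda>t. \<exists>F. continues_on {0..t} g F \<and> germ_eq B (g 0) c (F 0)"])
    have "continues_on {0..0} g (\<lambda>_. c)" using c by (intro continues_on_const) auto
    then show "\<exists>F. continues_on {0..0} g F \<and> germ_eq B (g 0) c (F 0)" using germ_refl[OF c] by blast
    fix t :: real assume t: "t \<in> {0..1}"
    then have "g t \<in> B" using g'(2) by blast
    then obtain k where k: "k \<in> \<C>" "g t \<in> fst k" using chart_around by blast
    obtain e where e: "e > 0" "\<And>s. s \<in> {0..1} \<Longrightarrow> dist s t < e \<Longrightarrow> g s \<in> fst k"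
      using stays_near[OF g' openB_chart[OF k(1)] t k(2)] by blast
    show "\<exists>T. openin (top_of_set {0..1}) T \<and> t \<in> T \<and>
      (\<forall>x\<in>T. \<forall>y\<in>T. (\<exists>F. continues_on {0..x} g F \<and> germ_eq B (g 0) c (F 0)) \<longrightarrow>
        (\<exists>F. continues_on {0..y} g F \<and> germ_eq B (g 0) c (F 0)))"
    proof (intro exI[of _ "{0..1} \<inter> ball t e"] conjI ballI impI)
      fix x y assume xy: "x \<in> {0..1} \<inter> ball t e" "y \<in> {0..1} \<inter> ball t e"
      assume "\<exists>F. continues_on {0..x} g F \<and> germ_eq B (g 0) c (F 0)"
      then obtain F where F: "continues_on {0..x} g F" "germ_eq B (g 0) c (F 0)" by blast
      show "\<exists>F. continues_on {0..y} g F \<and> germ_eq B (g 0) c (F 0)"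
      proof (cases "y \<le> x")
        case True
        then show ?thesis using F continues_on_subset[OF F(1), of "{0..y}"] by auto
      next
        case False
        have x: "F x \<in> \<C>" "g x \<in> fst (F x)" using F(1) xy(1) unfolding continues_on_def by auto
        have gk: "g s \<in> fst k" if "s \<in> {x..y}" for s
          using that xy by (intro e(2)) (auto simp: dist_real_def)
        then have "g x \<in> fst k" using False by simp
        then obtain A d where A: "A \<in> GL_int" "germ_eq B (g x) (F x) (affine_image A d k)"
          using germ_match[OF k(1) x(1) _ x(2)] by blast
        have "continues_on {x..y} g (\<lambda>_. affine_image A d k)"
          using gk by (intro continues_on_const affine_image_chart A k(1)) auto
        then have "continues_on {0..y} g (\<lambda>t. if t \<le> x then F t else affine_image A d k)"
          using xy False by (intro continues_on_glue[OF continuous_on_subset[OF g'(1)] _ _ _ F(1) _ A(2)] order_trans[OF image_mono g'(2)]) auto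
        moreover have "0 \<le> x" using xy by simp
        ultimately show ?thesis using F(2) by (intro exI[of _ "\<lambda>t. if t \<le> x then F t else affine_image A d k"]) simp
      qed
    qed (use t e(1) in auto)
  qed auto
  then show ?thesis using that continuation_iff by blast
qed

lemma continuation_unique:
  assumes g: "path g" "path_image g \<subseteq> B" and F: "continuation B \<C> g c F" "continuation B \<C> g c F'" and t: "t \<in> {0..1}"
  shows "germ_eq B (g t) (F t) (F' t)"
proof (rule continues_on_unique[of "{0..1}" g F F' 0 t])
  show "germ_eq B (g 0) (F 0) (F' 0)" using F germ_trans germ_sym unfolding continuation_iff by blast
qed (use g F t in \<open>auto simp: continuation_iff path_def path_image_def\<close>)

lemma continuation_join:
  assumes g: "path (g +++ h)" "path_image (g +++ h) \<subseteq> B" "pathfinish g = pathstart h"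
    and F: "continuation B \<C> g c F" and F': "continues_on {0..1} h F'" and germ: "germ_eq B (h 0) (F 1) (F' 0)"
  shows "continuation B \<C> (g +++ h) c (\<lambda>t. if t \<le> 1/2 then F (2 * t) else F' (2 * t - 1))"
  unfolding continuation_iff
proof
  have h0: "h 0 = g 1" using g(3) by (simp add: pathfinish_def pathstart_def)
  have 1: "continues_on {0..1/2} (g +++ h) (\<lambda>t. F (2 * t))"
    by (rule continues_on_cong[OF continues_on_reparam[of "{0..1}" g F "{0..1/2}" "\<lambda>t. 2 * t"]])
      (use F in \<open>auto simp: continuation_iff joinpaths_def intro!: continuous_intros\<close>)
  have gh: "h (2 * t - 1) = (g +++ h) t" if "t \<in> {1/2..1}" for t
  proof (cases "t \<le> 1/2")
    case True
    then have "2 * t = 1" using that by simp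
    then show ?thesis using True h0 by (simp only: joinpaths_def if_True diff_self)
  qed (simp add: joinpaths_def)
  have 2: "continues_on {1/2..1} (g +++ h) (\<lambda>t. F' (2 * t - 1))"
    by (rule continues_on_cong[OF continues_on_reparam[of "{0..1}" h F' "{1/2..1}" "\<lambda>t. 2 * t - 1"]])
      (use F' gh in \<open>auto intro!: continuous_intros\<close>)
  show "continues_on {0..1} (g +++ h) (\<lambda>t. if t \<le> 1/2 then F (2 * t) else F' (2 * t - 1))"
    by (rule continues_on_glue[OF _ _ _ _ 1 2]) (use g(1,2) germ h0 in \<open>auto simp: path_def path_image_def joinpaths_def\<close>)
  show "germ_eq B ((g +++ h) 0) c (if 0 \<le> (1/2::real) then F (2 * 0) else F' (2 * 0 - 1))"
    using F by (simp add: continuation_iff joinpaths_def)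
qed

text \<open>
  Let \<open>G s\<close> continue \<open>c\<close> along the path \<open>g s\<close> of the homotopy.  For every \<open>t\<close>, the germs of \<open>G s t\<close> and
  \<open>G s0 t\<close> agree if \<open>s\<close> is close to \<open>s0\<close>, by induction along \<open>t\<close> (\<open>near\<close>): on a short interval around \<open>t0\<close>, both \<open>G s0\<close> and
  all nearby \<open>G s\<close> are compared with the constant continuation by the chart \<open>G s0 t0\<close>, whose domain
  contains the whole patch of the homotopy.  So the final germ does not depend on \<open>s\<close>.
\<close>

lemma monodromy:
  assumes h: "homotopic_paths B p q" and c: "c \<in> \<C>" "p 0 \<in> fst c"
    and F: "continuation B \<C> p c F" "continuation B \<C> q c F'"
  shows "germ_eq B (p 1) (F 1) (F' 1)"
proof -
  obtain h :: "real \<times> real \<Rightarrow> 'b" where h': "continuous_on ({0..1} \<times> {0..1}) h" "h \<in> {0..1} \<times> {0..1} \<rightarrow> B"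
    "\<forall>t\<in>{0..1}. h (0, t) = p t" "\<forall>t\<in>{0..1}. h (1, t) = q t" "\<forall>s\<in>{0..1}. h (s, 0) = p 0 \<and> h (s, 1) = p 1"
    using h unfolding homotopic_paths pathstart_def pathfinish_def o_def by blast
  have h: "continuous_on ({0..1} \<times> {0..1}) h" "h ` ({0..1} \<times> {0..1}) \<subseteq> B"
    "\<And>t. t \<in> {0..1} \<Longrightarrow> h (0, t) = p t" "\<And>t. t \<in> {0..1} \<Longrightarrow> h (1, t) = q t"
    "\<And>s. s \<in> {0..1} \<Longrightarrow> h (s, 0) = p 0" "\<And>s. s \<in> {0..1} \<Longrightarrow> h (s, 1) = p 1"
    using h' by (simp_all add: image_subset_iff_funcset)
  define g where "g = (\<lambda>s t. h (s, t))"
  have gc: "continuous_on {0..1} (g s)" "g s ` {0..1} \<subseteq> B" if s: "s \<in> {0..1}" for s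
  proof -
    have "continuous_on {0..1} (\<lambda>t. (s, t))" by (intro continuous_intros)
    from continuous_on_compose2[OF h(1) this] show "continuous_on {0..1} (g s)" using s by (simp add: g_def image_subset_iff)
    show "g s ` {0..1} \<subseteq> B" unfolding g_def using s h(2) by blast
  qed
  have gc': "continuous_on {0..1} (\<lambda>s. g s t)" "(\<lambda>s. g s t) ` {0..1} \<subseteq> B" if t: "t \<in> {0..1}" for t
  proof -
    have "continuous_on {0..1} (\<lambda>s. (s, t))" by (intro continuous_intros)
    from continuous_on_compose2[OF h(1) this] show "continuous_on {0..1} (\<lambda>s. g s t)" using t by (simp add: g_def image_subset_iff)
    show "(\<lambda>s. g s t) ` {0..1} \<subseteq> B" unfolding g_def using t h(2) by blast
  qed
  have "\<exists>G. continuation B \<C> (g s) c G" if s: "s \<in> {0..1}" for s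
  proof -
    have "path (g s)" "path_image (g s) \<subseteq> B" "g s 0 \<in> fst c"
      using gc[OF s] c(2) h(5)[OF s] by (simp_all add: path_def path_image_def g_def)
    then obtain G where "continuation B \<C> (g s) c G" using continuation_exists[OF _ _ c(1)] by blast
    then show ?thesis by blast
  qed
  then obtain G where G: "\<And>s. s \<in> {0..1} \<Longrightarrow> continuation B \<C> (g s) c (G s)" by metis
  have near: "\<exists>d>0. \<forall>s\<in>{0..1}. dist s s0 < d \<longrightarrow> germ_eq B (g s 1) (G s0 1) (G s 1)" if s0: "s0 \<in> {0..1}" for s0
  proof (rule connected_induction_simple[of "{0..1}" 0 1 "\<lambda>t. \<exists>d>0. \<forall>s\<in>{0..1}. dist s s0 < d \<longrightarrow> germ_eq B (g s t) (G s0 t) (G s t)"])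
    have "germ_eq B (g s 0) (G s0 0) (G s 0)" if "s \<in> {0..1}" for s
      using G[OF that] G[OF s0] germ_sym germ_trans h(5)[OF that] h(5)[OF s0] unfolding continuation_iff g_def by metis
    then show "\<exists>d>0. \<forall>s\<in>{0..1}. dist s s0 < d \<longrightarrow> germ_eq B (g s 0) (G s0 0) (G s 0)" using zero_less_one by blast
    fix t0 :: real assume t0: "t0 \<in> {0..1}"
    define k where "k = G s0 t0"
    have k: "k \<in> \<C>" "h (s0, t0) \<in> fst k"
      using G[OF s0] t0 unfolding continuation_iff continues_on_def k_def g_def by auto
    obtain e1 where e1: "e1 > 0" "\<And>z. z \<in> {0..1} \<times> {0..1} \<Longrightarrow> dist z (s0, t0) < e1 \<Longrightarrow> h z \<in> fst k"
      using stays_near[OF h(1,2) openB_chart[OF k(1)] _ k(2)] s0 t0 by blast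
    obtain e2 where e2: "e2 > 0" "\<forall>t\<in>{0..1}. \<bar>t - t0\<bar> < e2 \<longrightarrow> germ_eq B (g s0 t) k (G s0 t)"
      using G[OF s0] t0 unfolding continuation_iff continues_on_def k_def by blast
    define T where "T = {0..1} \<inter> ball t0 (min (e1/2) e2)"
    have T: "T \<subseteq> {0..1}" "connected T" "t0 \<in> T" "openin (top_of_set {0..1}) T"
      using t0 e1(1) e2(1) by (auto simp: T_def intro!: convex_connected convex_Int)
    \<comment> \<open>How close \<open>s\<close> must be to \<open>s0\<close> depends on \<open>t\<close>; only the two ends of a short interval are used.\<close>
    have kG: "\<exists>d>0. \<forall>s\<in>{0..1}. dist s s0 < d \<longrightarrow> germ_eq B (g s t) k (G s0 t)" if t: "t \<in> T" for t
    proof -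
      have "germ_eq B (g s0 t) k (G s0 t)" "t \<in> {0..1}"
        using t e2(2) by (auto simp: T_def dist_real_def abs_minus_commute)
      then show ?thesis using germ_stays_near[OF gc'[of t] s0] by metis
    qed
    have step: "germ_eq B (g s y) k (G s y)"
      if s: "s \<in> {0..1}" "dist s s0 < e1/2" and xy: "x \<in> T" "y \<in> T" and g: "germ_eq B (g s x) k (G s x)" for s x y
    proof (rule continues_on_unique[where J = T and g = "g s" and F = "\<lambda>_. k" and F' = "G s" and a = x and b = y])
      show "connected T" "x \<in> T" "y \<in> T" "germ_eq B (g s x) k (G s x)" using T(2) xy g by blast+
      show "continuous_on T (g s)" "g s ` T \<subseteq> B" using gc[OF s(1)] T(1) continuous_on_subset by blast+
      show "continues_on T (g s) (G s)"
        using G[OF s(1)] continues_on_subset[OF _ T(1)] unfolding continuation_iff by blast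
      show "continues_on T (g s) (\<lambda>_. k)"
      proof (rule continues_on_const[OF k(1)], rule subsetI)
        fix z assume "z \<in> g s ` T"
        then obtain t where t: "t \<in> T" "z = h (s, t)" by (auto simp: g_def)
        have "dist t0 t < e1/2" using t(1) by (simp add: T_def)
        then have "dist (s, t) (s0, t0) < e1"
          using s(2) sqrt_sum_squares_le_sum_abs[of "dist s s0" "dist t t0"] by (simp add: dist_Pair_Pair dist_commute)
        then show "z \<in> fst k" using e1(2)[of "(s, t)"] s(1) t T(1) by auto
      qed
    qed
    show "\<exists>T. openin (top_of_set {0..1}) T \<and> t0 \<in> T \<and> (\<forall>x\<in>T. \<forall>y\<in>T.
        (\<exists>d>0. \<forall>s\<in>{0..1}. dist s s0 < d \<longrightarrow> germ_eq B (g s x) (G s0 x) (G s x)) \<longrightarrow>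
        (\<exists>d>0. \<forall>s\<in>{0..1}. dist s s0 < d \<longrightarrow> germ_eq B (g s y) (G s0 y) (G s y)))"
    proof (intro exI[of _ T] conjI ballI impI T)
      fix x y assume xy: "x \<in> T" "y \<in> T"
        and "\<exists>d>0. \<forall>s\<in>{0..1}. dist s s0 < d \<longrightarrow> germ_eq B (g s x) (G s0 x) (G s x)"
      then obtain d where d: "d > 0" "\<And>s. s \<in> {0..1} \<Longrightarrow> dist s s0 < d \<Longrightarrow> germ_eq B (g s x) (G s0 x) (G s x)" by blast
      obtain d1 where d1: "d1 > 0" "\<And>s. s \<in> {0..1} \<Longrightarrow> dist s s0 < d1 \<Longrightarrow> germ_eq B (g s x) k (G s0 x)" using kG[OF xy(1)] by blast
      obtain d2 where d2: "d2 > 0" "\<And>s. s \<in> {0..1} \<Longrightarrow> dist s s0 < d2 \<Longrightarrow> germ_eq B (g s y) k (G s0 y)" using kG[OF xy(2)] by blast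
      define e where "e = min (min d d1) (min d2 (e1/2))"
      have "germ_eq B (g s y) (G s0 y) (G s y)" if s: "s \<in> {0..1}" "dist s s0 < e" for s
      proof -
        have "germ_eq B (g s x) k (G s x)" using germ_trans[OF d1(2) d(2)] s by (simp add: e_def)
        then have "germ_eq B (g s y) k (G s y)" using step[OF s(1) _ xy] s(2) by (simp add: e_def)
        moreover have "germ_eq B (g s y) k (G s0 y)" using d2(2) s by (simp add: e_def)
        ultimately show ?thesis using germ_sym germ_trans by blast
      qed
      moreover have "e > 0" using d(1) d1(1) d2(1) e1(1) by (simp add: e_def)
      ultimately show "\<exists>d>0. \<forall>s\<in>{0..1}. dist s s0 < d \<longrightarrow> germ_eq B (g s y) (G s0 y) (G s y)" by blast
    qed
  qed auto
  have "germ_eq B (p 1) (G 0 1) (G 1 1)"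
  proof (rule connected_equivalence_relation[of "{0..1}" 0 1 "\<lambda>s s'. germ_eq B (p 1) (G s 1) (G s' 1)"])
    fix s0 :: real assume s0: "s0 \<in> {0..1}"
    obtain d where d: "d > 0" "\<And>s. s \<in> {0..1} \<Longrightarrow> dist s s0 < d \<Longrightarrow> germ_eq B (g s 1) (G s0 1) (G s 1)"
      using near[OF s0] by blast
    show "\<exists>T. openin (top_of_set {0..1}) T \<and> s0 \<in> T \<and> (\<forall>s\<in>T. germ_eq B (p 1) (G s0 1) (G s 1))"
    proof (intro exI[of _ "{0..1} \<inter> ball s0 d"] conjI ballI)
      fix s assume s: "s \<in> {0..1} \<inter> ball s0 d"
      then show "germ_eq B (p 1) (G s0 1) (G s 1)"
        using d(2)[of s] h(6)[of s] by (simp add: g_def dist_commute)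
    qed (use s0 d(1) in auto)
  qed (auto intro: germ_sym germ_trans)
  moreover have "germ_eq B (p 1) (F 1) (G 0 1)"
  proof -
    have "continuation B \<C> p c (G 0)"
      using G[of 0] h(3) continues_on_cong[of "{0..1}" "g 0" "G 0" p] by (simp add: continuation_iff g_def)
    then show ?thesis using continuation_unique[OF _ _ F(1), of "G 0" 1] homotopic_paths_imp_path[OF assms(1)] homotopic_paths_imp_subset[OF assms(1)] by simp
  qed
  moreover have "germ_eq B (p 1) (F' 1) (G 1 1)"
  proof -
    have "continuation B \<C> q c (G 1)"
      using G[of 1] h(4) continues_on_cong[of "{0..1}" "g 1" "G 1" q] by (simp add: continuation_iff g_def)
    then have "germ_eq B (q 1) (F' 1) (G 1 1)" using continuation_unique[OF _ _ F(2), of "G 1" 1] homotopic_paths_imp_path[OF assms(1)] homotopic_paths_imp_subset[OF assms(1)] by simp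
    then show ?thesis using h(4)[of 1] h(6)[of 1] by simp
  qed
  ultimately show ?thesis using germ_sym germ_trans by blast
qed

end

section \<open>The two local systems and the class \<open>w\<^sub>0\<close>\<close>

context integral_affine_mfd
begin

abbreviation tangent_group :: "'b \<Rightarrow> ('b, real^'n) tvec monoid" where
  "tangent_group x \<equiv> additive_group (tangent_space \<C> x)"

abbreviation const_field :: "('b, real^'n) chart \<Rightarrow> real^'n \<Rightarrow> 'b \<Rightarrow> ('b, real^'n) tvec" where
  "const_field c r x \<equiv> coord_vector \<C> c x r"

lemma coord_vector_add:
  assumes "c \<in> \<C>" "x \<in> fst c"
  shows "coord_vector \<C> c x r + coord_vector \<C> c x s = coord_vector \<C> c x (r + s)"
proof
  fix c' show "(coord_vector \<C> c x r + coord_vector \<C> c x s) c' = coord_vector \<C> c x (r + s) c'"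
  proof (cases "c' \<in> \<C> \<and> x \<in> fst c'")
    case True
    obtain A where A: "(transition c c' has_derivative (*v) A) (at (snd c x))"
      using affE[OF assms(1) _ assms(2)] True by metis
    then show ?thesis using True coord_vector_eq[OF _ _ A] by (simp add: matrix_vector_right_distrib)
  qed (auto simp: coord_vector_def)
qed

lemma coord_vector_0: "c \<in> \<C> \<Longrightarrow> x \<in> fst c \<Longrightarrow> coord_vector \<C> c x 0 = 0"
  using coord_vector_add[of c x 0 0] by simp

lemma coord_vector_minus: "c \<in> \<C> \<Longrightarrow> x \<in> fst c \<Longrightarrow> coord_vector \<C> c x (- r) = - coord_vector \<C> c x r"
  using coord_vector_add[of c x r "- r"] coord_vector_0[of c x] by (simp add: eq_neg_iff_add_eq_0 add.commute)

lemma coord_vector_diff: "c \<in> \<C> \<Longrightarrow> x \<in> fst c \<Longrightarrow>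
    coord_vector \<C> c x (r - s) = coord_vector \<C> c x r - coord_vector \<C> c x s"
  using coord_vector_add[of c x r "- s"] coord_vector_minus[of c x s] by simp

lemma flat_system_TB: "flat_system B \<A> \<C> tangent_group const_field"
proof (unfold_locales, goal_cases)
  case (1 c x r)
  then show ?case by (simp add: additive_group_def coord_vector_tangent)
next
  case (2 c x r s)
  then show ?case by (simp add: additive_group_def coord_vector_add)
next
  case (3 c x)
  then show ?case by (simp add: additive_group_def coord_vector_0)
next
  case (4 c x r s)
  then show ?case using coord_vector_self by metis
next
  case (5 c c' x A r)
  then show ?case by (rule coord_vector_change)
qed

text \<open>
  The classes of the forms \<open>\<Sum>\<^sub>i r\<^sub>i d\<theta>\<^sup>i\<close> have well defined coordinates \<open>r\<close>, and these change like tangent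
  vectors.
\<close>

lemma flat_system_HF: "flat_system B \<A> \<C> (\<lambda>x. deRham_H1 (fibre_atlas \<C> x)) (theta_class \<C>)"
proof (unfold_locales, goal_cases)
  case (1 c x r)
  then show ?case
    using theta_form_closed unfolding deRham_H1_def carrier_FactGroup theta_class_form deRham_class_def by blast
next
  case (2 c x r s)
  show ?case
    unfolding theta_class_form affine_atlas.deRham_class_mult[OF fibre_affine_atlas] theta_form_add by (rule refl)
next
  case (3 c x)
  show ?case
    unfolding theta_class_form affine_atlas.deRham_class_zero[OF fibre_affine_atlas] theta_form_zero by (rule refl)
next
  case (4 c x r s)
  then show ?case by (rule theta_class_inj)
next
  case (5 c c' x A r)
  then show ?case unfolding theta_class_form by (simp only: theta_form_change)
qed

end

sublocale integral_affine_mfd \<subseteq> TB: flat_system B \<A> \<C> tangent_group const_field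
  by (rule flat_system_TB)

sublocale integral_affine_mfd \<subseteq> HF: flat_system B \<A> \<C> "\<lambda>x. deRham_H1 (fibre_atlas \<C> x)" "theta_class \<C>"
  by (rule flat_system_HF)

context integral_affine_mfd
begin

lemma flat_TB_eq: "flat_TB B \<C> = TB.Flat"
  by (simp add: flat_TB_def)

lemma TB_mult: "x \<in> V \<Longrightarrow> (s \<otimes>\<^bsub>TB.Flat V\<^esub> t) x = s x + t x"
  unfolding TB.flat_mult by (simp add: additive_group_def)

lemma flat_HF_eq: "flat_HF B \<C> = HF.Flat"
  by (simp add: flat_HF_def)

lemma Phi_fibre_eq: "Phi_fibre \<C> = flat_transfer \<C> (theta_class \<C>) const_field"
  by (intro ext) (simp add: Phi_fibre_def flat_transfer_def)

lemma Phi_iso: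
  assumes "\<And>\<alpha>. \<alpha> \<in> I \<Longrightarrow> openB (U \<alpha>)"
  shows "Phi B \<C> I U \<in> iso (cech_H1 (flat_HF B \<C>) I U) (cech_H1 (flat_TB B \<C>) I U)"
    and "s \<in> carrier (cech_Z1 (flat_HF B \<C>) I U) \<Longrightarrow>
      Phi_cochain \<C> I U s \<in> carrier (cech_Z1 (flat_TB B \<C>) I U) \<and>
      Phi B \<C> I U (cech_class (flat_HF B \<C>) I U s) = cech_class (flat_TB B \<C>) I U (Phi_cochain \<C> I U s)"
proof -
  interpret flat_system_pair B \<A> \<C> "\<lambda>x. deRham_H1 (fibre_atlas \<C> x)" "theta_class \<C>" tangent_group const_field
    by unfold_locales
  note iso = flat_transfer_iso[of I U, OF assms]
  show "Phi B \<C> I U \<in> iso (cech_H1 (flat_HF B \<C>) I U) (cech_H1 (flat_TB B \<C>) I U)"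
    using iso(1) unfolding Phi_def[abs_def] Phi_cochain_def flat_TB_eq flat_HF_eq Phi_fibre_eq by simp
  assume "s \<in> carrier (cech_Z1 (flat_HF B \<C>) I U)"
  then show "Phi_cochain \<C> I U s \<in> carrier (cech_Z1 (flat_TB B \<C>) I U) \<and>
      Phi B \<C> I U (cech_class (flat_HF B \<C>) I U s) = cech_class (flat_TB B \<C>) I U (Phi_cochain \<C> I U s)"
    using iso(2)[of s] unfolding Phi_def Phi_cochain_def flat_TB_eq flat_HF_eq Phi_fibre_eq by simp
qed

lemma transition_id:
  assumes "c \<in> \<C>" "x \<in> fst c"
  shows "(transition c c has_derivative (*v) (mat 1)) (at (snd c x))"
proof -
  have "(*v) (mat 1 :: real^'n^'n) = (\<lambda>u. u)" by (intro ext) simp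
  then show ?thesis using transition_self[OF assms] by simp
qed

text \<open>
  On the fibre over \<open>x\<close> the coefficients \<open>a\<^sup>i\<close> of \<open>\<nu>\<close> are constant, so the difference of two potentials is
  a combination of the \<open>d\<theta>\<^sup>i\<close>.  It is expressed in the coordinates of a third chart \<open>d\<close>, as is needed for
  comparing the members of the cover on a triple intersection.
\<close>

lemma tau_value:
  assumes c: "c\<^sub>1 \<in> \<C>" "c\<^sub>2 \<in> \<C>" "x \<in> fst c\<^sub>1" "x \<in> fst c\<^sub>2" and d: "d \<in> \<C>" "x \<in> fst d"
    and A: "(transition c\<^sub>1 d has_derivative (*v) A\<^sub>1) (at (snd c\<^sub>1 x))"
      "(transition c\<^sub>2 d has_derivative (*v) A\<^sub>2) (at (snd c\<^sub>2 x))"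
  shows "fibre_class \<C> x (\<lambda>e v. nu_form \<C> c\<^sub>2 e v - nu_form \<C> c\<^sub>1 e v) =
    theta_class \<C> d (A\<^sub>2 *v snd c\<^sub>2 x - A\<^sub>1 *v snd c\<^sub>1 x) x"
proof -
  have "fibre_restrict \<C> x (\<lambda>e v. nu_form \<C> c\<^sub>2 e v - nu_form \<C> c\<^sub>1 e v) =
      theta_form c\<^sub>2 (snd c\<^sub>2 x) x - theta_form c\<^sub>1 (snd c\<^sub>1 x) x"
    by (intro ext) (simp add: fibre_restrict_def pullback1_def theta_form_def nu_form_def)
  also have "\<dots> = theta_form d (A\<^sub>2 *v snd c\<^sub>2 x) x - theta_form d (A\<^sub>1 *v snd c\<^sub>1 x) x"
    using theta_form_change[OF c(1) d(1) c(3) d(2) A(1)] theta_form_change[OF c(2) d(1) c(4) d(2) A(2)] by simp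
  also have "\<dots> = theta_form d (A\<^sub>2 *v snd c\<^sub>2 x - A\<^sub>1 *v snd c\<^sub>1 x) x"
    using theta_form_add[of d "A\<^sub>2 *v snd c\<^sub>2 x - A\<^sub>1 *v snd c\<^sub>1 x" x "A\<^sub>1 *v snd c\<^sub>1 x"] by (simp add: algebra_simps)
  finally show ?thesis by (simp add: fibre_class_def theta_class_form)
qed

text \<open>
  For \<open>\<kappa> \<beta> = A (\<kappa> \<alpha>) + d\<close> the coordinates of \<open>\<tau>\<^sub>\<beta>\<^sub>\<alpha>\<close> in the chart \<open>\<kappa> \<beta>\<close> are the constants \<open>d\<close>, so \<open>\<tau>\<^sub>\<beta>\<^sub>\<alpha>\<close> is flat.
\<close>

lemma tau_cocycle_Z1:
  assumes \<kappa>: "\<And>\<alpha>. \<alpha> \<in> I \<Longrightarrow> \<kappa> \<alpha> \<in> \<C>"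
  shows "tau_cocycle \<C> I \<kappa> \<in> carrier (cech_Z1 (flat_HF B \<C>) I (fst \<circ> \<kappa>))"
  unfolding flat_HF_eq
proof (rule HF.flat_cocycleI)
  show U: "openB ((fst \<circ> \<kappa>) \<alpha>)" if "\<alpha> \<in> I" for \<alpha> using openB_chart[OF \<kappa>[OF that]] by simp
  have deriv: "\<exists>A. (transition c d has_derivative (*v) A) (at (snd c y))"
    if "c \<in> \<C>" "d \<in> \<C>" "y \<in> fst c" "y \<in> fst d" for c d y
    using affE[OF that] by metis
  interpret cech_cover openB HF.Flat I "fst \<circ> \<kappa>"
    using U HF.flat_presheaf by (simp add: cech_cover_def cech_cover_axioms_def)
  show "tau_cocycle \<C> I \<kappa> \<in> carrier (cech_C1 HF.Flat I (fst \<circ> \<kappa>))"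
    unfolding C1_iff
  proof (intro conjI ballI)
    fix \<alpha> \<beta> assume a: "\<alpha> \<in> I" "\<beta> \<in> I"
    show "tau_cocycle \<C> I \<kappa> (\<alpha>, \<beta>) \<in> carrier (HF.Flat ((fst \<circ> \<kappa>) \<alpha> \<inter> (fst \<circ> \<kappa>) \<beta>))"
    proof (rule HF.flatI)
      fix x assume x: "x \<in> (fst \<circ> \<kappa>) \<alpha> \<inter> (fst \<circ> \<kappa>) \<beta>"
      then have xx: "x \<in> fst (\<kappa> \<alpha>)" "x \<in> fst (\<kappa> \<beta>)" by auto
      obtain A d N where A: "openB N" "x \<in> N" "N \<subseteq> fst (\<kappa> \<alpha>) \<inter> fst (\<kappa> \<beta>)"
        "\<And>y. y \<in> N \<Longrightarrow> snd (\<kappa> \<beta>) y = A *v snd (\<kappa> \<alpha>) y + d"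
        "\<And>y. y \<in> N \<Longrightarrow> (transition (\<kappa> \<alpha>) (\<kappa> \<beta>) has_derivative (*v) A) (at (snd (\<kappa> \<alpha>) y))"
        using chart_change[OF \<kappa>[OF a(1)] \<kappa>[OF a(2)] xx] by metis
      have "tau_cocycle \<C> I \<kappa> (\<alpha>, \<beta>) y = theta_class \<C> (\<kappa> \<beta>) d y" if y: "y \<in> N" for y
      proof -
        have yy: "y \<in> fst (\<kappa> \<alpha>)" "y \<in> fst (\<kappa> \<beta>)" using y A(3) by auto
        from tau_value[OF \<kappa>[OF a(1)] \<kappa>[OF a(2)] yy \<kappa>[OF a(2)] yy(2) A(5)[OF y] transition_id[OF \<kappa>[OF a(2)] yy(2)]]
        show ?thesis using a yy A(4)[OF y] by (simp add: tau_cocycle_def)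
      qed
      then show "\<exists>c\<in>\<C>. \<exists>N r. openB N \<and> x \<in> N \<and> N \<subseteq> (fst \<circ> \<kappa>) \<alpha> \<inter> (fst \<circ> \<kappa>) \<beta> \<inter> fst c \<and>
          (\<forall>y\<in>N. tau_cocycle \<C> I \<kappa> (\<alpha>, \<beta>) y = theta_class \<C> c r y)"
        using A(1-3) \<kappa>[OF a(2)] by (intro bexI[of _ "\<kappa> \<beta>"] exI[of _ N] exI[of _ d]) auto
    qed (use a in \<open>simp add: tau_cocycle_def\<close>)
  qed (simp add: tau_cocycle_def)
  fix y \<alpha> \<beta> \<gamma> assume a: "\<alpha> \<in> I" "\<beta> \<in> I" "\<gamma> \<in> I" and y: "y \<in> (fst \<circ> \<kappa>) \<alpha> \<inter> (fst \<circ> \<kappa>) \<beta> \<inter> (fst \<circ> \<kappa>) \<gamma>"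
  have "\<exists>A. (transition (\<kappa> \<mu>) (\<kappa> \<gamma>) has_derivative (*v) A) (at (snd (\<kappa> \<mu>) y))" if "\<mu> \<in> {\<alpha>, \<beta>, \<gamma>}" for \<mu>
    using deriv[of "\<kappa> \<mu>" "\<kappa> \<gamma>" y] that a \<kappa> y by auto
  then obtain A where A: "\<And>\<mu>. \<mu> \<in> {\<alpha>, \<beta>, \<gamma>} \<Longrightarrow> (transition (\<kappa> \<mu>) (\<kappa> \<gamma>) has_derivative (*v) (A \<mu>)) (at (snd (\<kappa> \<mu>) y))"
    by metis
  have "tau_cocycle \<C> I \<kappa> (\<mu>, \<nu>) y = theta_class \<C> (\<kappa> \<gamma>) (A \<nu> *v snd (\<kappa> \<nu>) y - A \<mu> *v snd (\<kappa> \<mu>) y) y"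
    if "\<mu> \<in> {\<alpha>, \<beta>, \<gamma>}" "\<nu> \<in> {\<alpha>, \<beta>, \<gamma>}" for \<mu> \<nu>
  proof -
    have m: "\<mu> \<in> I" "\<nu> \<in> I" "y \<in> fst (\<kappa> \<mu>)" "y \<in> fst (\<kappa> \<nu>)" "y \<in> fst (\<kappa> \<gamma>)" using that a y by auto
    show ?thesis
      using tau_value[OF \<kappa>[OF m(1)] \<kappa>[OF m(2)] m(3,4) \<kappa>[OF a(3)] m(5) A[OF that(1)] A[OF that(2)]] m
      by (simp add: tau_cocycle_def)
  qed
  then show "\<exists>c\<in>\<C>. y \<in> fst c \<and> (\<exists>e. \<forall>\<mu>\<in>{\<alpha>, \<beta>, \<gamma>}. \<forall>\<nu>\<in>{\<alpha>, \<beta>, \<gamma>}. tau_cocycle \<C> I \<kappa> (\<mu>, \<nu>) y = theta_class \<C> c (e \<nu> - e \<mu>) y)"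
    using \<kappa>[OF a(3)] y by (intro bexI[of _ "\<kappa> \<gamma>"] conjI exI[of _ "\<lambda>\<mu>. A \<mu> *v snd (\<kappa> \<mu>) y"] ballI) auto
qed

text \<open>
  The radiant field \<open>\<Sum>\<^sub>i a\<^sup>i \<partial>/\<partial>a\<^sup>i\<close> of a chart.
\<close>

definition radiant :: "('b, real^'n) chart \<Rightarrow> 'b \<Rightarrow> ('b, real^'n) tvec" where
  "radiant c x = coord_vector \<C> c x (snd c x)"

lemma Phi_tau:
  assumes \<kappa>: "\<And>\<alpha>. \<alpha> \<in> I \<Longrightarrow> \<kappa> \<alpha> \<in> \<C>" and a: "\<alpha> \<in> I" "\<beta> \<in> I" and x: "x \<in> fst (\<kappa> \<alpha>)" "x \<in> fst (\<kappa> \<beta>)"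
  shows "Phi_cochain \<C> I (fst \<circ> \<kappa>) (tau_cocycle \<C> I \<kappa>) (\<alpha>, \<beta>) x = radiant (\<kappa> \<beta>) x - radiant (\<kappa> \<alpha>) x"
proof -
  interpret flat_system_pair B \<A> \<C> "\<lambda>x. deRham_H1 (fibre_atlas \<C> x)" "theta_class \<C>" tangent_group const_field
    by unfold_locales
  note k = \<kappa>[OF a(1)] \<kappa>[OF a(2)]
  obtain A where A: "(transition (\<kappa> \<alpha>) (\<kappa> \<beta>) has_derivative (*v) A) (at (snd (\<kappa> \<alpha>) x))"
    using affE[OF k x] by metis
  have "tau_cocycle \<C> I \<kappa> (\<alpha>, \<beta>) x = theta_class \<C> (\<kappa> \<beta>) (snd (\<kappa> \<beta>) x - A *v snd (\<kappa> \<alpha>) x) x"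
    using tau_value[OF k x k(2) x(2) A transition_id[OF k(2) x(2)]] a x by (simp add: tau_cocycle_def)
  then have "Phi_cochain \<C> I (fst \<circ> \<kappa>) (tau_cocycle \<C> I \<kappa>) (\<alpha>, \<beta>) x = coord_vector \<C> (\<kappa> \<beta>) x (snd (\<kappa> \<beta>) x - A *v snd (\<kappa> \<alpha>) x)"
    using a x transfer_eq[OF k(2) x(2)] by (simp add: Phi_cochain_def Phi_fibre_eq)
  also have "\<dots> = radiant (\<kappa> \<beta>) x - radiant (\<kappa> \<alpha>) x"
    using coord_vector_change[OF k x A, of "snd (\<kappa> \<alpha>) x"]
    by (simp add: radiant_def coord_vector_diff[OF k(2) x(2)])
  finally show ?thesis .
qed

section \<open>Holonomy and the radiance obstruction\<close>

lemma affine_transition: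
  assumes c: "c \<in> \<C>" "openB N" "N \<subseteq> fst c" "x \<in> N" and A: "\<And>y. y \<in> N \<Longrightarrow> snd c' y = A *v snd c y + d"
  shows "(transition c c' has_derivative (*v) A) (at (snd c x))"
proof (rule transition_has_derivative[OF matrix_vector_mul_linear])
  show "open (snd c ` N)" by (rule open_chart_image[OF c(1-3)])
  show "snd c x \<in> snd c ` N" using c(4) by blast
  fix y assume "y \<in> snd c ` N"
  then obtain z where "z \<in> N" "y = snd c z" by blast
  then show "snd c' (chart_inv c y) = A *v y + d" using A c(1,3) by auto
qed

lemma germ_coord_vector:
  assumes c: "c \<in> \<C>" "c' \<in> \<C>" and g: "germ_eq B x c c'"
  shows "coord_vector \<C> c x u = coord_vector \<C> c' x u" "snd c x = snd c' x"
proof -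
  obtain N where N: "openB N" "x \<in> N" "N \<subseteq> fst c \<inter> fst c'" "\<forall>y\<in>N. snd c y = snd c' y"
    using g unfolding germ_eq_def by blast
  have "(transition c c' has_derivative (*v) (mat 1)) (at (snd c x))"
    by (rule affine_transition[OF c(1) N(1) _ N(2), of _ "mat 1" 0]) (use N in auto)
  from coord_vector_change[OF c _ _ this] show "coord_vector \<C> c x u = coord_vector \<C> c' x u"
    using N by auto
  show "snd c x = snd c' x" using N by blast
qed

text \<open>
  The final germ of a continuation is unique, and a tangent vector is determined by its coordinates
  in the chart of this germ.
\<close>

lemma parallel_transport_eq:
  assumes g: "path g" "path_image g \<subseteq> B" and F: "continuation B \<C> g c F"
  shows "parallel_transport B \<C> c g u = coord_vector \<C> (F 1) (g 1) u"
proof -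
  have C: "F 1 \<in> \<C> \<and> g 1 \<in> fst (F 1)" if "continuation B \<C> g c F" for F
    using that by (simp add: continuation_def)
  show ?thesis
    unfolding parallel_transport_def
  proof (rule the_equality)
    show "coord_vector \<C> (F 1) (g 1) u \<in> tangent_space \<C> (g 1) \<and>
      (\<exists>F'. continuation B \<C> g c F' \<and> coord_vector \<C> (F 1) (g 1) u (F' 1) = u)"
      using C[OF F] F coord_vector_tangent coord_vector_self by blast
    fix v assume "v \<in> tangent_space \<C> (g 1) \<and> (\<exists>F. continuation B \<C> g c F \<and> v (F 1) = u)"
    then obtain F' where v: "v \<in> tangent_space \<C> (g 1)" "continuation B \<C> g c F'" "v (F' 1) = u" by blast
    have "germ_eq B (g 1) (F 1) (F' 1)" by (rule continuation_unique[OF g F v(2)]) simp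
    then show "v = coord_vector \<C> (F 1) (g 1) u"
      using germ_coord_vector(1) C[OF F] C[OF v(2)] tangent_eq_coord[OF v(1)] v(3) by metis
  qed
qed

text \<open>
  Continue \<open>c\<close> along \<open>q\<close> to \<open>G 1 = A (F 1) + d\<close>, and then back along \<open>p\<close> by the charts \<open>A (F t) + d\<close>.  This ends
  in \<open>A (F 0) + d\<close>, which is \<open>A c + d\<close> near \<open>b\<close>.  The holonomy refers to any loop in the homotopy class and
  any continuation; by monodromy they all yield the same germ.
\<close>

lemma affine_holonomy_eq:
  assumes c: "c \<in> \<C>" "b \<in> fst c"
    and p: "path p" "path_image p \<subseteq> B" "pathstart p = b" and q: "path q" "path_image q \<subseteq> B" "pathstart q = b"
    and e: "pathfinish p = pathfinish q"
    and F: "continuation B \<C> p c F" and G: "continuation B \<C> q c G"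
    and A: "A \<in> GL_int" "germ_eq B (pathfinish q) (G 1) (affine_image A d (F 1))"
  shows "affine_holonomy B \<C> b c (path_class B (q +++ reversepath p)) = (A, d)"
proof -
  let ?g = "q +++ reversepath p"
  have g: "path ?g" "path_image ?g \<subseteq> B" "?g 0 = b" "?g 1 = b"
  proof -
    show "path ?g" "path_image ?g \<subseteq> B" using p q e by (simp_all add: path_image_join)
    show "?g 0 = b" "?g 1 = b" using p(3) q(3) by (simp_all add: joinpaths_def pathstart_def reversepath_def)
  qed
  define H where "H = (\<lambda>t. affine_image A d (F (1 - t)))"
  have "continues_on {0..1} (reversepath p) (\<lambda>t. F (1 - t))"
    unfolding reversepath_def
    by (rule continues_on_reparam[of "{0..1}"]) (use F in \<open>auto simp: continuation_iff intro!: continuous_intros\<close>)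
  then have H: "continues_on {0..1} (reversepath p) H"
    unfolding H_def by (rule continues_on_affine[OF _ A(1)])
  define K where "K = (\<lambda>t. if t \<le> 1/2 then G (2 * t) else H (2 * t - 1))"
  have K: "continuation B \<C> ?g c K"
    unfolding K_def
    by (rule continuation_join[OF g(1,2) _ G H]) (use A e in \<open>simp_all add: H_def pathfinish_def pathstart_def reversepath_def\<close>)
  have K1: "K 1 = affine_image A d (F 0)" by (simp add: K_def H_def)
  have germ0: "germ_eq B b c (F 0)" using F p(3) by (simp add: continuation_iff pathstart_def)
  show ?thesis
    unfolding affine_holonomy_def
  proof (rule the_equality, unfold prod.case)
    obtain N where N: "openB N" "b \<in> N" "N \<subseteq> fst c \<inter> fst (F 0)" "\<forall>y\<in>N. snd c y = snd (F 0) y"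
      using germ0 unfolding germ_eq_def by blast
    have "homotopic_paths B ?g ?g" using g by simp
    then have "?g \<in> path_class B ?g" by (simp add: path_class_def)
    moreover have "N \<subseteq> fst c \<inter> fst (K 1)" "\<forall>y\<in>N. snd (K 1) y = A *v snd c y + d"
      using N by (auto simp: K1)
    ultimately show "A \<in> GL_int \<and> (\<exists>g\<in>path_class B ?g. \<exists>F N. continuation B \<C> g c F \<and> openB N \<and> b \<in> N \<and>
        N \<subseteq> fst c \<inter> fst (F 1) \<and> (\<forall>y\<in>N. snd (F 1) y = A *v snd c y + d))"
      using A(1) K N(1,2) by blast
  next
    fix P assume "case P of (A, d) \<Rightarrow> A \<in> GL_int \<and> (\<exists>g\<in>path_class B ?g. \<exists>F N. continuation B \<C> g c F \<and> openB N \<and> b \<in> N \<and>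
        N \<subseteq> fst c \<inter> fst (F 1) \<and> (\<forall>y\<in>N. snd (F 1) y = A *v snd c y + d))"
    then obtain A' d' g' F' N where P: "P = (A', d')" and g': "homotopic_paths B ?g g'" "continuation B \<C> g' c F'"
      and N: "openB N" "b \<in> N" "N \<subseteq> fst c \<inter> fst (F' 1)" "\<And>y. y \<in> N \<Longrightarrow> snd (F' 1) y = A' *v snd c y + d'"
      unfolding path_class_def by (cases P) auto
    have "germ_eq B b (K 1) (F' 1)"
      using monodromy[OF g'(1) c(1) _ K g'(2)] g(3,4) c(2) by simp
    then obtain N' where N': "openB N'" "b \<in> N'" "\<And>y. y \<in> N' \<Longrightarrow> snd (K 1) y = snd (F' 1) y"
      unfolding germ_eq_def by blast
    obtain N'' where N'': "openB N''" "b \<in> N''" "\<And>y. y \<in> N'' \<Longrightarrow> snd c y = snd (F 0) y"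
      using germ0 unfolding germ_eq_def by blast
    define M where "M = N \<inter> N' \<inter> N''"
    have M: "openB M" "M \<subseteq> fst c" "b \<in> M" using N N' N'' by (auto simp: M_def)
    have "A *v snd c y + d = A' *v snd c y + d'" if y: "y \<in> M" for y
    proof -
      have "A *v snd c y + d = snd (K 1) y" using N''(3)[of y] y by (simp add: K1 M_def)
      also have "\<dots> = A' *v snd c y + d'" using N(4)[of y] N'(3)[of y] y by (simp add: M_def)
      finally show ?thesis .
    qed
    from chart_affine_eqD[OF c(1) M this] show "P = (A, d)" using P by simp
  qed
qed

lemma path_nbhd:
  assumes V: "openB V" and c: "c \<in> \<C>" and x: "x \<in> V" "x \<in> fst c"
  obtains N where "openB N" "x \<in> N" "N \<subseteq> V \<inter> fst c" "path_connected N"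
proof -
  have W: "openB (V \<inter> fst c)" using V openB_chart[OF c] by blast
  have "snd c ` (V \<inter> fst c) \<subseteq> snd c ` fst c" by blast
  then obtain N where N: "openB N" "x \<in> N" "N \<subseteq> fst c" "path_connected N" "snd c ` N \<subseteq> snd c ` (V \<inter> fst c)"
    using chart_nbhd[OF c open_chart_image[OF c W], of x] x by (metis IntI Int_lower2 imageI)
  have "y \<in> V" if y: "y \<in> N" for y
  proof -
    obtain z where z: "z \<in> V \<inter> fst c" "snd c y = snd c z" using N(5) y by blast
    then have "y = z" using inj_onD[OF inj_chart[OF c] z(2)] N(3) y by blast
    then show ?thesis using z(1) by blast
  qed
  then show ?thesis using that N by blast
qed

context
  fixes I :: "'i set" and U :: "'i \<Rightarrow> 'b set" and b :: 'b and c :: "('b, real^'n) chart" and \<sigma> :: "'i \<Rightarrow> 'b \<Rightarrow> real \<Rightarrow> 'b"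
  assumes c: "c \<in> \<C>" "b \<in> fst c" and \<sigma>: "univ_cover_sections B b I U \<sigma>"
    and U: "\<And>\<alpha>. \<alpha> \<in> I \<Longrightarrow> openB (U \<alpha>)"
begin

text \<open>
  A continuation of \<open>c\<close> along the path \<open>\<sigma> \<alpha> x\<close>.  Its last chart \<open>dev_chart \<alpha> x\<close> represents the developing
  map of \<open>c\<close>, pulled back to \<open>B\<close> by the section \<open>\<sigma> \<alpha>\<close> of the universal cover, near \<open>x\<close>.
\<close>

definition dev_path :: "'i \<Rightarrow> 'b \<Rightarrow> real \<Rightarrow> ('b, real^'n) chart" where
  "dev_path \<alpha> x = (SOME F. continuation B \<C> (\<sigma> \<alpha> x) c F)"

definition dev_chart :: "'i \<Rightarrow> 'b \<Rightarrow> ('b, real^'n) chart" where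
  "dev_chart \<alpha> x = dev_path \<alpha> x 1"

lemma section_path:
  assumes "\<alpha> \<in> I" "x \<in> U \<alpha>"
  shows "path (\<sigma> \<alpha> x)" "path_image (\<sigma> \<alpha> x) \<subseteq> B" "pathstart (\<sigma> \<alpha> x) = b" "pathfinish (\<sigma> \<alpha> x) = x"
  using \<sigma> assms unfolding univ_cover_sections_def by blast+

lemma dev_path:
  assumes "\<alpha> \<in> I" "x \<in> U \<alpha>"
  shows "continuation B \<C> (\<sigma> \<alpha> x) c (dev_path \<alpha> x)"
proof -
  have "\<sigma> \<alpha> x 0 \<in> fst c" using section_path(3)[OF assms] c(2) by (simp add: pathstart_def)
  then obtain F where "continuation B \<C> (\<sigma> \<alpha> x) c F"
    using continuation_exists[OF section_path(1,2)[OF assms] c(1)] by blast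
  then have "\<exists>F. continuation B \<C> (\<sigma> \<alpha> x) c F" by blast
  from someI_ex[OF this] show ?thesis unfolding dev_path_def .
qed

lemma dev_chart:
  assumes "\<alpha> \<in> I" "x \<in> U \<alpha>"
  shows "dev_chart \<alpha> x \<in> \<C>" "x \<in> fst (dev_chart \<alpha> x)"
proof -
  have "dev_path \<alpha> x 1 \<in> \<C> \<and> \<sigma> \<alpha> x 1 \<in> fst (dev_path \<alpha> x 1)"
    using dev_path[OF assms] by (simp add: continuation_def)
  then show "dev_chart \<alpha> x \<in> \<C>" "x \<in> fst (dev_chart \<alpha> x)"
    using section_path(4)[OF assms] by (auto simp: dev_chart_def pathfinish_def)
qed

text \<open>
  For \<open>y\<close> near \<open>x\<close>, the path \<open>\<sigma> \<alpha> y\<close> is homotopic to \<open>\<sigma> \<alpha> x\<close> followed by a short path \<open>h\<close> in the domain of the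
  chart \<open>dev_chart \<alpha> x\<close>, along which the continuation stays constant.
\<close>

lemma dev_chart_near:
  assumes a: "\<alpha> \<in> I" and x: "x \<in> U \<alpha>"
  obtains N where "openB N" "x \<in> N" "N \<subseteq> U \<alpha> \<inter> fst (dev_chart \<alpha> x)"
    "\<And>y. y \<in> N \<Longrightarrow> germ_eq B y (dev_chart \<alpha> x) (dev_chart \<alpha> y)"
proof -
  define k where "k = dev_chart \<alpha> x"
  have k: "k \<in> \<C>" "x \<in> fst k" using dev_chart[OF a x] by (auto simp: k_def)
  obtain N where N: "openB N" "x \<in> N" "N \<subseteq> U \<alpha> \<inter> fst k" "path_connected N"
    using path_nbhd[OF U[OF a] k(1) x k(2)] by blast
  have "germ_eq B y k (dev_chart \<alpha> y)" if y: "y \<in> N" for y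
  proof -
    obtain h where h: "path h" "path_image h \<subseteq> N" "pathstart h = x" "pathfinish h = y"
      using N(2,4) y unfolding path_connected_def by blast
    have yU: "y \<in> U \<alpha>" using y N(3) by blast
    have hom: "homotopic_paths B (\<sigma> \<alpha> x +++ h) (\<sigma> \<alpha> y)"
    proof -
      have "path_image h \<subseteq> U \<alpha>" using h(2) N(3) by blast
      then show ?thesis using \<sigma> a h(1,3,4) unfolding univ_cover_sections_def by metis
    qed
    have "germ_eq B ((\<sigma> \<alpha> x +++ h) 1) k (dev_chart \<alpha> y)"
    proof -
      have "continues_on {0..1} h (\<lambda>_. k)"
        using h(2) N(3) by (intro continues_on_const k(1)) (auto simp: path_image_def)
      moreover have "germ_eq B (h 0) (dev_path \<alpha> x 1) k"
        using germ_refl[OF k] h(3) by (simp add: k_def dev_chart_def pathstart_def)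
      ultimately have "continuation B \<C> (\<sigma> \<alpha> x +++ h) c (\<lambda>t. if t \<le> 1/2 then dev_path \<alpha> x (2 * t) else k)"
        using homotopic_paths_imp_path[OF hom] homotopic_paths_imp_subset[OF hom] section_path(4)[OF a x] h(3)
        by (intro continuation_join[OF _ _ _ dev_path[OF a x], where F' = "\<lambda>_. k"]) auto
      moreover have "(\<sigma> \<alpha> x +++ h) 0 \<in> fst c"
        using section_path(3)[OF a x] c(2) by (simp add: joinpaths_def pathstart_def)
      ultimately show ?thesis
        using monodromy[OF hom c(1) _ _ dev_path[OF a yU]] by (fastforce simp: dev_chart_def)
    qed
    moreover have "(\<sigma> \<alpha> x +++ h) 1 = y" using h(4) by (simp add: joinpaths_def pathfinish_def)
    ultimately show ?thesis by simp
  qed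
  then show ?thesis using that N(1-3) unfolding k_def by blast
qed

text \<open>
  Near a point, \<open>\<kappa> \<alpha>\<close> and the developing chart \<open>k\<close> are related by \<open>\<kappa> \<alpha> = A k + d\<close>; the linear parts of
  the radiant fields cancel.  The term with \<open>w\<close> accounts for the choice of a representative of the
  class of \<open>Trans \<circ> a\<close> in group cohomology.
\<close>

lemma radiant_diff_flat:
  assumes \<kappa>: "\<And>\<alpha>. \<alpha> \<in> I \<Longrightarrow> \<kappa> \<alpha> \<in> \<C> \<and> fst (\<kappa> \<alpha>) = U \<alpha>" and a: "\<alpha> \<in> I"
  shows "(\<lambda>x\<in>U \<alpha>. radiant (dev_chart \<alpha> x) x - radiant (\<kappa> \<alpha>) x - coord_vector \<C> (dev_chart \<alpha> x) x w)
    \<in> carrier (TB.Flat (U \<alpha>))" (is "restrict ?s _ \<in> _")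
proof (rule TB.flatI)
  fix x assume x: "x \<in> U \<alpha>"
  define k where "k = dev_chart \<alpha> x"
  have k: "k \<in> \<C>" "x \<in> fst k" using dev_chart[OF a x] by (auto simp: k_def)
  have ka: "\<kappa> \<alpha> \<in> \<C>" "fst (\<kappa> \<alpha>) = U \<alpha>" using \<kappa>[OF a] by auto
  obtain N where N: "openB N" "x \<in> N" "N \<subseteq> U \<alpha> \<inter> fst k" "\<And>y. y \<in> N \<Longrightarrow> germ_eq B y k (dev_chart \<alpha> y)"
    using dev_chart_near[OF a x] unfolding k_def by blast
  obtain A A' d N' where A: "A ** A' = mat 1" "openB N'" "x \<in> N'" "N' \<subseteq> fst k \<inter> fst (\<kappa> \<alpha>)"
    "\<And>y. y \<in> N' \<Longrightarrow> snd (\<kappa> \<alpha>) y = A *v snd k y + d"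
    "\<And>y. y \<in> N' \<Longrightarrow> (transition k (\<kappa> \<alpha>) has_derivative (*v) A) (at (snd k y))"
    using chart_change[OF k(1) ka(1) k(2)] x ka(2) by metis
  have "restrict ?s (U \<alpha>) y = coord_vector \<C> k y (- (A' *v d) - w)" if y: "y \<in> N \<inter> N'" for y
  proof -
    have yy: "y \<in> U \<alpha>" "y \<in> fst k" "y \<in> fst (\<kappa> \<alpha>)" using y N(3) A(4) by auto
    note g = germ_coord_vector[OF k(1) dev_chart(1)[OF a yy(1)] N(4)]
    have g1: "coord_vector \<C> (dev_chart \<alpha> y) y u = coord_vector \<C> k y u" for u using g(1) y by simp
    have g2: "snd (dev_chart \<alpha> y) y = snd k y" using g(2) y by simp
    have ch: "coord_vector \<C> k y u = coord_vector \<C> (\<kappa> \<alpha>) y (A *v u)" for u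
      using coord_vector_change[OF k(1) ka(1) yy(2,3) A(6)] y by blast
    have "radiant (\<kappa> \<alpha>) y = coord_vector \<C> (\<kappa> \<alpha>) y (A *v (snd k y + A' *v d))"
      using A(5)[of y] y A(1) by (simp add: radiant_def matrix_vector_right_distrib matrix_vector_mul_assoc)
    also have "\<dots> = coord_vector \<C> k y (snd k y) + coord_vector \<C> k y (A' *v d)"
      unfolding ch[symmetric] coord_vector_add[OF k(1) yy(2)] ..
    finally show ?thesis
      using yy(1) by (simp add: radiant_def[of "dev_chart \<alpha> y"] g1 g2 coord_vector_diff[OF k(1) yy(2)]
        coord_vector_minus[OF k(1) yy(2)])
  qed
  then show "\<exists>k\<in>\<C>. \<exists>N r. openB N \<and> x \<in> N \<and> N \<subseteq> U \<alpha> \<inter> fst k \<and> (\<forall>y\<in>N. restrict ?s (U \<alpha>) y = coord_vector \<C> k y r)"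
    using k(1) N(1-3) A(2-4) by (intro bexI[of _ k] exI[of _ "N \<inter> N'"] exI[of _ "- (A' *v d) - w"]) auto
qed simp

text \<open>
  The representatives of the class of \<open>Trans \<circ> a\<close>: it changes by the principal crossed homomorphism of \<open>w\<close>.
\<close>

definition hol_cocycle :: "real^'n \<Rightarrow> (real \<Rightarrow> 'b) set \<Rightarrow> real^'n" where
  "hol_cocycle w = (\<lambda>K\<in>carrier (fundamental_group B b).
     (linear_holonomy B \<C> b c K *v w - w) + Trans (affine_holonomy B \<C> b c K))"

lemma radiance_class_eq: "radiance_class B \<C> b c = range hol_cocycle"
  unfolding radiance_class_def group_H1_class_def principal_crossed_homs_def r_coset_def hol_cocycle_def
  by (auto simp: crossed_homs_def additive_group_def fun_eq_iff image_iff)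

text \<open>
  For \<open>c\<^sub>\<beta> = A c\<^sub>\<alpha> + d\<close> the value is the tangent vector with coordinates \<open>A w - w + d\<close> in \<open>c\<^sub>\<beta>\<close>.  Here \<open>d\<close> is
  the difference of the radiant fields, and \<open>A w\<close> in the coordinates \<open>c\<^sub>\<beta>\<close> is \<open>w\<close> in the coordinates \<open>c\<^sub>\<alpha>\<close>.
\<close>

lemma crossed_hom_cochain_value:
  assumes a: "\<alpha> \<in> I" "\<beta> \<in> I" and x: "x \<in> U \<alpha>" "x \<in> U \<beta>"
  shows "crossed_hom_cochain B \<C> c I U \<sigma> (hol_cocycle w) (\<alpha>, \<beta>) x =
    (radiant (dev_chart \<beta> x) x - coord_vector \<C> (dev_chart \<beta> x) x w) -
    (radiant (dev_chart \<alpha> x) x - coord_vector \<C> (dev_chart \<alpha> x) x w)"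
proof -
  let ?p = "\<sigma> \<alpha> x" and ?q = "\<sigma> \<beta> x" and ?k = "dev_chart \<alpha> x" and ?l = "dev_chart \<beta> x"
  note p = section_path[OF a(1) x(1)] and q = section_path[OF a(2) x(2)]
  note k = dev_chart[OF a(1) x(1)] and l = dev_chart[OF a(2) x(2)]
  obtain A d where A: "A \<in> GL_int" and g: "germ_eq B x ?l (affine_image A d ?k)"
    using germ_match[OF k(1) l(1) k(2) l(2)] .
  define K where "K = path_class B (?q +++ reversepath ?p)"
  have "path (?q +++ reversepath ?p)" "path_image (?q +++ reversepath ?p) \<subseteq> B"
    "pathstart (?q +++ reversepath ?p) = b" "pathfinish (?q +++ reversepath ?p) = b"
    using p q by (simp_all add: path_image_join)
  then have K: "K \<in> carrier (fundamental_group B b)"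
    unfolding K_def fundamental_group_def by auto
  have "affine_holonomy B \<C> b c K = (A, d)"
    unfolding K_def
    by (rule affine_holonomy_eq[OF c p(1-3) q(1-3) _ dev_path[OF a(1) x(1)] dev_path[OF a(2) x(2)] A])
      (use p(4) q(4) g in \<open>simp_all add: dev_chart_def\<close>)
  then have h: "hol_cocycle w K = (A *v w - w) + d"
    using K by (simp add: hol_cocycle_def linear_holonomy_def Trans_def)
  have "crossed_hom_cochain B \<C> c I U \<sigma> (hol_cocycle w) (\<alpha>, \<beta>) x = coord_vector \<C> ?l x ((A *v w - w) + d)"
    using a x parallel_transport_eq[OF q(1,2) dev_path[OF a(2) x(2)]] q(4)
    by (simp add: crossed_hom_cochain_def K_def[symmetric] h dev_chart_def pathfinish_def)
  also have "\<dots> = coord_vector \<C> ?l x (A *v w) - coord_vector \<C> ?l x w + coord_vector \<C> ?l x d"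
    by (simp only: coord_vector_add[OF l, symmetric] coord_vector_diff[OF l])
  finally have 1: "crossed_hom_cochain B \<C> c I U \<sigma> (hol_cocycle w) (\<alpha>, \<beta>) x =
    coord_vector \<C> ?l x (A *v w) - coord_vector \<C> ?l x w + coord_vector \<C> ?l x d" .
  obtain N where N: "openB N" "x \<in> N" "N \<subseteq> fst ?l \<inter> fst ?k" "\<forall>y\<in>N. snd ?l y = A *v snd ?k y + d"
    using g unfolding germ_eq_def by auto
  have t: "(transition ?k ?l has_derivative (*v) A) (at (snd ?k x))"
    by (rule affine_transition[OF k(1) N(1) _ N(2)]) (use N in auto)
  note ch = coord_vector_change[OF k(1) l(1) k(2) l(2) t]
  have "radiant ?l x = radiant ?k x + coord_vector \<C> ?l x d"
    using N(2,4) by (simp add: radiant_def ch coord_vector_add[OF l])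
  then show ?thesis unfolding 1 ch[of w] by simp
qed

text \<open>
  For every representative of the class of \<open>Trans \<circ> a\<close>, the cocycle \<open>z\<close> differs from its cochain by the
  coboundary of the flat fields of \<open>radiant_diff_flat\<close>.
\<close>

lemma radiance_obstruction_eq:
  assumes \<kappa>: "\<And>\<alpha>. \<alpha> \<in> I \<Longrightarrow> \<kappa> \<alpha> \<in> \<C> \<and> fst (\<kappa> \<alpha>) = U \<alpha>"
    and z: "z \<in> carrier (cech_Z1 (flat_TB B \<C>) I U)"
    and zE: "\<And>\<alpha> \<beta> x. \<alpha> \<in> I \<Longrightarrow> \<beta> \<in> I \<Longrightarrow> x \<in> U \<alpha> \<inter> U \<beta> \<Longrightarrow> z (\<alpha>, \<beta>) x = radiant (\<kappa> \<beta>) x - radiant (\<kappa> \<alpha>) x"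
  shows "radiance_obstruction B \<C> b c I U \<sigma> = cech_class (flat_TB B \<C>) I U z"
proof -
  interpret cech_cover openB TB.Flat I U
    using U TB.flat_presheaf by (simp add: cech_cover_def cech_cover_axioms_def)
  have "cech_class (flat_TB B \<C>) I U (crossed_hom_cochain B \<C> c I U \<sigma> (hol_cocycle w)) = cech_class (flat_TB B \<C>) I U z" for w
  proof -
    define u where "u = (\<lambda>\<alpha>\<in>I. \<lambda>x\<in>U \<alpha>. radiant (dev_chart \<alpha> x) x - radiant (\<kappa> \<alpha>) x - coord_vector \<C> (dev_chart \<alpha> x) x w)"
    have u: "u \<in> carrier (cech_C0 TB.Flat I U)"
      unfolding C0_iff u_def using radiant_diff_flat[OF \<kappa>] by simp
    have "crossed_hom_cochain B \<C> c I U \<sigma> (hol_cocycle w) = cech_delta0 TB.Flat I U u \<otimes>\<^bsub>cech_Z1 TB.Flat I U\<^esub> z"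
    proof (rule extensionalityI[of _ "I \<times> I"])
      show "crossed_hom_cochain B \<C> c I U \<sigma> (hol_cocycle w) \<in> extensional (I \<times> I)"
        by (simp add: crossed_hom_cochain_def)
      show "cech_delta0 TB.Flat I U u \<otimes>\<^bsub>cech_Z1 TB.Flat I U\<^esub> z \<in> extensional (I \<times> I)"
        by (simp add: Z1_mult cech_C1_def)
      fix p assume "p \<in> I \<times> I"
      then obtain \<alpha> \<beta> where p: "p = (\<alpha>, \<beta>)" and a: "\<alpha> \<in> I" "\<beta> \<in> I" by blast
      define V where "V = U \<alpha> \<inter> U \<beta>"
      have V: "openB V" using Op_cover2[OF a] by (simp add: V_def)
      have ua: "restrict (u \<mu>) V \<in> carrier (TB.Flat V)" if "\<mu> = \<alpha> \<or> \<mu> = \<beta>" for \<mu>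
        using TB.flat_restrict[OF _ V] u that a unfolding C0_iff V_def by blast
      show "crossed_hom_cochain B \<C> c I U \<sigma> (hol_cocycle w) p = (cech_delta0 TB.Flat I U u \<otimes>\<^bsub>cech_Z1 TB.Flat I U\<^esub> z) p"
        unfolding p Z1_mult C1_mult[OF a] V_def[symmetric]
      proof (rule extensionalityI[of _ V])
        fix x assume x: "x \<in> V"
        then have xU: "x \<in> U \<alpha>" "x \<in> U \<beta>" by (auto simp: V_def)
        have ka: "\<kappa> \<alpha> \<in> \<C>" "x \<in> fst (\<kappa> \<alpha>)" using \<kappa>[OF a(1)] xU by auto
        obtain r where r: "restrict (u \<alpha>) V x = coord_vector \<C> (\<kappa> \<alpha>) x r"
          using TB.flat_value[OF ua x ka] by blast
        define v where "v = inv\<^bsub>TB.Flat V\<^esub> (restrict (u \<alpha>) V)"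
        have v: "v x = - u \<alpha> x"
          unfolding v_def TB.flat_inv[OF V ua[OF disjI1[OF refl]] x ka r] coord_vector_minus[OF ka] r[symmetric]
          using x by simp
        have "cech_delta0 TB.Flat I U u (\<alpha>, \<beta>) = restrict (u \<beta>) V \<otimes>\<^bsub>TB.Flat V\<^esub> v"
          using a by (simp add: cech_delta0_def Let_def V_def v_def)
        then have "cech_delta0 TB.Flat I U u (\<alpha>, \<beta>) x = u \<beta> x - u \<alpha> x"
          using x v by (simp add: TB_mult)
        then show "crossed_hom_cochain B \<C> c I U \<sigma> (hol_cocycle w) (\<alpha>, \<beta>) x =
            (cech_delta0 TB.Flat I U u (\<alpha>, \<beta>) \<otimes>\<^bsub>TB.Flat V\<^esub> z (\<alpha>, \<beta>)) x"
          using x xU a zE[OF a, of x] crossed_hom_cochain_value[OF a xU, of w]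
          by (simp add: TB_mult u_def)
      qed (use a in \<open>simp_all add: crossed_hom_cochain_def V_def TB.flat_mult\<close>)
    qed
    then show ?thesis
      using cech_class_coboundary[OF _ u, of z] z unfolding flat_TB_eq by simp
  qed
  then have "(\<lambda>f. cech_class (flat_TB B \<C>) I U (crossed_hom_cochain B \<C> c I U \<sigma> f)) ` radiance_class B \<C> b c =
      {cech_class (flat_TB B \<C>) I U z}"
    unfolding radiance_class_eq by auto
  then show ?thesis by (simp add: radiance_obstruction_def group_to_cech_def)
qed

end

end

theorem theorem5p3:
  fixes B :: "'b::topological_space set" and \<A> :: "('b, real^'n) chart set"
    and I :: "'i set" and \<kappa> :: "'i \<Rightarrow> ('b, real^'n) chart"
    and b :: 'b and c :: "('b, real^'n) chart" and \<sigma> :: "'i \<Rightarrow> 'b \<Rightarrow> real \<Rightarrow> 'b"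
  assumes "integral_affine_manifold B \<A>" and "\<C> = int_affine_charts B \<A>"
    and "good_chart_cover B \<C> I \<kappa>"
    and "U = fst \<circ> \<kappa>"
    and "c \<in> \<C>" and "b \<in> fst c"
    and "univ_cover_sections B b I U \<sigma>"
  shows "w0_class B \<C> I \<kappa> \<in> carrier (cech_H1 (flat_HF B \<C>) I U) \<and>
    Phi B \<C> I U \<in> iso (cech_H1 (flat_HF B \<C>) I U) (cech_H1 (flat_TB B \<C>) I U) \<and>
    Phi B \<C> I U (w0_class B \<C> I \<kappa>) = radiance_obstruction B \<C> b c I U \<sigma>"
proof -
  interpret integral_affine_mfd B \<A> \<C> using assms(1,2) by unfold_locales
  have \<kappa>: "\<kappa> \<alpha> \<in> \<C>" if "\<alpha> \<in> I" for \<alpha> using assms(3) that by (simp add: good_chart_cover_def)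
  have U: "openB (U \<alpha>)" if "\<alpha> \<in> I" for \<alpha> using openB_chart[OF \<kappa>[OF that]] assms(4) by simp
  define z where "z = Phi_cochain \<C> I U (tau_cocycle \<C> I \<kappa>)"
  have tau: "tau_cocycle \<C> I \<kappa> \<in> carrier (cech_Z1 (flat_HF B \<C>) I U)"
    using tau_cocycle_Z1[of I \<kappa>] \<kappa> assms(4) by simp
  have w0: "w0_class B \<C> I \<kappa> = cech_class (flat_HF B \<C>) I U (tau_cocycle \<C> I \<kappa>)"
    by (simp add: w0_class_def assms(4))
  have Phi: "Phi B \<C> I U \<in> iso (cech_H1 (flat_HF B \<C>) I U) (cech_H1 (flat_TB B \<C>) I U)"
    "z \<in> carrier (cech_Z1 (flat_TB B \<C>) I U)" "Phi B \<C> I U (w0_class B \<C> I \<kappa>) = cech_class (flat_TB B \<C>) I U z"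
    using Phi_iso[of I U] U tau unfolding z_def w0 by blast+
  have "radiance_obstruction B \<C> b c I U \<sigma> = cech_class (flat_TB B \<C>) I U z"
  proof (rule radiance_obstruction_eq[OF assms(5-7) U _ Phi(2), of \<kappa>])
    show "z (\<alpha>, \<beta>) x = radiant (\<kappa> \<beta>) x - radiant (\<kappa> \<alpha>) x" if "\<alpha> \<in> I" "\<beta> \<in> I" "x \<in> U \<alpha> \<inter> U \<beta>" for \<alpha> \<beta> x
      using Phi_tau[of I \<kappa>, OF \<kappa> that(1,2)] that(3) unfolding z_def assms(4) by auto
  qed (use \<kappa> assms(4) in auto)
  moreover have "w0_class B \<C> I \<kappa> \<in> carrier (cech_H1 (flat_HF B \<C>) I U)"
    unfolding w0 cech_H1_def cech_class_def carrier_FactGroup using tau by blast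
  ultimately show ?thesis using Phi by simp
qed

end
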